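(* Let $u_0:[0,1]\to[0,1]$ be continuous and let $v_{0,-},v_{0,+}\in[0,1]$. For each positive integer $N$ let $M=N$ and $\epsilon=1/N$, and suppose the initial distribution of the process with generator $\mathbf L$ satisfies $\rho^{\epsilon}_{\pm}(0)=v_{0,\pm}$ and $\rho^{\epsilon}(x,0)=u_0(\epsilon x)$ for all $x\in\Lambda_N$. Then for any $r\in[0,1]$ and $t>0$, as $N\to\infty$, $\rho^{\epsilon}([Nr],N^2t)$ and $\rho^{\epsilon}_{\pm}(N^2t)$ have limits $u(r,t)$ and $v_{\pm}(t)$ respectively. Moreover $(u,v_-,v_+)$ is the unique solution of the following free boundary problem: find $u\in C^{2,1}([0,1]\times(0,\infty))$ and $v_{\pm}\in C^1(0,\infty)$, continuous at $t=0$, such that $$u_t=\tfrac12 u_{rr},\qquad u(1,t)=v_+(t),\quad u(0,t)=v_-(t)\quad (t>0),\qquad \lim_{t\downarrow 0}u(r,t)=u_0(r)\quad (r\in(0,1)),$$ where $\lim_{t\to0}v_{\pm}(t)=v_{0,\pm}$ and, for all $t>0$, $$v_-(t)=v_{0,-}+\lim_{l\to0}\lim_{t_0\to0}\int_{t_0}^t\tfrac12u_r(l,s)\,ds,\qquad v_+(t)=v_{0,+}-\lim_{l\to1}\lim_{t_0\to0}\int_{t_0}^t\tfrac12u_r(l,s)\,ds .$$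
   Context: For positive integers $N,M$ let $\Lambda_N=\{1,\dots,N\}$ and consider the continuous-time Markov jump process on $\Omega=\{0,1\}^{\Lambda_N}\times\{0,\dots,M\}\times\{0,\dots,M\}$, with elements $\omega=(\eta,n_-,n_+)$, $\eta=(\eta(x))_{x\in\Lambda_N}$, and generator $$\mathbf Lf(\omega)=\tfrac12\sum_{x=1}^{N-1}[f(\omega^{x,x+1})-f(\omega)]+c_N(\omega)[f(\omega^N)-f(\omega)]+c_1(\omega)[f(\omega^1)-f(\omega)].$$ Here $\omega^{x,x+1}$ is obtained from $\omega$ by exchanging $\eta(x)$ and $\eta(x+1)$. If $\eta(N)=1$, then $c_N(\omega)=\frac12(1-\frac{n_+}{M})$ and $\omega^N$ is obtained from $\omega$ by setting $\eta(N)$ to $0$ and replacing $n_+$ by $n_++1$; if $\eta(N)=0$, then $c_N(\omega)=\frac12\frac{n_+}{M}$ and $\omega^N$ is obtained by setting $\eta(N)$ to $1$ and replacing $n_+$ by $n_+-1$. $c_1(\omega)$ and $\omega^1$ are defined in the same way with $\eta(1),n_-$ in place of $\eta(N),n_+$. Let $\mathbf E^{\epsilon}$ denote expectation for this process. Put $\eta(0,t)=n_-(t)/M$, $\eta(N+1,t)=n_+(t)/M$, $\rho^{\epsilon}(x,t)=\mathbf E^{\epsilon}[\eta(x,t)]$ for $x\in\{0,1,\dots,N+1\}$, $\rho^{\epsilon}_-(t)=\rho^{\epsilon}(0,t)$ and $\rho^{\epsilon}_+(t)=\rho^{\epsilon}(N+1,t)$. $[\cdot]$ denotes the integer part. $C^{2,1}$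 means twice continuously differentiable in the space variable $r$ and once in time $t$. The limit $l\to0$ is from the right and $l\to 1$ from the left.
   Formalization: Uniqueness is asserted only among solutions with u bounded on [0,1] as t tends to 0 (the limit is shown to be one): without this it fails, since a solution started from the derivative of a Dirac mass at an interior point is a nonzero solution with zero data. *)

theory Defs
  imports "HOL-Probability.Probability"
begin

section \<open>Continuous-time Markov jump processes on a finite state space\<close>

definition transition_semigroup :: "'s set \<Rightarrow> (real \<Rightarrow> 's \<Rightarrow> 's \<Rightarrow> real) \<Rightarrow> bool" where
  "transition_semigroup S p \<longleftrightarrow>
     (\<forall>t\<ge>0. \<forall>x\<in>S. (\<forall>y\<in>S. 0 \<le> p t x y) \<and> (\<Sum>y\<in>S. p t x y) = 1) \<and>
     (\<forall>x\<in>S. \<forall>y\<in>S. p 0 x y = (if x = y then 1 else 0)) \<and>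
     (\<forall>s\<ge>0. \<forall>t\<ge>0. \<forall>x\<in>S. \<forall>y\<in>S. p (s + t) x y = (\<Sum>z\<in>S. p s x z * p t z y))"

definition has_generator ::
    "'s set \<Rightarrow> (real \<Rightarrow> 's \<Rightarrow> 's \<Rightarrow> real) \<Rightarrow> (('s \<Rightarrow> real) \<Rightarrow> 's \<Rightarrow> real) \<Rightarrow> bool" where
  "has_generator S p L \<longleftrightarrow>
     (\<forall>f. \<forall>x\<in>S. ((\<lambda>h. ((\<Sum>y\<in>S. p h x y * f y) - f x) / h) \<longlongrightarrow> L f x) (at_right 0))"

text \<open>The Markov property with respect to the natural filtration, in its elementary form: \<open>J\<close> is
  a finite set of observation times up to the present time \<open>s \<in> J\<close>, and \<open>a\<close> the observed values.
  No division by the probability of the conditioning event is needed.\<close>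

definition markov_property ::
    "'a measure \<Rightarrow> 's set \<Rightarrow> (real \<Rightarrow> 's \<Rightarrow> 's \<Rightarrow> real) \<Rightarrow> (real \<Rightarrow> 'a \<Rightarrow> 's) \<Rightarrow> bool" where
  "markov_property P S p X \<longleftrightarrow>
     (\<forall>J s h a w. finite J \<and> J \<subseteq> {0..s} \<and> s \<in> J \<and> 0 \<le> h \<and> (\<forall>j\<in>J. a j \<in> S) \<and> w \<in> S \<longrightarrow>
        measure P {\<xi> \<in> space P. (\<forall>j\<in>J. X j \<xi> = a j) \<and> X (s + h) \<xi> = w}
          = measure P {\<xi> \<in> space P. \<forall>j\<in>J. X j \<xi> = a j} * p h (a s) w)"

text \<open>Right-continuous with left limits for the discrete topology: piecewise constant, with finitely
  many jumps in bounded time intervals.\<close>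

definition jump_path :: "(real \<Rightarrow> 's) \<Rightarrow> bool" where
  "jump_path \<gamma> \<longleftrightarrow>
     (\<forall>t\<ge>0. eventually (\<lambda>s. \<gamma> s = \<gamma> t) (at_right t)) \<and>
     (\<forall>t>0. \<exists>w. eventually (\<lambda>s. \<gamma> s = w) (at_left t))"

definition markov_jump_process ::
    "'a measure \<Rightarrow> 's set \<Rightarrow> (('s \<Rightarrow> real) \<Rightarrow> 's \<Rightarrow> real) \<Rightarrow> (real \<Rightarrow> 'a \<Rightarrow> 's) \<Rightarrow> bool" where
  "markov_jump_process P S L X \<longleftrightarrow>
     prob_space P \<and> finite S \<and>
     (\<forall>t\<ge>0. X t \<in> P \<rightarrow>\<^sub>M count_space S) \<and>
     (AE \<xi> in P. jump_path (\<lambda>t. X t \<xi>)) \<and>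
     (\<exists>p. transition_semigroup S p \<and> has_generator S p L \<and> markov_property P S p X)"

section \<open>Exclusion process in contact with two finite reservoirs\<close>

type_synonym state = "(nat \<Rightarrow> nat) \<times> nat \<times> nat"

definition states :: "nat \<Rightarrow> nat \<Rightarrow> state set" where
  "states N M = ({1..N} \<rightarrow>\<^sub>E {0, 1}) \<times> {0..M} \<times> {0..M}"

fun swap :: "nat \<Rightarrow> state \<Rightarrow> state" where
  "swap x (\<eta>, nm, np) = (\<eta>(x := \<eta> (x + 1), x + 1 := \<eta> x), nm, np)"

definition rate :: "nat \<Rightarrow> nat \<Rightarrow> nat \<Rightarrow> real" where
  "rate M e n = (if e = 1 then 1/2 * (1 - real n / real M) else 1/2 * (real n / real M))"

text \<open>The reservoir contents \<open>M + 1\<close> and (truncated) \<open>0 - 1\<close> below only occur together with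
  rate \<open>0\<close>.\<close>

definition refill :: "nat \<Rightarrow> nat \<Rightarrow> nat" where
  "refill e n = (if e = 1 then n + 1 else n - 1)"

fun rate_right :: "nat \<Rightarrow> nat \<Rightarrow> state \<Rightarrow> real" where
  "rate_right N M (\<eta>, nm, np) = rate M (\<eta> N) np"

fun flip_right :: "nat \<Rightarrow> state \<Rightarrow> state" where
  "flip_right N (\<eta>, nm, np) = (\<eta>(N := 1 - \<eta> N), nm, refill (\<eta> N) np)"

fun rate_left :: "nat \<Rightarrow> state \<Rightarrow> real" where
  "rate_left M (\<eta>, nm, np) = rate M (\<eta> 1) nm"

fun flip_left :: "state \<Rightarrow> state" where
  "flip_left (\<eta>, nm, np) = (\<eta>(1 := 1 - \<eta> 1), refill (\<eta> 1) nm, np)"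

definition generator :: "nat \<Rightarrow> nat \<Rightarrow> (state \<Rightarrow> real) \<Rightarrow> state \<Rightarrow> real" where
  "generator N M f \<omega> =
     1/2 * (\<Sum>x = 1..<N. f (swap x \<omega>) - f \<omega>)
     + rate_right N M \<omega> * (f (flip_right N \<omega>) - f \<omega>)
     + rate_left M \<omega> * (f (flip_left \<omega>) - f \<omega>)"

fun occupation :: "nat \<Rightarrow> nat \<Rightarrow> state \<Rightarrow> nat \<Rightarrow> real" where
  "occupation N M (\<eta>, nm, np) x =
     (if x = 0 then real nm / real M
      else if x = N + 1 then real np / real M
      else real (\<eta> x))"

definition mean_occupation ::
    "nat \<Rightarrow> nat \<Rightarrow> 'a measure \<Rightarrow> (real \<Rightarrow> 'a \<Rightarrow> state) \<Rightarrow> nat \<Rightarrow> real \<Rightarrow> real" where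
  "mean_occupation N M P X x t = (\<integral>\<xi>. occupation N M (X t \<xi>) x \<partial>P)"

section \<open>The free boundary problem\<close>

text \<open>Functions \<open>u r t\<close> in \<open>C\<^sup>2\<^sup>,\<^sup>1([0,1] \<times> (0,\<infinity>))\<close>, together with their derivatives
  \<open>ur\<close>, \<open>urr\<close>, \<open>ut\<close>; the space derivatives are one-sided at \<open>r = 0\<close> and \<open>r = 1\<close>.\<close>

definition C21_with ::
    "(real \<Rightarrow> real \<Rightarrow> real) \<Rightarrow> (real \<Rightarrow> real \<Rightarrow> real) \<Rightarrow> (real \<Rightarrow> real \<Rightarrow> real) \<Rightarrow> (real \<Rightarrow> real \<Rightarrow> real) \<Rightarrow> bool"
  where
  "C21_with u ur urr ut \<longleftrightarrow>
     (\<forall>r\<in>{0..1}. \<forall>t>0.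
        ((\<lambda>r. u r t) has_real_derivative ur r t) (at r within {0..1}) \<and>
        ((\<lambda>r. ur r t) has_real_derivative urr r t) (at r within {0..1}) \<and>
        ((\<lambda>t. u r t) has_real_derivative ut r t) (at t)) \<and>
     (\<forall>g\<in>{u, ur, urr, ut}. continuous_on ({0..1} \<times> {0<..}) (\<lambda>(r, t). g r t))"

text \<open>\<open>lim\<^sub>l lim\<^sub>s F l s = c\<close>, where the inner limits have to exist for all \<open>l\<close> close to
  the limit point.\<close>

definition iterated_limit ::
    "('b \<Rightarrow> 'c \<Rightarrow> real) \<Rightarrow> real \<Rightarrow> 'b filter \<Rightarrow> 'c filter \<Rightarrow> bool" where
  "iterated_limit F c A B \<longleftrightarrow>
     (\<exists>G. eventually (\<lambda>l. (F l \<longlongrightarrow> G l) B) A \<and> (G \<longlongrightarrow> c) A)"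

definition free_boundary_solution ::
    "(real \<Rightarrow> real) \<Rightarrow> real \<Rightarrow> real \<Rightarrow>
     (real \<Rightarrow> real \<Rightarrow> real) \<Rightarrow> (real \<Rightarrow> real) \<Rightarrow> (real \<Rightarrow> real) \<Rightarrow> bool" where
  "free_boundary_solution u0 v0m v0p u vm vp \<longleftrightarrow>
     (\<exists>ur urr ut.
        C21_with u ur urr ut \<and>
        vm C1_differentiable_on {0<..} \<and> vp C1_differentiable_on {0<..} \<and>
        (vm \<longlongrightarrow> v0m) (at_right 0) \<and> (vp \<longlongrightarrow> v0p) (at_right 0) \<and>
        (\<forall>r\<in>{0..1}. \<forall>t>0. ut r t = 1/2 * urr r t) \<and>
        (\<forall>t>0. u 1 t = vp t \<and> u 0 t = vm t) \<and>
        (\<forall>r\<in>{0<..<1}. ((\<lambda>t. u r t) \<longlongrightarrow> u0 r) (at_right 0)) \<and>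
        (\<forall>t>0. \<exists>c. iterated_limit (\<lambda>l t0. integral {t0..t} (\<lambda>s. 1/2 * ur l s)) c
                      (at_right 0) (at_right 0) \<and> vm t = v0m + c) \<and>
        (\<forall>t>0. \<exists>c. iterated_limit (\<lambda>l t0. integral {t0..t} (\<lambda>s. 1/2 * ur l s)) c
                      (at_left 1) (at_right 0) \<and> vp t = v0p - c))"

text \<open>The initial datum is attained only pointwise in \<open>(0,1)\<close>, and \<open>u\<close> need not have a limit at the
  corners \<open>(0,0)\<close>, \<open>(1,0)\<close>, since \<open>u0 0 = v0m\<close> and \<open>u0 1 = v0p\<close> are not assumed.  Uniqueness is
  therefore understood among solutions that stay bounded as \<open>t \<down> 0\<close>: without this, the solution
  started from the derivative of a Dirac mass at an interior point is a nonzero solution with zero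
  data, since the space derivative of the heat kernel tends to \<open>0\<close> pointwise as \<open>t \<down> 0\<close>.\<close>

definition bounded_near_initial_time :: "(real \<Rightarrow> real \<Rightarrow> real) \<Rightarrow> bool" where
  "bounded_near_initial_time u \<longleftrightarrow>
     (\<exists>C. eventually (\<lambda>t. \<forall>r\<in>{0..1}. \<bar>u r t\<bar> \<le> C) (at_right 0))"

end

theory Submission
  imports Defs "HOL-Complex_Analysis.Great_Picard"
begin

text \<open>The exclusion rule is invisible to one-point functions: applying the generator to an occupation
variable gives a linear combination of occupation variables, the two reservoir fillings included.
The mean occupations in rescaled time therefore solve a closed linear system \<open>w' = L w\<close> on the
chain \<open>0, \<dots>, N + 1\<close>, where \<open>L\<close> is a discrete Laplacian in the bulk and a first difference at the
reservoirs (\<open>generator_occupation\<close>, \<open>mean_occupation_heat_flow\<close>). What has to be shown is that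
this scheme for the heat equation, with a boundary that carries mass, converges. Existence for the
limit problem is not presupposed: the solution is obtained as a limit of the chains.

Compactness. \<open>L\<close> is symmetric and nonpositive for the inner product that gives mass \<open>1\<close> to each
reservoir and \<open>1/N\<close> to each bulk site. Hence \<open>\<parallel>w\<parallel>\<^sup>2 + 2 t D(w) + 2 t\<^sup>2 \<parallel>L w\<parallel>\<^sup>2\<close>, where \<open>D\<close> is the
Dirichlet form, decreases in time (\<open>energy_decay\<close>). As \<open>L w\<close> solves the same system, iterating
this bounds \<open>w\<close>, \<open>L w\<close> and \<open>L\<^sup>2 w\<close> and their Dirichlet forms for \<open>t \<ge> \<tau>\<close>, uniformly in \<open>N\<close>. In one
dimension that makes \<open>w\<close> and the speed \<open>L w\<close> equicontinuous, so a subsequence converges pointwise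
to some \<open>u\<close> and \<open>G\<close>. Summing the equation over sites instead of differencing it, the limit obeys
\<open>u\<^sub>t = G\<close> and \<open>u\<^sub>r(r) = 2 G(0) + 2 \<integral>\<^sub>0\<^sup>r G\<close>, and \<open>u(r) = u(0) + \<integral>\<^sub>0\<^sup>r u\<^sub>r\<close>. Regularity up to the
boundary, the heat equation and the boundary laws \<open>v\<^sub>-' = u\<^sub>r(0) / 2\<close>, \<open>v\<^sub>+' = - u\<^sub>r(1) / 2\<close> can all
be read off from these formulas.

Initial data. In the bulk a parabola is a supersolution and, by the maximum principle, a barrier
(\<open>initial_layer_bulk\<close>). At a reservoir, where \<open>u\<^sub>0\<close> need not match the initial filling, testing the
equation with a hat function of width \<open>\<surd>t\<close> shows that the filling moves by \<open>O(\<surd>t)\<close>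
(\<open>initial_layer_reservoir\<close>).

Uniqueness. For bounded solutions, mass balance on \<open>[0, l]\<close> turns the iterated limits of the flux
into the boundary laws above (\<open>iterated_limit_iff\<close>). The difference \<open>w\<close> of two solutions then has
the decreasing energy \<open>w(0)\<^sup>2 + w(1)\<^sup>2 + \<integral> w\<^sup>2\<close>, which vanishes as \<open>t\<close> tends to \<open>0\<close>. Since all
subsequential limits agree, the whole sequence converges.\<close>

section \<open>Expectations under a Markov jump process\<close>

lemma expectation_finite_range:
  fixes f :: "'s \<Rightarrow> real"
  assumes "prob_space P" "finite S" "Y \<in> P \<rightarrow>\<^sub>M count_space S"
  shows "(\<integral>\<xi>. f (Y \<xi>) \<partial>P) = (\<Sum>a\<in>S. measure P {\<xi> \<in> space P. Y \<xi> = a} * f a)"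
proof -
  interpret prob_space P by fact
  have sets: "{\<xi> \<in> space P. Y \<xi> = a} \<in> sets P" if "a \<in> S" for a
  proof -
    have "Y -` {a} \<inter> space P \<in> sets P"
      using assms(3) that by (intro measurable_sets[of Y P "count_space S"]) auto
    also have "Y -` {a} \<inter> space P = {\<xi> \<in> space P. Y \<xi> = a}" by auto
    finally show ?thesis .
  qed
  have inS: "Y \<xi> \<in> S" if "\<xi> \<in> space P" for \<xi>
    using measurable_space[OF assms(3) that] by simp
  have "(\<integral>\<xi>. f (Y \<xi>) \<partial>P) = (\<integral>\<xi>. (\<Sum>a\<in>S. indicator {\<xi> \<in> space P. Y \<xi> = a} \<xi> * f a) \<partial>P)"
  proof (intro Bochner_Integration.integral_cong refl)
    fix \<xi> assume "\<xi> \<in> space P"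
    then have "(\<Sum>a\<in>S. indicator {\<xi> \<in> space P. Y \<xi> = a} \<xi> * f a)
        = (\<Sum>a\<in>S. if Y \<xi> = a then f a else 0)"
      by (intro sum.cong refl) (auto simp: indicator_def)
    also have "\<dots> = f (Y \<xi>)"
      using assms(2) inS[OF \<open>\<xi> \<in> space P\<close>] by simp
    finally show "f (Y \<xi>) = (\<Sum>a\<in>S. indicator {\<xi> \<in> space P. Y \<xi> = a} \<xi> * f a)" ..
  qed
  also have "\<dots> = (\<Sum>a\<in>S. (\<integral>\<xi>. indicator {\<xi> \<in> space P. Y \<xi> = a} \<xi> * f a \<partial>P))"
    using sets by (intro Bochner_Integration.integral_sum) (auto simp: less_top[symmetric])
  also have "\<dots> = (\<Sum>a\<in>S. measure P {\<xi> \<in> space P. Y \<xi> = a} * f a)"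
    using sets by (intro sum.cong refl) (auto simp: Int_def conj_commute intro!: arg_cong[where f="measure P"])
  finally show ?thesis .
qed

text \<open>The generator only controls right difference quotients at time \<open>0\<close>. From the right this is enough;
a left difference quotient at \<open>s\<close> is an average over the earlier law \<open>\<pi> (s - h)\<close>, so left continuity
of \<open>\<pi>\<close> is needed as well. It holds because the quotients converge at each of the finitely many
states, so that one step of length \<open>h\<close> changes expectations by \<open>O(h)\<close> whatever the starting law.\<close>

lemma forward_equation_of_semigroup:
  fixes \<pi> :: "real \<Rightarrow> 's \<Rightarrow> real"
  assumes S: "finite S" and gen: "has_generator S p L"
    and pi: "\<And>s a. s \<ge> 0 \<Longrightarrow> a \<in> S \<Longrightarrow> 0 \<le> \<pi> s a \<and> \<pi> s a \<le> 1"
    and step: "\<And>s h w. s \<ge> 0 \<Longrightarrow> h \<ge> 0 \<Longrightarrow> w \<in> S \<Longrightarrow> \<pi> (s + h) w = (\<Sum>a\<in>S. \<pi> s a * p h a w)"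
    and t: "0 \<le> t"
  shows "((\<lambda>t. \<Sum>a\<in>S. \<pi> t a * f a) has_real_derivative (\<Sum>a\<in>S. \<pi> t a * L f a)) (at t within {0..})"
proof -
  define D where "D = (\<lambda>f h a. ((\<Sum>y\<in>S. p h a y * f y) - f a) / h)"
  define m where "m = (\<lambda>f t. \<Sum>a\<in>S. \<pi> t a * f a)"
  have D: "((\<lambda>h. D f h a) \<longlongrightarrow> L f a) (at_right 0)" if "a \<in> S" for f a
    using gen that unfolding has_generator_def D_def by auto
  have increment: "m f (s + h) - m f s = h * (\<Sum>a\<in>S. \<pi> s a * D f h a)"
    if "s \<ge> 0" "h > 0" for f s h
  proof -
    have "m f (s + h) = (\<Sum>w\<in>S. \<Sum>a\<in>S. \<pi> s a * p h a w * f w)"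
      using that step by (simp add: m_def sum_distrib_right)
    also have "\<dots> = (\<Sum>a\<in>S. \<pi> s a * (\<Sum>w\<in>S. p h a w * f w))"
      by (subst sum.swap) (simp add: sum_distrib_left mult.assoc)
    finally have "m f (s + h) - m f s = (\<Sum>a\<in>S. \<pi> s a * ((\<Sum>w\<in>S. p h a w * f w) - f a))"
      by (simp add: m_def sum_subtractf right_diff_distrib)
    also have "\<dots> = h * (\<Sum>a\<in>S. \<pi> s a * D f h a)"
      using that by (simp add: D_def sum_distrib_left)
    finally show ?thesis .
  qed
  have right: "((\<lambda>h. (m f (s + h) - m f s) / h) \<longlongrightarrow> m (L f) s) (at_right 0)"
    if "s \<ge> 0" for f s
  proof (rule Lim_transform_eventually)
    show "((\<lambda>h. \<Sum>a\<in>S. \<pi> s a * D f h a) \<longlongrightarrow> m (L f) s) (at_right 0)"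
      unfolding m_def by (intro tendsto_sum tendsto_mult tendsto_const D)
    show "eventually (\<lambda>h. (\<Sum>a\<in>S. \<pi> s a * D f h a) = (m f (s + h) - m f s) / h) (at_right 0)"
      using eventually_at_right_less[of 0]
      by eventually_elim (use that in \<open>simp add: increment\<close>)
  qed
  have less: "eventually (\<lambda>h. 0 < h \<and> h < s) (at_right 0)" if "0 < s" for s :: real
    using that by (auto simp: eventually_at_right_field)
  have left_cont: "((\<lambda>h. \<pi> (s - h) w) \<longlongrightarrow> \<pi> s w) (at_right 0)"
    if "0 < s" "w \<in> S" for s w
  proof -
    define f where "f = (\<lambda>y. if y = w then 1 else 0 :: real)"
    have mf: "m f t = \<pi> t w" for t
      using S that by (simp add: m_def f_def if_distrib cong: if_cong)
    have "((\<lambda>h. h * (\<Sum>a\<in>S. \<bar>D f h a\<bar>)) \<longlongrightarrow> 0 * (\<Sum>a\<in>S. \<bar>L f a\<bar>)) (at_right 0)"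
      by (intro tendsto_mult tendsto_sum tendsto_rabs D tendsto_ident_at)
    then have lim: "((\<lambda>h. h * (\<Sum>a\<in>S. \<bar>D f h a\<bar>)) \<longlongrightarrow> 0) (at_right 0)" by simp
    have "eventually (\<lambda>h. norm (\<pi> (s - h) w - \<pi> s w) \<le> h * (\<Sum>a\<in>S. \<bar>D f h a\<bar>)) (at_right 0)"
      using less[OF that(1)]
    proof eventually_elim
      case (elim h)
      have "\<pi> s w - \<pi> (s - h) w = h * (\<Sum>a\<in>S. \<pi> (s - h) a * D f h a)"
        using increment[of "s - h" h f] elim by (simp add: mf)
      then have "norm (\<pi> (s - h) w - \<pi> s w) = h * \<bar>\<Sum>a\<in>S. \<pi> (s - h) a * D f h a\<bar>"
        using elim by (simp add: abs_minus_commute abs_mult)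
      also have "\<dots> \<le> h * (\<Sum>a\<in>S. \<bar>\<pi> (s - h) a * D f h a\<bar>)"
        using elim by (intro mult_left_mono sum_abs) auto
      also have "\<dots> \<le> h * (\<Sum>a\<in>S. \<bar>D f h a\<bar>)"
        using elim pi[of "s - h"]
        by (intro mult_left_mono sum_mono) (auto simp: abs_mult intro!: mult_left_le_one_le)
      finally show ?case .
    qed
    then have "((\<lambda>h. \<pi> (s - h) w - \<pi> s w) \<longlongrightarrow> 0) (at_right 0)"
      by (rule Lim_null_comparison[OF _ lim])
    then show ?thesis by (rule LIM_zero_cancel)
  qed
  have left: "((\<lambda>h. (m f s - m f (s - h)) / h) \<longlongrightarrow> m (L f) s) (at_right 0)"
    if "0 < s" for f s
  proof (rule Lim_transform_eventually)
    show "((\<lambda>h. \<Sum>a\<in>S. \<pi> (s - h) a * D f h a) \<longlongrightarrow> m (L f) s) (at_right 0)"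
      unfolding m_def by (intro tendsto_sum tendsto_mult D left_cont that)
    show "eventually (\<lambda>h. (\<Sum>a\<in>S. \<pi> (s - h) a * D f h a) = (m f s - m f (s - h)) / h) (at_right 0)"
      using less[OF that]
    proof eventually_elim
      case (elim h)
      then show ?case using increment[of "s - h" h f] by simp
    qed
  qed
  have at_right: "((\<lambda>y. (m f y - m f s) / (y - s)) \<longlongrightarrow> m (L f) s) (at_right s)" if "0 \<le> s" for s
    using right[OF that, of f] by (subst at_right_to_0) (simp add: filterlim_filtermap add.commute)
  have at_left: "((\<lambda>y. (m f y - m f s) / (y - s)) \<longlongrightarrow> m (L f) s) (at_left s)" if "0 < s" for s
  proof -
    have eq: "(m f s - m f (s - h)) / h = (m f (- (h - s)) - m f s) / (- (h - s) - s)" for h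
    proof -
      have "- (h - s) - s = - h" "- (h - s) = s - h" by simp_all
      then show ?thesis by (metis minus_diff_eq minus_divide_divide)
    qed
    show ?thesis
      unfolding filterlim_at_left_to_right at_right_to_0[of "- s"] filterlim_filtermap
      using left[OF that, of f] unfolding eq by simp
  qed
  have "((\<lambda>y. (m f y - m f t) / (y - t)) \<longlongrightarrow> m (L f) t) (at t within {0..})"
  proof (cases "t = 0")
    case True
    then show ?thesis using at_right[of 0] by (simp add: at_within_Ici_at_right)
  next
    case False
    then have "at t within {0..} = at t"
      using t by (intro at_within_interior) auto
    then show ?thesis
      using at_left[of t] at_right[of t] False t by (simp add: filterlim_at_split)
  qed
  then show ?thesis
    by (simp add: m_def has_field_derivative_iff)
qed

text \<open>For a single observation time, the Markov property says that the one-time laws evolve by the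
transition semigroup.\<close>

lemma expectation_has_derivative:
  assumes proc: "markov_jump_process P S L X" and t: "0 \<le> t"
  shows "((\<lambda>t. \<integral>\<xi>. f (X t \<xi>) \<partial>P) has_real_derivative (\<integral>\<xi>. L f (X t \<xi>) \<partial>P)) (at t within {0..})"
proof -
  from proc obtain p where P: "prob_space P" and S: "finite S"
    and X: "\<And>t. t \<ge> 0 \<Longrightarrow> X t \<in> P \<rightarrow>\<^sub>M count_space S"
    and gen: "has_generator S p L" and markov: "markov_property P S p X"
    unfolding markov_jump_process_def by auto
  interpret prob_space P by fact
  define \<pi> where "\<pi> = (\<lambda>t a. measure P {\<xi> \<in> space P. X t \<xi> = a})"
  have E: "(\<integral>\<xi>. f (X t \<xi>) \<partial>P) = (\<Sum>a\<in>S. \<pi> t a * f a)" if "t \<ge> 0" for t f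
    unfolding \<pi>_def by (rule expectation_finite_range[OF P S X[OF that]])
  have step: "\<pi> (s + h) w = (\<Sum>a\<in>S. \<pi> s a * p h a w)" if "s \<ge> 0" "h \<ge> 0" "w \<in> S" for s h w
  proof -
    have sets: "{\<xi> \<in> space P. X t \<xi> = a} \<in> sets P" if "a \<in> S" "t \<ge> 0" for a t
    proof -
      have "X t -` {a} \<inter> space P \<in> sets P"
        using X that by (intro measurable_sets[of "X t" P "count_space S"]) auto
      also have "X t -` {a} \<inter> space P = {\<xi> \<in> space P. X t \<xi> = a}" by auto
      finally show ?thesis .
    qed
    have inS: "X s \<xi> \<in> S" if "\<xi> \<in> space P" for \<xi>
      using measurable_space[OF X that] \<open>s \<ge> 0\<close> by simp
    have "{\<xi> \<in> space P. X (s + h) \<xi> = w}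
        = (\<Union>a\<in>S. {\<xi> \<in> space P. X s \<xi> = a \<and> X (s + h) \<xi> = w})"
      using inS by auto
    moreover have "{\<xi> \<in> space P. X s \<xi> = a \<and> X (s + h) \<xi> = w} \<in> sets P" if "a \<in> S" for a
    proof -
      have "{\<xi> \<in> space P. X s \<xi> = a} \<inter> {\<xi> \<in> space P. X (s + h) \<xi> = w} \<in> sets P"
        using sets that \<open>s \<ge> 0\<close> \<open>h \<ge> 0\<close> \<open>w \<in> S\<close> by auto
      then show ?thesis by (simp add: Collect_conj_eq[symmetric] Int_def conj_ac cong: conj_cong)
    qed
    ultimately have "\<pi> (s + h) w = measure P (\<Union>a\<in>S. {\<xi> \<in> space P. X s \<xi> = a \<and> X (s + h) \<xi> = w})"
      and "(\<lambda>a. {\<xi> \<in> space P. X s \<xi> = a \<and> X (s + h) \<xi> = w}) ` S \<subseteq> sets P"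
      unfolding \<pi>_def by auto
    then have "\<pi> (s + h) w = (\<Sum>a\<in>S. measure P {\<xi> \<in> space P. X s \<xi> = a \<and> X (s + h) \<xi> = w})"
      using finite_measure_finite_Union[OF S, of "\<lambda>a. {\<xi> \<in> space P. X s \<xi> = a \<and> X (s + h) \<xi> = w}"]
      by (auto simp: disjoint_family_on_def)
    also have "\<dots> = (\<Sum>a\<in>S. \<pi> s a * p h a w)"
    proof (intro sum.cong refl)
      fix a assume "a \<in> S"
      then show "measure P {\<xi> \<in> space P. X s \<xi> = a \<and> X (s + h) \<xi> = w} = \<pi> s a * p h a w"
        using markov[unfolded markov_property_def, rule_format, of "{s}" s h "\<lambda>_. a" w] that
        by (simp add: \<pi>_def)
    qed
    finally show ?thesis .
  qed
  have A: "((\<lambda>t. \<Sum>a\<in>S. \<pi> t a * f a) has_real_derivative (\<Sum>a\<in>S. \<pi> t a * L f a)) (at t within {0..})"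
    by (rule forward_equation_of_semigroup[OF S gen _ step t]) (auto simp: \<pi>_def)
  show ?thesis
    unfolding E[OF t]
    by (rule has_field_derivative_transform_within[OF A zero_less_one]) (use t in \<open>auto simp: E\<close>)
qed

section \<open>The closed equation for the mean occupations\<close>

text \<open>The operator \<open>L\<close> of the mean occupations in rescaled time \<open>N\<^sup>2 t\<close>, with the reservoirs as sites \<open>0\<close>
and \<open>N + 1\<close>. A reservoir filling has the factor \<open>N\<close> instead of \<open>N\<^sup>2\<close>, because one particle changes
it by \<open>1/N\<close>.\<close>

definition chain_op :: "nat \<Rightarrow> (nat \<Rightarrow> real) \<Rightarrow> nat \<Rightarrow> real" where
  "chain_op N f x =
     (if x = 0 then real N / 2 * (f 1 - f 0)
      else if x = N + 1 then real N / 2 * (f N - f (N + 1))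
      else (real N)\<^sup>2 / 2 * ((f (x + 1) - f x) - (f x - f (x - 1))))"

definition heat_flow :: "nat \<Rightarrow> (nat \<Rightarrow> real \<Rightarrow> real) \<Rightarrow> bool" where
  "heat_flow N w \<longleftrightarrow>
     (\<forall>x\<le>N + 1. \<forall>t\<ge>0. (w x has_real_derivative chain_op N (\<lambda>y. w y t) x) (at t within {0..}))"

lemma chain_op_linear:
  "chain_op N (\<lambda>y. a * f y + b * g y) x = a * chain_op N f x + b * chain_op N g x"
  by (auto simp: chain_op_def algebra_simps add_divide_distrib diff_divide_distrib)

text \<open>Summed over both occupation values of the end site, the jump rates are affine: with occupation \<open>e\<close>
and filling \<open>v\<close>, a gain \<open>(1 - e) v / 2\<close> and a loss \<open>e (1 - v) / 2\<close> leave \<open>(v - e) / 2\<close>. In the bulk an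
exchange across a bond replaces an occupation by that of the neighbour.\<close>

lemma generator_occupation:
  assumes N: "0 < N" and \<omega>: "\<omega> \<in> states N N" and x: "x \<le> N + 1"
  shows "generator N N (\<lambda>\<omega>. occupation N N \<omega> x) \<omega> = chain_op N (occupation N N \<omega>) x / (real N)\<^sup>2"
proof -
  obtain \<eta> nm np where eq: "\<omega> = (\<eta>, nm, np)" by (cases \<omega>)
  from \<omega> have eta: "\<eta> y = 0 \<or> \<eta> y = 1" if "1 \<le> y" "y \<le> N" for y
    using that by (auto simp: eq states_def PiE_def Pi_def)
  consider "x = 0" | "x = N + 1" | "1 \<le> x" "x \<le> N" using x by linarith
  then show ?thesis
  proof cases
    case 1
    show ?thesis
      using eta[of 1] N
      by (cases nm) (auto simp: 1 eq generator_def chain_op_def rate_def refill_def field_simps power2_eq_square)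
  next
    case 2
    show ?thesis
      using eta[of N] N
      by (cases np) (auto simp: 2 eq generator_def chain_op_def rate_def refill_def field_simps power2_eq_square)
  next
    case 3
    have occ: "occupation N N (\<zeta>, a, b) x = real (\<zeta> x)" for \<zeta> a b
      using 3 by simp
    have "(\<Sum>y = 1..<N. occupation N N (swap y \<omega>) x - occupation N N \<omega> x)
        = (\<Sum>y = 1..<N. (if y = x then real (\<eta> (x + 1)) - real (\<eta> x) else 0)
            + (if y = x - 1 then real (\<eta> (x - 1)) - real (\<eta> x) else 0))"
      using 3 by (intro sum.cong refl) (auto simp: eq occ)
    also have "\<dots> = (if x < N then real (\<eta> (x + 1)) - real (\<eta> x) else 0)
        + (if 1 < x then real (\<eta> (x - 1)) - real (\<eta> x) else 0)"
      using 3 by (auto simp: sum.distrib)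
    finally have swaps: "(\<Sum>y = 1..<N. occupation N N (swap y \<omega>) x - occupation N N \<omega> x) = \<dots>" .
    have right: "rate_right N N \<omega> * (occupation N N (flip_right N \<omega>) x - occupation N N \<omega> x)
        = (if x = N then (real np / real N - real (\<eta> N)) / 2 else 0)"
      using eta[of N] N 3 by (auto simp: eq rate_def field_simps)
    have left: "rate_left N \<omega> * (occupation N N (flip_left \<omega>) x - occupation N N \<omega> x)
        = (if x = 1 then (real nm / real N - real (\<eta> 1)) / 2 else 0)"
      using eta[of 1] N 3 by (auto simp: eq rate_def field_simps)
    have bulk: "occupation N N \<omega> (x + 1) = (if x < N then real (\<eta> (x + 1)) else real np / real N)"
      "occupation N N \<omega> (x - 1) = (if 1 < x then real (\<eta> (x - 1)) else real nm / real N)"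
      "occupation N N \<omega> x = real (\<eta> x)"
      using 3 by (auto simp: eq)
    have "chain_op N (occupation N N \<omega>) x / (real N)\<^sup>2
        = ((occupation N N \<omega> (x + 1) - occupation N N \<omega> x)
            - (occupation N N \<omega> x - occupation N N \<omega> (x - 1))) / 2"
      using 3 N by (simp add: chain_op_def)
    also have "\<dots> = 1/2 * (\<Sum>y = 1..<N. occupation N N (swap y \<omega>) x - occupation N N \<omega> x)
        + rate_right N N \<omega> * (occupation N N (flip_right N \<omega>) x - occupation N N \<omega> x)
        + rate_left N \<omega> * (occupation N N (flip_left \<omega>) x - occupation N N \<omega> x)"
      unfolding swaps right left unfolding bulk using 3 by (auto simp: field_simps)
    finally show ?thesis by (simp add: generator_def)
  qed
qed

lemma occupation_range:
  assumes "\<omega> \<in> states N N" "x \<le> N + 1"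
  shows "0 \<le> occupation N N \<omega> x" "occupation N N \<omega> x \<le> 1"
proof -
  obtain \<eta> nm np where eq: "\<omega> = (\<eta>, nm, np)" by (cases \<omega>)
  have eta: "\<eta> x = 0 \<or> \<eta> x = 1" if "x \<noteq> 0" "x \<noteq> N + 1"
    using assms that by (auto simp: eq states_def PiE_def Pi_def)
  have n: "nm \<le> N" "np \<le> N" using assms by (auto simp: eq states_def)
  show "0 \<le> occupation N N \<omega> x" "occupation N N \<omega> x \<le> 1"
    using eta n by (auto simp: eq divide_le_eq_1)
qed

lemma chain_op_sum:
  assumes "finite A"
  shows "chain_op N (\<lambda>y. \<Sum>a\<in>A. c a * f a y) x = (\<Sum>a\<in>A. c a * chain_op N (f a) x)"
  using assms
proof (induction A)
  case empty
  then show ?case by (simp add: chain_op_def)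
next
  case (insert a A)
  then show ?case
    using chain_op_linear[of N "c a" "f a" 1 "\<lambda>y. \<Sum>a\<in>A. c a * f a y" x] by simp
qed

context
  fixes N :: nat and P :: "'a measure" and X
  assumes N: "0 < N" and proc: "markov_jump_process P (states N N) (generator N N) X"
begin

lemma mean_occupation_range:
  assumes t: "0 \<le> t" and x: "x \<le> N + 1"
  shows "\<bar>mean_occupation N N P X x t\<bar> \<le> 1"
proof -
  from proc t have X: "X t \<in> P \<rightarrow>\<^sub>M count_space (states N N)" and P: "prob_space P"
    by (auto simp: markov_jump_process_def)
  interpret prob_space P by fact
  from proc have fin: "finite (states N N)" by (simp add: markov_jump_process_def)
  define \<pi> where "\<pi> = (\<lambda>a. measure P {\<xi> \<in> space P. X t \<xi> = a})"
  have "\<bar>mean_occupation N N P X x t\<bar> = \<bar>\<Sum>a\<in>states N N. \<pi> a * occupation N N a x\<bar>"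
    unfolding mean_occupation_def \<pi>_def
    by (subst expectation_finite_range[OF P fin X, of "\<lambda>\<omega>. occupation N N \<omega> x"]) simp
  also have "\<dots> \<le> (\<Sum>a\<in>states N N. \<bar>\<pi> a * occupation N N a x\<bar>)" by (rule sum_abs)
  also have "\<dots> \<le> (\<Sum>a\<in>states N N. \<pi> a * 1)"
    using occupation_range[OF _ x] by (intro sum_mono) (auto simp: \<pi>_def abs_mult intro!: mult_left_le)
  also have "\<dots> = (\<integral>\<xi>. 1 \<partial>P)"
    unfolding \<pi>_def by (rule expectation_finite_range[OF P fin X, symmetric])
  also have "\<dots> = 1" by (simp add: prob_space)
  finally show ?thesis .
qed

lemma mean_occupation_heat_flow:
  "heat_flow N (\<lambda>x t. mean_occupation N N P X x ((real N)\<^sup>2 * t))"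
  unfolding heat_flow_def
proof (intro allI impI)
  fix x t assume x: "x \<le> N + 1" and t: "0 \<le> (t :: real)"
  define s where "s = (real N)\<^sup>2 * t"
  have s: "0 \<le> s" using t by (simp add: s_def)
  from proc s have X: "X s \<in> P \<rightarrow>\<^sub>M count_space (states N N)" and P: "prob_space P"
    and fin: "finite (states N N)"
    by (auto simp: markov_jump_process_def)
  define \<pi> where "\<pi> = (\<lambda>a. measure P {\<xi> \<in> space P. X s \<xi> = a})"
  have E: "mean_occupation N N P X y s = (\<Sum>a\<in>states N N. \<pi> a * occupation N N a y)" for y
    unfolding mean_occupation_def \<pi>_def
    by (rule expectation_finite_range[OF P fin X, of "\<lambda>\<omega>. occupation N N \<omega> y"])
  have "(\<integral>\<xi>. generator N N (\<lambda>\<omega>. occupation N N \<omega> x) (X s \<xi>) \<partial>P)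
      = (\<Sum>a\<in>states N N. \<pi> a * generator N N (\<lambda>\<omega>. occupation N N \<omega> x) a)"
    unfolding \<pi>_def by (rule expectation_finite_range[OF P fin X])
  also have "\<dots> = (\<Sum>a\<in>states N N. \<pi> a * chain_op N (occupation N N a) x) / (real N)\<^sup>2"
    using generator_occupation[OF N _ x] by (simp add: sum_divide_distrib)
  also have "\<dots> = chain_op N (\<lambda>y. mean_occupation N N P X y s) x / (real N)\<^sup>2"
    by (simp add: E chain_op_sum[OF fin])
  finally have gen: "(\<integral>\<xi>. generator N N (\<lambda>\<omega>. occupation N N \<omega> x) (X s \<xi>) \<partial>P)
      = chain_op N (\<lambda>y. mean_occupation N N P X y s) x / (real N)\<^sup>2" .
  have "((\<lambda>s. mean_occupation N N P X x s) has_real_derivative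
      chain_op N (\<lambda>y. mean_occupation N N P X y s) x / (real N)\<^sup>2) (at s within {0..})"
    using expectation_has_derivative[OF proc s, of "\<lambda>\<omega>. occupation N N \<omega> x"]
    unfolding gen mean_occupation_def .
  then have d: "((\<lambda>s. mean_occupation N N P X x s) has_real_derivative
      chain_op N (\<lambda>y. mean_occupation N N P X y s) x / (real N)\<^sup>2)
      (at ((real N)\<^sup>2 * t) within (\<lambda>t. (real N)\<^sup>2 * t) ` {0..})"
    unfolding s_def by (rule has_field_derivative_subset) auto
  have d2: "((\<lambda>t. (real N)\<^sup>2 * t) has_real_derivative (real N)\<^sup>2) (at t within {0..})"
    by (auto intro!: derivative_eq_intros)
  have "((\<lambda>t. mean_occupation N N P X x ((real N)\<^sup>2 * t)) has_real_derivative
      (real N)\<^sup>2 * (chain_op N (\<lambda>y. mean_occupation N N P X y s) x / (real N)\<^sup>2)) (at t within {0..})"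
    using DERIV_image_chain[OF d d2] by (simp add: o_def mult.commute)
  then show "((\<lambda>t. mean_occupation N N P X x ((real N)\<^sup>2 * t)) has_real_derivative
      chain_op N (\<lambda>y. mean_occupation N N P X y ((real N)\<^sup>2 * t)) x) (at t within {0..})"
    using N by (simp add: s_def)
qed

end

section \<open>Energy estimates on the chain\<close>

lemma nonincreasing_of_derivative:
  fixes f :: "real \<Rightarrow> real"
  assumes der: "\<And>t. 0 \<le> t \<Longrightarrow> (f has_real_derivative f' t) (at t within {0..})"
    and nonpos: "\<And>t. 0 \<le> t \<Longrightarrow> f' t \<le> 0" and ab: "0 \<le> a" "a \<le> b"
  shows "f b \<le> f a"
proof (rule DERIV_nonpos_imp_decreasing_open[OF ab(2)])
  show "\<exists>y. (f has_real_derivative y) (at x) \<and> y \<le> 0" if "a < x" "x < b" for x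
  proof -
    have "at x within {0..} = at x" using that ab by (intro at_within_interior) auto
    then show ?thesis using der[of x] nonpos[of x] that ab by auto
  qed
  have "continuous_on {0..} f"
    using der by (auto intro!: DERIV_continuous_on)
  then show "continuous_on {a..b} f" by (rule continuous_on_subset) (use ab in auto)
qed

text \<open>The inner product of the reversible mass distribution: a reservoir holds as much as \<open>N\<close> bulk sites.\<close>

definition mass_inner :: "nat \<Rightarrow> (nat \<Rightarrow> real) \<Rightarrow> (nat \<Rightarrow> real) \<Rightarrow> real" where
  "mass_inner N f g = f 0 * g 0 + f (N + 1) * g (N + 1) + (\<Sum>x = 1..N. f x * g x) / real N"

definition dirichlet :: "nat \<Rightarrow> (nat \<Rightarrow> real) \<Rightarrow> (nat \<Rightarrow> real) \<Rightarrow> real" where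
  "dirichlet N f g = real N / 2 * (\<Sum>x\<le>N. (f (x + 1) - f x) * (g (x + 1) - g x))"

lemma mass_inner_commute: "mass_inner N f g = mass_inner N g f"
  by (simp add: mass_inner_def mult.commute)

lemma dirichlet_commute: "dirichlet N f g = dirichlet N g f"
  by (simp add: dirichlet_def mult.commute)

lemma mass_inner_self_nonneg: "0 \<le> mass_inner N f f"
  by (simp add: mass_inner_def sum_nonneg)

lemma dirichlet_self_nonneg: "0 \<le> dirichlet N f f"
  by (simp add: dirichlet_def sum_nonneg)

lemma summation_by_parts:
  fixes f d :: "nat \<Rightarrow> real"
  shows "(\<Sum>x = 1..n. f x * (d x - d (x - 1)))
    = f (n + 1) * d n - f 0 * d 0 - (\<Sum>x\<le>n. (f (x + 1) - f x) * d x)"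
  by (induction n) (simp_all add: algebra_simps)

lemma green_identity:
  assumes "0 < N"
  shows "mass_inner N f (chain_op N g) = - dirichlet N f g"
proof -
  define d where "d = (\<lambda>x. g (x + 1) - g x)"
  have "(\<Sum>x = 1..N. f x * chain_op N g x)
      = (\<Sum>x = 1..N. (real N)\<^sup>2 / 2 * (f x * (d x - d (x - 1))))"
    by (intro sum.cong refl) (auto simp: chain_op_def d_def)
  also have "\<dots> = (real N)\<^sup>2 / 2 * (f (N + 1) * d N - f 0 * d 0 - (\<Sum>x\<le>N. (f (x + 1) - f x) * d x))"
    unfolding sum_distrib_left[symmetric] summation_by_parts ..
  finally have "(\<Sum>x = 1..N. f x * chain_op N g x) / real N
      = real N / 2 * (f (N + 1) * d N - f 0 * d 0 - (\<Sum>x\<le>N. (f (x + 1) - f x) * d x))"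
    using assms by (simp add: power2_eq_square)
  moreover have "f 0 * chain_op N g 0 = real N / 2 * (f 0 * d 0)"
    "f (N + 1) * chain_op N g (N + 1) = - (real N / 2 * (f (N + 1) * d N))"
    by (simp_all add: chain_op_def d_def field_simps)
  ultimately have "mass_inner N f (chain_op N g) = - (real N / 2 * (\<Sum>x\<le>N. (f (x + 1) - f x) * d x))"
    unfolding mass_inner_def by (simp only: algebra_simps)
  then show ?thesis by (simp add: dirichlet_def d_def)
qed

lemma chain_op_symmetric:
  assumes "0 < N"
  shows "mass_inner N f (chain_op N g) = mass_inner N (chain_op N f) g"
  using green_identity[OF assms, of f g] green_identity[OF assms, of g f]
  by (simp add: mass_inner_commute dirichlet_commute)

lemma heat_flowD:
  assumes "heat_flow N w" "x \<le> N + 1" "0 \<le> t"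
  shows "(w x has_real_derivative chain_op N (\<lambda>y. w y t) x) (at t within {0..})"
  using assms by (auto simp: heat_flow_def)

lemma chain_op_derivative:
  assumes "\<And>y. y \<le> N + 1 \<Longrightarrow> (v y has_real_derivative v' y) (at t within S)" "x \<le> N + 1"
  shows "((\<lambda>t. chain_op N (\<lambda>y. v y t) x) has_real_derivative chain_op N v' x) (at t within S)"
proof -
  note d = DERIV_diff[OF assms(1) assms(1)]
  consider "x = 0" | "x = N + 1" | "1 \<le> x" "x \<le> N" using assms(2) by linarith
  then show ?thesis
  proof cases
    case 1
    then have "(\<lambda>t. chain_op N (\<lambda>y. v y t) x) = (\<lambda>t. real N / 2 * (v 1 t - v 0 t))"
      "chain_op N v' x = real N / 2 * (v' 1 - v' 0)"
      by (simp_all add: chain_op_def)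
    then show ?thesis by (simp only:) (intro DERIV_cmult d; simp)
  next
    case 2
    then have "(\<lambda>t. chain_op N (\<lambda>y. v y t) x) = (\<lambda>t. real N / 2 * (v N t - v (N + 1) t))"
      "chain_op N v' x = real N / 2 * (v' N - v' (N + 1))"
      by (simp_all add: chain_op_def)
    then show ?thesis by (simp only:) (intro DERIV_cmult d; simp)
  next
    case 3
    then have "(\<lambda>t. chain_op N (\<lambda>y. v y t) x)
          = (\<lambda>t. (real N)\<^sup>2 / 2 * ((v (x + 1) t - v x t) - (v x t - v (x - 1) t)))"
      "chain_op N v' x = (real N)\<^sup>2 / 2 * ((v' (x + 1) - v' x) - (v' x - v' (x - 1)))"
      by (simp_all add: chain_op_def)
    then show ?thesis
      by (simp only:) (intro DERIV_cmult DERIV_diff[OF d d]; use 3 in simp)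
  qed
qed

lemma heat_flow_chain_op:
  assumes "heat_flow N w"
  shows "heat_flow N (\<lambda>x t. chain_op N (\<lambda>y. w y t) x)"
  unfolding heat_flow_def
  by (intro allI impI chain_op_derivative heat_flowD[OF assms])

lemma heat_flow_shift:
  assumes "heat_flow N w" "0 \<le> s"
  shows "heat_flow N (\<lambda>x t. w x (s + t))"
  unfolding heat_flow_def
proof (intro allI impI)
  fix x t assume x: "x \<le> N + 1" and t: "0 \<le> (t :: real)"
  have "(w x has_real_derivative chain_op N (\<lambda>y. w y (s + t)) x) (at (s + t) within (+) s ` {0..})"
    using heat_flowD[OF assms(1) x, of "s + t"] assms t
    by (auto elim!: has_field_derivative_subset)
  moreover have "((+) s has_real_derivative 1) (at t within {0..})"
    by (auto intro!: derivative_eq_intros)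
  ultimately show "((\<lambda>t. w x (s + t)) has_real_derivative chain_op N (\<lambda>y. w y (s + t)) x)
      (at t within {0..})"
    using DERIV_image_chain[of "w x" _ "(+) s" t "{0..}" 1] by (simp add: o_def)
qed

lemma heat_flow_reflect:
  assumes "heat_flow N w"
  shows "heat_flow N (\<lambda>x. w (N + 1 - x))"
  unfolding heat_flow_def
proof (intro allI impI)
  fix x t assume x: "x \<le> N + 1" and t: "0 \<le> (t :: real)"
  have "chain_op N (\<lambda>y. w y t) (N + 1 - x) = chain_op N (\<lambda>y. w (N + 1 - y) t) x"
    using x by (auto simp: chain_op_def Suc_diff_le)
  then show "(w (N + 1 - x) has_real_derivative chain_op N (\<lambda>y. w (N + 1 - y) t) x)
      (at t within {0..})"
    using heat_flowD[OF assms _ t, of "N + 1 - x"] by simp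
qed

lemma mass_inner_derivative:
  assumes "\<And>x. x \<le> N + 1 \<Longrightarrow> (f x has_real_derivative f' x) (at t within S)"
    "\<And>x. x \<le> N + 1 \<Longrightarrow> (g x has_real_derivative g' x) (at t within S)"
  shows "((\<lambda>t. mass_inner N (\<lambda>x. f x t) (\<lambda>x. g x t)) has_real_derivative
    mass_inner N f' (\<lambda>x. g x t) + mass_inner N (\<lambda>x. f x t) g') (at t within S)"
proof -
  have d: "((\<lambda>t. f x t * g x t) has_real_derivative f' x * g x t + f x t * g' x) (at t within S)"
    if "x \<le> N + 1" for x
    using DERIV_mult[OF assms(1)[OF that] assms(2)[OF that]] by (simp add: mult.commute)
  have "((\<lambda>t. mass_inner N (\<lambda>x. f x t) (\<lambda>x. g x t)) has_real_derivative
     (f' 0 * g 0 t + f 0 t * g' 0) + (f' (N+1) * g (N+1) t + f (N+1) t * g' (N+1))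
       + (\<Sum>x = 1..N. f' x * g x t + f x t * g' x) / real N) (at t within S)"
    unfolding mass_inner_def by (intro DERIV_add DERIV_cdivide DERIV_sum d) auto
  then show ?thesis
    by (simp add: mass_inner_def sum.distrib add_divide_distrib add_ac)
qed

text \<open>With \<open>g = L w\<close>, the derivatives of \<open>\<parallel>w\<parallel>\<^sup>2\<close>, \<open>D(w)\<close> and \<open>\<parallel>g\<parallel>\<^sup>2\<close> are \<open>- 2 D(w)\<close>, \<open>- 2 \<parallel>g\<parallel>\<^sup>2\<close> and
\<open>- 2 D(g)\<close>. The weights \<open>1\<close>, \<open>2 t\<close>, \<open>2 t\<^sup>2\<close> make everything cancel except \<open>- 4 t\<^sup>2 D(g)\<close>.\<close>

lemma energy_decay:
  assumes N: "0 < N" and w: "heat_flow N w" and a: "0 \<le> a" and s: "0 < s"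
  shows "dirichlet N (\<lambda>x. w x (a + s)) (\<lambda>x. w x (a + s))
      \<le> mass_inner N (\<lambda>x. w x a) (\<lambda>x. w x a) / (2 * s)" (is ?D)
    and "mass_inner N (chain_op N (\<lambda>y. w y (a + s))) (chain_op N (\<lambda>y. w y (a + s)))
      \<le> mass_inner N (\<lambda>x. w x a) (\<lambda>x. w x a) / (2 * s\<^sup>2)" (is ?G)
proof -
  define v where "v = (\<lambda>x t. w x (a + t))"
  define h where "h = (\<lambda>x t. chain_op N (\<lambda>y. v y t) x)"
  have v: "heat_flow N v" unfolding v_def by (rule heat_flow_shift[OF w a])
  have h: "heat_flow N h" unfolding h_def by (rule heat_flow_chain_op[OF v])
  have Lv: "chain_op N (\<lambda>y. v y t) = (\<lambda>x. h x t)" for t by (simp add: h_def)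
  define A where "A = (\<lambda>t. mass_inner N (\<lambda>x. v x t) (\<lambda>x. v x t))"
  define D where "D = (\<lambda>t. dirichlet N (\<lambda>x. v x t) (\<lambda>x. v x t))"
  define B where "B = (\<lambda>t. mass_inner N (\<lambda>x. h x t) (\<lambda>x. h x t))"
  define E where "E = (\<lambda>t. dirichlet N (\<lambda>x. h x t) (\<lambda>x. h x t))"
  have dA: "(A has_real_derivative - 2 * D t) (at t within {0..})" if "0 \<le> t" for t
    using mass_inner_derivative[of N v "chain_op N (\<lambda>y. v y t)" t "{0..}" v "chain_op N (\<lambda>y. v y t)",
      OF heat_flowD[OF v _ that] heat_flowD[OF v _ that]]
    unfolding A_def D_def by (simp add: mass_inner_commute[of N "chain_op N _"] green_identity[OF N])
  have dB: "(B has_real_derivative - 2 * E t) (at t within {0..})" if "0 \<le> t" for t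
    using mass_inner_derivative[of N h "chain_op N (\<lambda>y. h y t)" t "{0..}" h "chain_op N (\<lambda>y. h y t)",
      OF heat_flowD[OF h _ that] heat_flowD[OF h _ that]]
    unfolding B_def E_def by (simp add: mass_inner_commute[of N "chain_op N _"] green_identity[OF N])
  have D_eq: "D = (\<lambda>t. - mass_inner N (\<lambda>x. v x t) (\<lambda>x. h x t))"
    unfolding D_def Lv[symmetric] by (simp add: green_identity[OF N])
  have dD: "(D has_real_derivative - 2 * B t) (at t within {0..})" if "0 \<le> t" for t
  proof -
    have "mass_inner N (\<lambda>x. v x t) (chain_op N (\<lambda>x. h x t)) = B t"
      unfolding chain_op_symmetric[OF N] Lv B_def ..
    then show ?thesis
      using DERIV_minus[OF mass_inner_derivative[of N v "chain_op N (\<lambda>y. v y t)" t "{0..}" h "chain_op N (\<lambda>y. h y t)",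
        OF heat_flowD[OF v _ that] heat_flowD[OF h _ that]]]
      unfolding D_eq Lv by (simp add: B_def)
  qed
  have "A s + 2 * s * D s + 2 * s\<^sup>2 * B s \<le> A 0 + 2 * 0 * D 0 + 2 * 0\<^sup>2 * B 0"
  proof (rule nonincreasing_of_derivative[where f = "\<lambda>t. A t + 2 * t * D t + 2 * t\<^sup>2 * B t"
        and f' = "\<lambda>t. - 4 * t\<^sup>2 * E t"])
    fix t :: real assume t: "0 \<le> t"
    show "((\<lambda>t. A t + 2 * t * D t + 2 * t\<^sup>2 * B t) has_real_derivative - 4 * t\<^sup>2 * E t)
        (at t within {0..})"
      by (rule derivative_eq_intros dA dB dD t refl)+ (simp add: algebra_simps power2_eq_square)
    show "- 4 * t\<^sup>2 * E t \<le> 0" by (simp add: E_def dirichlet_self_nonneg)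
  qed (use s in auto)
  then have "A s + 2 * s * D s + 2 * s\<^sup>2 * B s \<le> A 0" by simp
  moreover have "0 \<le> A s" "0 \<le> 2 * s * D s" "0 \<le> 2 * s\<^sup>2 * B s"
    using s by (auto simp: A_def B_def D_def mass_inner_self_nonneg dirichlet_self_nonneg)
  ultimately have "2 * s * D s \<le> A 0" "2 * s\<^sup>2 * B s \<le> A 0" by linarith+
  then show ?D and ?G
    using s by (auto simp: A_def D_def B_def h_def v_def field_simps)
qed

text \<open>The discrete form of the embedding of \<open>H\<^sup>1\<close> into the functions of Hoelder exponent \<open>1/2\<close>, by the
Cauchy-Schwarz inequality.\<close>

lemma oscillation_bound:
  assumes N: "0 < N" and xy: "x \<le> y" "y \<le> N + 1"
  shows "(f y - f x)\<^sup>2 \<le> 2 * ((real y - real x) / real N) * dirichlet N f f"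
proof -
  have "f y - f x = (\<Sum>z = x..<y. f (z + 1) - f z)"
    using xy(1) by (simp add: sum_Suc_diff')
  then have "(f y - f x)\<^sup>2 \<le> (\<Sum>z = x..<y. (f (z + 1) - f z)\<^sup>2) * card {x..<y}"
    using sum_squared_le_sum_of_squares by metis
  also have "\<dots> \<le> (\<Sum>z\<le>N. (f (z + 1) - f z)\<^sup>2) * card {x..<y}"
    using xy by (intro mult_right_mono sum_mono2) auto
  also have "\<dots> = 2 * ((real y - real x) / real N) * dirichlet N f f"
    using xy N by (simp add: dirichlet_def power2_eq_square of_nat_diff)
  finally show ?thesis .
qed

text \<open>The value at the reservoir is part of the norm, and the oscillation is bounded by the Dirichlet form.
No maximum principle is involved, so the bound also applies to \<open>L w\<close> and \<open>L\<^sup>2 w\<close>.\<close>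

lemma sup_bound:
  assumes N: "0 < N" and x: "x \<le> N + 1"
  shows "(f x)\<^sup>2 \<le> 2 * mass_inner N f f + 8 * dirichlet N f f"
proof -
  have "(f x)\<^sup>2 \<le> 2 * (f 0)\<^sup>2 + 2 * (f x - f 0)\<^sup>2"
    using zero_le_power2[of "f x - 2 * f 0"] by (simp add: power2_eq_square algebra_simps)
  moreover have "(f 0)\<^sup>2 \<le> mass_inner N f f"
    by (simp add: mass_inner_def power2_eq_square sum_nonneg)
  moreover have "(f x - f 0)\<^sup>2 \<le> 2 * (real x / real N) * dirichlet N f f"
    using oscillation_bound[OF N _ x, of 0 f] by simp
  moreover have "2 * (real x / real N) * dirichlet N f f \<le> 4 * dirichlet N f f"
    using x N by (intro mult_right_mono dirichlet_self_nonneg) (simp add: divide_simps)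
  ultimately show ?thesis by linarith
qed

definition bounded_flow :: "nat \<Rightarrow> (nat \<Rightarrow> real \<Rightarrow> real) \<Rightarrow> bool" where
  "bounded_flow N w \<longleftrightarrow> 0 < N \<and> heat_flow N w \<and> (\<forall>x\<le>N + 1. \<forall>t\<ge>0. \<bar>w x t\<bar> \<le> 1)"

lemma bounded_flow_mass_inner:
  assumes "bounded_flow N w" "0 \<le> t"
  shows "mass_inner N (\<lambda>x. w x t) (\<lambda>x. w x t) \<le> 3"
proof -
  have sq: "w x t * w x t \<le> 1" if "x \<le> N + 1" for x
    using assms that abs_square_le_1[of "w x t"] by (simp add: bounded_flow_def power2_eq_square)
  have "(\<Sum>x = 1..N. w x t * w x t) \<le> (\<Sum>x = 1..N. 1)"
    by (intro sum_mono sq) auto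
  then have "(\<Sum>x = 1..N. w x t * w x t) / real N \<le> 1"
    using assms by (simp add: bounded_flow_def)
  then show ?thesis
    using sq[of 0] sq[of "N + 1"] by (simp add: mass_inner_def)
qed

text \<open>Each third of the time \<open>\<tau>\<close> is spent on one application of the energy decay: the first bounds \<open>L w\<close>,
the second \<open>L\<^sup>2 w\<close>, the third their Dirichlet forms. The starting norm is at most \<open>3\<close> for
every \<open>N\<close>.\<close>

lemma parabolic_smoothing:
  assumes \<tau>: "0 < \<tau>"
  obtains C where "0 \<le> C"
    "\<And>N w x y t. bounded_flow N w \<Longrightarrow> x \<le> N + 1 \<Longrightarrow> y \<le> N + 1 \<Longrightarrow> \<tau> \<le> t \<Longrightarrow>
      \<bar>chain_op N (\<lambda>z. w z t) x\<bar> \<le> C \<and>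
      \<bar>chain_op N (chain_op N (\<lambda>z. w z t)) x\<bar> \<le> C \<and>
      \<bar>w x t - w y t\<bar> \<le> C * sqrt (\<bar>real x - real y\<bar> / real N) \<and>
      \<bar>chain_op N (\<lambda>z. w z t) x - chain_op N (\<lambda>z. w z t) y\<bar>
        \<le> C * sqrt (\<bar>real x - real y\<bar> / real N)"
proof -
  define s where "s = \<tau> / 3"
  have s: "0 < s" using \<tau> by (simp add: s_def)
  define a where "a = 3 / (2 * s\<^sup>2)"
  define b where "b = a / (2 * s\<^sup>2)"
  define K where "K = (2 * a + 8 * (a / (2 * s))) + (2 * b + 8 * (b / (2 * s)))
     + 2 * (3 / (2 * s)) + 2 * (a / (2 * s))"
  have pos: "0 \<le> a" "0 \<le> b" "0 \<le> a / (2 * s)" "0 \<le> b / (2 * s)" "0 \<le> 3 / (2 * s)"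
    using s by (simp_all add: a_def b_def)
  have K: "2 * a + 8 * (a / (2 * s)) \<le> K" "2 * b + 8 * (b / (2 * s)) \<le> K"
    "2 * (3 / (2 * s)) \<le> K" "2 * (a / (2 * s)) \<le> K" "0 \<le> K"
    using pos unfolding K_def by linarith+
  have root: "\<bar>z\<bar> \<le> sqrt K" if "z\<^sup>2 \<le> K" for z
    using that by (metis real_sqrt_abs real_sqrt_le_mono)
  have osc: "\<bar>f x - f y\<bar> \<le> sqrt K * sqrt (\<bar>real x - real y\<bar> / real N)"
    if N: "0 < N" and x: "x \<le> N + 1" "y \<le> N + 1" and D: "2 * dirichlet N f f \<le> K" for f x y N
  proof -
    have "(f x - f y)\<^sup>2 \<le> 2 * (\<bar>real x - real y\<bar> / real N) * dirichlet N f f"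
      using oscillation_bound[OF N, of x y f] oscillation_bound[OF N, of y x f] x
      by (cases "x \<le> y") (auto simp: power2_commute)
    also have "\<dots> = (\<bar>real x - real y\<bar> / real N) * (2 * dirichlet N f f)" by simp
    also have "\<dots> \<le> (\<bar>real x - real y\<bar> / real N) * K"
      by (intro mult_left_mono D) auto
    finally show ?thesis
      by (metis mult.commute real_sqrt_abs real_sqrt_le_mono real_sqrt_mult)
  qed
  show ?thesis
  proof (rule that[of "sqrt K"])
    show "0 \<le> sqrt K" using K by simp
    fix N w x y t
    assume flow: "bounded_flow N w" and x: "x \<le> N + 1" "y \<le> N + 1" and t: "\<tau> \<le> (t :: real)"
    define g where "g = (\<lambda>x t. chain_op N (\<lambda>z. w z t) x)"
    have N: "0 < N" and w: "heat_flow N w" using flow by (auto simp: bounded_flow_def)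
    have g: "heat_flow N g" unfolding g_def by (rule heat_flow_chain_op[OF w])
    have h: "heat_flow N (\<lambda>x t. chain_op N (\<lambda>z. g z t) x)" by (rule heat_flow_chain_op[OF g])
    have Lg: "chain_op N (\<lambda>z. w z t) = (\<lambda>x. g x t)" for t by (simp add: g_def)
    have mass_inner_g: "mass_inner N (\<lambda>x. g x t) (\<lambda>x. g x t) \<le> a" if "s \<le> t" for t
    proof -
      have "mass_inner N (\<lambda>x. g x t) (\<lambda>x. g x t) \<le> mass_inner N (\<lambda>x. w x (t - s)) (\<lambda>x. w x (t - s)) / (2 * s\<^sup>2)"
        using energy_decay(2)[OF N w _ s, of "t - s"] that by (simp add: Lg)
      also have "\<dots> \<le> 3 / (2 * s\<^sup>2)"
        using bounded_flow_mass_inner[OF flow, of "t - s"] that s by (intro divide_right_mono) auto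
      finally show ?thesis by (simp add: a_def)
    qed
    have mass_inner_h: "mass_inner N (chain_op N (\<lambda>z. g z t)) (chain_op N (\<lambda>z. g z t)) \<le> b" if "2 * s \<le> t" for t
    proof -
      have "mass_inner N (chain_op N (\<lambda>z. g z t)) (chain_op N (\<lambda>z. g z t))
          \<le> mass_inner N (\<lambda>x. g x (t - s)) (\<lambda>x. g x (t - s)) / (2 * s\<^sup>2)"
        using energy_decay(2)[OF N g _ s, of "t - s"] that s by simp
      also have "\<dots> \<le> a / (2 * s\<^sup>2)"
        using mass_inner_g[of "t - s"] that s by (intro divide_right_mono) auto
      finally show ?thesis by (simp add: b_def)
    qed
    have ts: "3 * s \<le> t" using t by (simp add: s_def)
    have dir_w: "dirichlet N (\<lambda>x. w x t) (\<lambda>x. w x t) \<le> 3 / (2 * s)"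
      using energy_decay(1)[OF N w _ s, of "t - s"] bounded_flow_mass_inner[OF flow, of "t - s"] ts s
      by (auto elim!: order_trans intro!: divide_right_mono)
    have dir_g: "dirichlet N (\<lambda>x. g x t) (\<lambda>x. g x t) \<le> a / (2 * s)"
      using energy_decay(1)[OF N g _ s, of "t - s"] mass_inner_g[of "t - s"] ts s
      by (auto elim!: order_trans intro!: divide_right_mono)
    have dir_h: "dirichlet N (chain_op N (\<lambda>z. g z t)) (chain_op N (\<lambda>z. g z t)) \<le> b / (2 * s)"
      using energy_decay(1)[OF N h _ s, of "t - s"] mass_inner_h[of "t - s"] ts s
      by (auto elim!: order_trans intro!: divide_right_mono)
    have "\<bar>g x t\<bar> \<le> sqrt K"
      using sup_bound[OF N x(1), of "\<lambda>x. g x t"] mass_inner_g[of t] dir_g ts s K(1) by (intro root) linarith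
    moreover have "\<bar>chain_op N (\<lambda>z. g z t) x\<bar> \<le> sqrt K"
      using sup_bound[OF N x(1), of "chain_op N (\<lambda>z. g z t)"] mass_inner_h[of t] dir_h ts s K(2)
      by (intro root) linarith
    moreover have "\<bar>w x t - w y t\<bar> \<le> sqrt K * sqrt (\<bar>real x - real y\<bar> / real N)"
      using osc[OF N x, of "\<lambda>x. w x t"] dir_w K(3) by simp
    moreover have "\<bar>g x t - g y t\<bar> \<le> sqrt K * sqrt (\<bar>real x - real y\<bar> / real N)"
      using osc[OF N x, of "\<lambda>x. g x t"] dir_g K(4) by simp
    ultimately show "\<bar>chain_op N (\<lambda>z. w z t) x\<bar> \<le> sqrt K \<and>
      \<bar>chain_op N (chain_op N (\<lambda>z. w z t)) x\<bar> \<le> sqrt K \<and>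
      \<bar>w x t - w y t\<bar> \<le> sqrt K * sqrt (\<bar>real x - real y\<bar> / real N) \<and>
      \<bar>chain_op N (\<lambda>z. w z t) x - chain_op N (\<lambda>z. w z t) y\<bar>
        \<le> sqrt K * sqrt (\<bar>real x - real y\<bar> / real N)"
      by (simp add: Lg)
  qed
qed

lemma lipschitz_of_flow:
  assumes w: "heat_flow N w" and x: "x \<le> N + 1" and \<tau>: "0 \<le> \<tau>" "\<tau> \<le> t" "\<tau> \<le> t'"
    and B: "\<And>t. \<tau> \<le> t \<Longrightarrow> \<bar>chain_op N (\<lambda>z. w z t) x\<bar> \<le> B"
  shows "\<bar>w x t - w x t'\<bar> \<le> B * \<bar>t - t'\<bar>"
proof -
  have "norm (w x t - w x t') \<le> B * norm (t - t')"
  proof (rule field_differentiable_bound[where S = "{\<tau>..}" and f' = "\<lambda>t. chain_op N (\<lambda>z. w z t) x"])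
    show "(w x has_real_derivative chain_op N (\<lambda>z. w z t) x) (at t within {\<tau>..})"
      if "t \<in> {\<tau>..}" for t
      by (rule has_field_derivative_subset[OF heat_flowD[OF w x]]) (use that \<tau> in auto)
  qed (use \<tau> B in auto)
  then show ?thesis by simp
qed

text \<open>The time derivatives of \<open>w\<close> and \<open>L w\<close> are \<open>L w\<close> and \<open>L\<^sup>2 w\<close>, so their suprema are Lipschitz
constants in time.\<close>

lemma equicontinuity:
  assumes \<tau>: "0 < \<tau>"
  obtains C where "0 \<le> C"
    "\<And>N w x t. bounded_flow N w \<Longrightarrow> x \<le> N + 1 \<Longrightarrow> \<tau> \<le> t \<Longrightarrow> \<bar>chain_op N (\<lambda>z. w z t) x\<bar> \<le> C"
    "\<And>N w x y t t'. bounded_flow N w \<Longrightarrow> x \<le> N + 1 \<Longrightarrow> y \<le> N + 1 \<Longrightarrow> \<tau> \<le> t \<Longrightarrow> \<tau> \<le> t' \<Longrightarrow>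
      \<bar>w x t - w y t'\<bar> \<le> C * (sqrt (\<bar>real x - real y\<bar> / real N) + \<bar>t - t'\<bar>)"
    "\<And>N w x y t t'. bounded_flow N w \<Longrightarrow> x \<le> N + 1 \<Longrightarrow> y \<le> N + 1 \<Longrightarrow> \<tau> \<le> t \<Longrightarrow> \<tau> \<le> t' \<Longrightarrow>
      \<bar>chain_op N (\<lambda>z. w z t) x - chain_op N (\<lambda>z. w z t') y\<bar>
        \<le> C * (sqrt (\<bar>real x - real y\<bar> / real N) + \<bar>t - t'\<bar>)"
proof -
  obtain C where C: "0 \<le> C"
    "\<And>N w x y t. bounded_flow N w \<Longrightarrow> x \<le> N + 1 \<Longrightarrow> y \<le> N + 1 \<Longrightarrow> \<tau> \<le> t \<Longrightarrow>
      \<bar>chain_op N (\<lambda>z. w z t) x\<bar> \<le> C \<and>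
      \<bar>chain_op N (chain_op N (\<lambda>z. w z t)) x\<bar> \<le> C \<and>
      \<bar>w x t - w y t\<bar> \<le> C * sqrt (\<bar>real x - real y\<bar> / real N) \<and>
      \<bar>chain_op N (\<lambda>z. w z t) x - chain_op N (\<lambda>z. w z t) y\<bar>
        \<le> C * sqrt (\<bar>real x - real y\<bar> / real N)"
    using parabolic_smoothing[OF \<tau>] by metis
  show ?thesis
  proof (rule that[of C])
    fix N w x y t t'
    assume flow: "bounded_flow N w" and x: "x \<le> N + 1" "y \<le> N + 1" and t: "\<tau> \<le> (t::real)" "\<tau> \<le> (t'::real)"
    have w: "heat_flow N w" using flow by (simp add: bounded_flow_def)
    have "\<bar>w y t - w y t'\<bar> \<le> C * \<bar>t - t'\<bar>"
      by (rule lipschitz_of_flow[OF w x(2) _ t]) (use C(2)[OF flow x(2) x(2)] \<tau> in auto)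
    then show "\<bar>w x t - w y t'\<bar> \<le> C * (sqrt (\<bar>real x - real y\<bar> / real N) + \<bar>t - t'\<bar>)"
      using C(2)[OF flow x t(1)] unfolding distrib_left by linarith
    have "\<bar>chain_op N (\<lambda>z. w z t) y - chain_op N (\<lambda>z. w z t') y\<bar> \<le> C * \<bar>t - t'\<bar>"
      by (rule lipschitz_of_flow[OF heat_flow_chain_op[OF w] x(2) _ t])
        (use C(2)[OF flow x(2) x(2)] \<tau> in auto)
    then show "\<bar>chain_op N (\<lambda>z. w z t) x - chain_op N (\<lambda>z. w z t') y\<bar>
        \<le> C * (sqrt (\<bar>real x - real y\<bar> / real N) + \<bar>t - t'\<bar>)"
      using C(2)[OF flow x t(1)] unfolding distrib_left by linarith
  qed (use C in auto)
qed

section \<open>Maximum principle and initial layers on the chain\<close>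

lemma min_zero_square_derivative:
  assumes "(f has_real_derivative f') (at t within S)"
  shows "((\<lambda>t. (min (f t) 0)\<^sup>2) has_real_derivative 2 * min (f t) 0 * f') (at t within S)"
proof -
  have "((\<lambda>y :: real. (min y 0)\<^sup>2) has_real_derivative 2 * min y 0) (at y)" for y :: real
  proof (cases "y = 0")
    case True
    have "((\<lambda>h :: real. (min h 0)\<^sup>2 / h) \<longlongrightarrow> 0) (at 0)"
    proof (rule Lim_null_comparison)
      show "\<forall>\<^sub>F h :: real in at 0. norm ((min h 0)\<^sup>2 / h) \<le> \<bar>h\<bar>"
        by (intro always_eventually allI) (auto simp: min_def power2_eq_square)
      show "((\<lambda>h :: real. \<bar>h\<bar>) \<longlongrightarrow> 0) (at 0)"
        by (rule tendsto_rabs_zero) (rule tendsto_ident_at)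
    qed
    then show ?thesis using True by (simp add: has_field_derivative_iff)
  next
    case False
    show ?thesis
    proof (cases "0 < y")
      case True
      have "((\<lambda>_. 0) has_real_derivative 2 * min y 0) (at y)" using True by simp
      then show ?thesis
        by (rule has_field_derivative_transform_within_open[of _ _ _ "{0<..}"]) (use True in auto)
    next
      case 2: False
      have "((\<lambda>y. y\<^sup>2) has_real_derivative 2 * min y 0) (at y)"
        using 2 by (auto intro!: derivative_eq_intros)
      then show ?thesis
        by (rule has_field_derivative_transform_within_open[of _ _ _ "{..<0}"]) (use 2 False in auto)
    qed
  qed
  from DERIV_chain2[OF this assms] show ?thesis .
qed

text \<open>The norm of the negative part decreases: pairing \<open>min f 0\<close> with \<open>L f\<close> gives \<open>- D(min f 0, f)\<close>, which
is nonpositive because \<open>min _ 0\<close> is monotone. The square of the negative part is differentiable,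
although the negative part is not.\<close>

lemma maximum_principle:
  assumes N: "0 < N"
    and der: "\<And>x t. x \<le> N + 1 \<Longrightarrow> 0 \<le> t \<Longrightarrow> (f x has_real_derivative f' x t) (at t within {0..})"
    and super: "\<And>x t. x \<le> N + 1 \<Longrightarrow> 0 \<le> t \<Longrightarrow> chain_op N (\<lambda>y. f y t) x \<le> f' x t"
    and init: "\<And>x. x \<le> N + 1 \<Longrightarrow> 0 \<le> f x 0"
    and x: "x \<le> N + 1" and t: "0 \<le> t"
  shows "0 \<le> f x t"
proof -
  define m where "m = (\<lambda>x t. min (f x t) 0)"
  define E where "E = (\<lambda>t. mass_inner N (\<lambda>x. m x t) (\<lambda>x. m x t))"
  have E_der: "(E has_real_derivative 2 * mass_inner N (\<lambda>x. m x t) (\<lambda>x. f' x t)) (at t within {0..})"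
    if "0 \<le> t" for t
  proof -
    have E_eq: "E = (\<lambda>t. (m 0 t)\<^sup>2 + (m (N + 1) t)\<^sup>2 + (\<Sum>x = 1..N. (m x t)\<^sup>2) / real N)"
      by (auto simp: E_def mass_inner_def power2_eq_square)
    have d: "((\<lambda>t. (m x t)\<^sup>2) has_real_derivative 2 * m x t * f' x t) (at t within {0..})"
      if "x \<le> N + 1" for x
      unfolding m_def by (rule min_zero_square_derivative[OF der[OF that \<open>0 \<le> t\<close>]])
    have "(E has_real_derivative 2 * m 0 t * f' 0 t + 2 * m (N + 1) t * f' (N + 1) t
        + (\<Sum>x = 1..N. 2 * m x t * f' x t) / real N) (at t within {0..})"
      unfolding E_eq by (intro DERIV_add DERIV_cdivide DERIV_sum d) auto
    then show ?thesis by (simp add: mass_inner_def sum_distrib_left algebra_simps)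
  qed
  have nonpos: "2 * mass_inner N (\<lambda>x. m x t) (\<lambda>x. f' x t) \<le> 0" if "0 \<le> t" for t
  proof -
    have le: "m x t * f' x t \<le> m x t * chain_op N (\<lambda>y. f y t) x" if "x \<le> N + 1" for x
      using super[OF that \<open>0 \<le> t\<close>] by (intro mult_left_mono_neg) (auto simp: m_def)
    have "mass_inner N (\<lambda>x. m x t) (\<lambda>x. f' x t) \<le> mass_inner N (\<lambda>x. m x t) (chain_op N (\<lambda>y. f y t))"
      unfolding mass_inner_def by (intro add_mono divide_right_mono sum_mono le) auto
    also have "\<dots> = - dirichlet N (\<lambda>x. m x t) (\<lambda>x. f x t)" by (rule green_identity[OF N])
    also have "\<dots> \<le> 0"
    proof -
      have "0 \<le> (min a 0 - min b 0) * (a - b)" for a b :: real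
        by (cases "a \<le> b") (auto simp: mult_nonneg_nonneg mult_nonpos_nonpos min_def)
      then show ?thesis by (simp add: dirichlet_def m_def sum_nonneg)
    qed
    finally show ?thesis by simp
  qed
  have "E t \<le> E 0"
    by (rule nonincreasing_of_derivative[OF E_der nonpos]) (use t in auto)
  also have "E 0 = 0"
    using init by (simp add: E_def mass_inner_def m_def)
  finally have "E t \<le> 0" .
  have le: "a \<le> 0 \<and> b \<le> 0 \<and> c \<le> 0" if "a + b + c \<le> 0" "0 \<le> a" "0 \<le> b" "0 \<le> c" for a b c :: real
    using that by linarith
  have parts: "m 0 t * m 0 t \<le> 0 \<and> m (N + 1) t * m (N + 1) t \<le> 0 \<and>
      (\<Sum>x = 1..N. m x t * m x t) / real N \<le> 0"
    using \<open>E t \<le> 0\<close> unfolding E_def mass_inner_def by (intro le) (auto simp: sum_nonneg)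
  have "m x t * m x t \<le> 0"
  proof (cases "x = 0 \<or> x = N + 1")
    case True
    then show ?thesis using parts by auto
  next
    case False
    have "m x t * m x t \<le> (\<Sum>x = 1..N. m x t * m x t)"
      using False x by (intro member_le_sum) auto
    also have "\<dots> \<le> 0" using parts N by (simp add: divide_le_0_iff)
    finally show ?thesis .
  qed
  then have "m x t = 0" by (metis antisym mult_eq_0_iff zero_le_square)
  then show ?thesis by (simp add: m_def min_def split: if_splits)
qed

text \<open>In the bulk the value is exactly \<open>1\<close>. At the reservoirs the inward difference of the parabola has a
favourable sign, up to a term of order \<open>1/N\<close>. This is what makes it a barrier for the boundary
condition as well.\<close>

lemma chain_op_parabola:
  assumes N: "0 < N" and r: "0 \<le> r" "r \<le> 1"
  shows "chain_op N (\<lambda>x. (real x / real N - r)\<^sup>2) x \<le> 1"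
proof -
  consider "x = 0" | "x = N + 1" | "x \<noteq> 0" "x \<noteq> N + 1" by blast
  then show ?thesis
  proof cases
    case 1
    have "chain_op N (\<lambda>x. (real x / real N - r)\<^sup>2) x = 1 / (2 * real N) - r"
      using N by (simp add: 1 chain_op_def field_simps power2_eq_square)
    also have "\<dots> \<le> 1 / 2 - r" using N by (simp add: field_simps)
    finally show ?thesis using r by simp
  next
    case 2
    have "chain_op N (\<lambda>x. (real x / real N - r)\<^sup>2) x = - (1 / (2 * real N)) - (1 - r)"
      using N by (simp add: 2 chain_op_def field_simps power2_eq_square)
    also have "\<dots> \<le> 1"
    proof -
      have "0 \<le> 1 / (2 * real N)" by simp
      then show ?thesis using r by linarith
    qed
    finally show ?thesis .
  next
    case 3
    define y where "y = x - 1"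
    have x: "x = Suc y" using 3 by (simp add: y_def)
    show ?thesis
      using N 3 by (simp add: x chain_op_def field_simps power2_eq_square)
  qed
qed

text \<open>Comparison of \<open>w\<close> from above and below with the barrier \<open>c \<plusminus> (\<epsilon> + K ((x/N - r)\<^sup>2 + t))\<close>. With
\<open>K = 2 / \<delta>\<^sup>2\<close> its width reaches the largest possible deviation \<open>2\<close> at distance \<open>\<delta>\<close> from \<open>r\<close>, where nothing
is known about the data; the reservoirs lie in that region.\<close>

lemma initial_layer_bulk:
  assumes flow: "bounded_flow N w" and r: "0 < \<delta>" "\<delta> \<le> r" "\<delta> \<le> 1 - r"
    and c: "\<bar>c\<bar> \<le> 1" and \<epsilon>: "0 \<le> \<epsilon>"
    and init: "\<And>x. x \<in> {1..N} \<Longrightarrow> \<bar>real x / real N - r\<bar> < \<delta> \<Longrightarrow> \<bar>w x 0 - c\<bar> \<le> \<epsilon>"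
    and x: "x \<le> N + 1" and t: "0 \<le> t"
  shows "\<bar>w x t - c\<bar> \<le> \<epsilon> + 2 / \<delta>\<^sup>2 * ((real x / real N - r)\<^sup>2 + t)"
proof -
  define K where "K = 2 / \<delta>\<^sup>2"
  define q where "q = (\<lambda>x. (real x / real N - r)\<^sup>2)"
  have N: "0 < N" and w: "heat_flow N w" and w1: "\<And>x t. x \<le> N + 1 \<Longrightarrow> 0 \<le> t \<Longrightarrow> \<bar>w x t\<bar> \<le> 1"
    using flow by (auto simp: bounded_flow_def)
  have K: "0 \<le> K" by (simp add: K_def)
  \<comment> \<open>Both signs at once: \<open>\<sigma> = 1\<close> is the upper and \<open>\<sigma> = - 1\<close> the lower barrier.\<close>
  have bound: "0 \<le> K * (q x + t) + (\<epsilon> + \<sigma> * (c - w x t))" if \<sigma>: "\<sigma> = 1 \<or> \<sigma> = - 1" for \<sigma>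
  proof (rule maximum_principle[OF N _ _ _ x t])
    fix x t assume x: "x \<le> N + 1" and t: "0 \<le> (t :: real)"
    show "((\<lambda>t. K * (q x + t) + (\<epsilon> + \<sigma> * (c - w x t))) has_real_derivative
        K - \<sigma> * chain_op N (\<lambda>y. w y t) x) (at t within {0..})"
      by (auto intro!: derivative_eq_intros heat_flowD[OF w x t])
    have "(\<lambda>y. K * (q y + t) + (\<epsilon> + \<sigma> * (c - w y t)))
        = (\<lambda>y. K * q y + 1 * ((K * t + \<epsilon> + \<sigma> * c) * 1 + (- \<sigma>) * w y t))"
      by (simp add: algebra_simps)
    then have "chain_op N (\<lambda>y. K * (q y + t) + (\<epsilon> + \<sigma> * (c - w y t))) x
        = K * chain_op N q x + 1 * ((K * t + \<epsilon> + \<sigma> * c) * chain_op N (\<lambda>_. 1) x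
           + (- \<sigma>) * chain_op N (\<lambda>y. w y t) x)"
      by (simp only: chain_op_linear)
    also have "chain_op N (\<lambda>_. 1) x = 0" by (simp add: chain_op_def)
    finally show "chain_op N (\<lambda>y. K * (q y + t) + (\<epsilon> + \<sigma> * (c - w y t))) x
        \<le> K - \<sigma> * chain_op N (\<lambda>y. w y t) x"
      using mult_left_mono[OF chain_op_parabola[OF N, of r x] K] r by (simp add: q_def)
  next
    fix x assume x: "x \<le> N + 1"
    have le: "\<bar>\<sigma> * (c - w x 0)\<bar> = \<bar>w x 0 - c\<bar>" using \<sigma> by auto
    have pos: "0 \<le> a + (\<epsilon> + z)" if "\<bar>z\<bar> \<le> \<epsilon> + a" for a z :: real
      using that by linarith
    show "0 \<le> K * (q x + 0) + (\<epsilon> + \<sigma> * (c - w x 0))"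
    proof (cases "\<bar>real x / real N - r\<bar> < \<delta>")
      case True
      have "x \<noteq> 0"
      proof
        assume "x = 0"
        then show False using True r by simp
      qed
      moreover have "x \<noteq> N + 1"
      proof
        assume "x = N + 1"
        then have "real x / real N = 1 + 1 / real N" using N by (simp add: field_simps)
        moreover have "0 < 1 / real N" using N by simp
        ultimately show False using True[unfolded abs_less_iff] r by linarith
      qed
      ultimately have "\<bar>w x 0 - c\<bar> \<le> \<epsilon>" using init[of x] True x by auto
      moreover have "0 \<le> K * q x" using K by (simp add: q_def)
      ultimately have "\<bar>\<sigma> * (c - w x 0)\<bar> \<le> \<epsilon> + K * q x" unfolding le by linarith
      then show ?thesis unfolding add_0_right by (rule pos)
    next
      case False
      then have "\<delta>\<^sup>2 \<le> q x"
        unfolding q_def using r by (metis abs_le_square_iff abs_of_pos not_less)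
      then have "K * \<delta>\<^sup>2 \<le> K * q x" using K by (rule mult_left_mono)
      moreover have "K * \<delta>\<^sup>2 = 2" using r by (simp add: K_def)
      moreover have "\<bar>w x 0 - c\<bar> \<le> 2" using w1[OF x, of 0] c by simp
      ultimately have "\<bar>\<sigma> * (c - w x 0)\<bar> \<le> \<epsilon> + K * q x" unfolding le using \<epsilon> by linarith
      then show ?thesis unfolding add_0_right by (rule pos)
    qed
  qed
  show ?thesis
    using bound[of 1] bound[of "- 1"] unfolding K_def q_def by (simp add: abs_le_iff)
qed

text \<open>Test with the hat function \<open>\<phi>\<close> that falls from \<open>1\<close> at the reservoir to \<open>0\<close> at site \<open>m\<close>. By Green's
identity the pairing changes at the rate \<open>N (w(m) - w(0)) / (2 m)\<close>, because \<open>\<phi>\<close> is affine on its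
support; apart from \<open>w(0)\<close> itself the pairing has total mass at most \<open>m/N\<close>. The bound does not
depend on how the bulk data fit the filling of the reservoir.\<close>

lemma initial_layer_reservoir:
  assumes flow: "bounded_flow N w" and m: "1 \<le> m" "m \<le> N" and t: "0 \<le> t"
  shows "\<bar>w 0 t - w 0 0\<bar> \<le> 2 * real m / real N + real N * t / real m"
proof -
  have N: "0 < N" and w: "heat_flow N w" and w1: "\<And>x t. x \<le> N + 1 \<Longrightarrow> 0 \<le> t \<Longrightarrow> \<bar>w x t\<bar> \<le> 1"
    using flow by (auto simp: bounded_flow_def)
  define \<phi> where "\<phi> = (\<lambda>x. if x < m then 1 - real x / real m else 0)"
  define F where "F = (\<lambda>t. mass_inner N \<phi> (\<lambda>x. w x t))"
  have "((\<lambda>t. mass_inner N (\<lambda>x. \<phi> x) (\<lambda>x. w x t)) has_real_derivative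
      mass_inner N (\<lambda>_. 0) (\<lambda>x. w x t) + mass_inner N \<phi> (chain_op N (\<lambda>y. w y t))) (at t within {0..})"
    if "0 \<le> t" for t
    by (rule mass_inner_derivative) (auto intro!: heat_flowD[OF w _ that])
  then have der: "(F has_real_derivative - dirichlet N \<phi> (\<lambda>x. w x t)) (at t within {0..})"
    if "0 \<le> t" for t
    using that unfolding F_def green_identity[OF N, symmetric] by (simp add: mass_inner_def)
  have dir: "\<bar>dirichlet N \<phi> (\<lambda>x. w x t)\<bar> \<le> real N / real m" if "0 \<le> t" for t
  proof -
    have "(\<Sum>x\<le>N. (\<phi> (x + 1) - \<phi> x) * (w (x + 1) t - w x t))
        = (\<Sum>x<m. - (1 / real m) * (w (x + 1) t - w x t))"
    proof (rule sum.mono_neutral_cong_right)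
      show "\<forall>i\<in>{..N} - {..<m}. (\<phi> (i + 1) - \<phi> i) * (w (i + 1) t - w i t) = 0"
        by (auto simp: \<phi>_def)
      have "\<phi> (x + 1) - \<phi> x = - (1 / real m)" if "x < m" for x
      proof (cases "x + 1 < m")
        case True
        then show ?thesis using that by (simp add: \<phi>_def diff_divide_distrib[symmetric])
      next
        case False
        then have "m = x + 1" using that by simp
        then show ?thesis by (simp add: \<phi>_def field_simps)
      qed
      then show "(\<phi> (x + 1) - \<phi> x) * (w (x + 1) t - w x t) = - (1 / real m) * (w (x + 1) t - w x t)"
        if "x \<in> {..<m}" for x using that by simp
    qed (use m in auto)
    also have "\<dots> = - (1 / real m) * (w m t - w 0 t)"
      unfolding sum_distrib_left[symmetric]
      using sum_lessThan_telescope[of "\<lambda>x. w x t" m] by simp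
    finally have "dirichlet N \<phi> (\<lambda>x. w x t) = - (real N / (2 * real m)) * (w m t - w 0 t)"
      by (simp add: dirichlet_def)
    then have "\<bar>dirichlet N \<phi> (\<lambda>x. w x t)\<bar> = real N / (2 * real m) * \<bar>w m t - w 0 t\<bar>"
      by (simp add: abs_mult)
    also have "\<dots> \<le> real N / (2 * real m) * 2"
      using w1[of m t] w1[of 0 t] m that by (intro mult_left_mono) auto
    finally show ?thesis by simp
  qed
  have "norm (F t - F 0) \<le> real N / real m * norm (t - 0)"
    by (rule field_differentiable_bound[where S = "{0..}" and f' = "\<lambda>t. - dirichlet N \<phi> (\<lambda>x. w x t)"])
      (use der dir t in auto)
  then have F: "\<bar>F t - F 0\<bar> \<le> real N * t / real m" using t by simp
  define R where "R = (\<Sum>x = 1..N. \<phi> x * (w x t - w x 0))"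
  have "\<bar>R\<bar> \<le> (\<Sum>x = 1..N. \<bar>\<phi> x * (w x t - w x 0)\<bar>)" unfolding R_def by (rule sum_abs)
  also have "\<dots> = (\<Sum>x = 1..<m. \<bar>\<phi> x * (w x t - w x 0)\<bar>)"
    by (rule sum.mono_neutral_right) (use m in \<open>auto simp: \<phi>_def\<close>)
  also have "\<dots> \<le> (\<Sum>x = 1..<m. 1 * 2)"
  proof (intro sum_mono)
    fix x assume x: "x \<in> {1..<m}"
    have "\<bar>\<phi> x\<bar> \<le> 1" using x by (simp add: \<phi>_def)
    moreover have "\<bar>w x t - w x 0\<bar> \<le> 2" using w1[of x t] w1[of x 0] x m t by auto
    ultimately show "\<bar>\<phi> x * (w x t - w x 0)\<bar> \<le> 1 * 2"
      unfolding abs_mult by (intro mult_mono) auto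
  qed
  also have "\<dots> \<le> 2 * real m" by simp
  finally have "\<bar>R / real N\<bar> \<le> 2 * real m / real N" using N by (simp add: divide_right_mono)
  moreover have "F t - F 0 = (w 0 t - w 0 0) + R / real N"
    using m by (simp add: F_def mass_inner_def R_def \<phi>_def right_diff_distrib sum_subtractf diff_divide_distrib)
  ultimately show ?thesis using F by linarith
qed

section \<open>Pointwise compactness and Riemann sums\<close>

text \<open>A diagonal argument on a countable set \<open>D\<close>, in the style of Arzela and Ascoli. The functions come from
lattices and are discontinuous; it is enough that each point can be approximated from \<open>D\<close> with an
error that is eventually small. Boundedness on \<open>D\<close> need not be uniform, as it is not near time \<open>0\<close>.\<close>

lemma pointwise_convergent_subsequence:
  fixes F :: "nat \<Rightarrow> 'p \<Rightarrow> 'b :: {real_normed_vector, heine_borel}"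
  assumes D: "countable D" and bdd: "\<And>p. p \<in> D \<Longrightarrow> \<exists>B. \<forall>n. norm (F n p) \<le> B"
    and approx: "\<And>p e. p \<in> S \<Longrightarrow> 0 < e \<Longrightarrow>
      \<exists>q\<in>D. eventually (\<lambda>n. dist (F n p) (F n q) \<le> e) sequentially"
  obtains k where "strict_mono (k :: nat \<Rightarrow> nat)" "\<And>p. p \<in> S \<Longrightarrow> convergent (\<lambda>n. F (k n) p)"
proof -
  from bdd obtain B where B: "\<And>p n. p \<in> D \<Longrightarrow> norm (F n p) \<le> B p" by metis
  \<comment> \<open>Normalised to reduce to a bound that is uniform on \<open>D\<close>.\<close>
  define b where "b = (\<lambda>p. max 1 (B p))"
  have b: "0 < b p" for p by (simp add: b_def)
  have "norm (F n p /\<^sub>R b p) \<le> 1" if "p \<in> D" for n p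
    using B[OF that, of n] b[of p] by (simp add: b_def divide_simps)
  then obtain k where k: "strict_mono (k :: nat \<Rightarrow> nat)"
    "\<And>p. p \<in> D \<Longrightarrow> \<exists>l. (\<lambda>n. F (k n) p /\<^sub>R b p) \<longlonglongrightarrow> l"
    using function_convergent_subsequence[OF D, of "\<lambda>n p. F n p /\<^sub>R b p" 1] by metis
  have convD: "Cauchy (\<lambda>n. F (k n) p)" if "p \<in> D" for p
  proof -
    from k(2)[OF that] obtain l where "(\<lambda>n. F (k n) p /\<^sub>R b p) \<longlonglongrightarrow> l" by auto
    then have "(\<lambda>n. b p *\<^sub>R (F (k n) p /\<^sub>R b p)) \<longlonglongrightarrow> b p *\<^sub>R l"
      by (intro tendsto_intros)
    then show ?thesis using b[of p] by (auto intro!: convergent_Cauchy convergentI)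
  qed
  have "convergent (\<lambda>n. F (k n) p)" if p: "p \<in> S" for p
  proof (rule Cauchy_convergent, rule metric_CauchyI)
    fix e :: real assume e: "0 < e"
    then obtain q where q: "q \<in> D" and ev: "eventually (\<lambda>n. dist (F n p) (F n q) \<le> e / 4) sequentially"
      using approx[OF p, of "e / 4"] by auto
    from ev obtain n0 where n0: "\<And>n. n0 \<le> n \<Longrightarrow> dist (F n p) (F n q) \<le> e / 4"
      by (auto simp: eventually_sequentially)
    from convD[OF q] e obtain n1 where n1: "\<And>m n. n1 \<le> m \<Longrightarrow> n1 \<le> n \<Longrightarrow>
        dist (F (k m) q) (F (k n) q) < e / 4"
      using metric_CauchyD[of "\<lambda>n. F (k n) q" "e / 4"] by auto
    have "dist (F (k m) p) (F (k n) p) < e" if "max n0 n1 \<le> m" "max n0 n1 \<le> n" for m n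
    proof -
      have "n0 \<le> k m" "n0 \<le> k n"
        using that seq_suble[OF k(1), of m] seq_suble[OF k(1), of n] by auto
      then have "dist (F (k m) p) (F (k m) q) \<le> e / 4" "dist (F (k n) p) (F (k n) q) \<le> e / 4"
        using n0 by auto
      moreover have "dist (F (k m) q) (F (k n) q) < e / 4" using n1 that by auto
      moreover have "dist (F (k m) p) (F (k n) p)
          \<le> dist (F (k m) p) (F (k m) q) + dist (F (k m) q) (F (k n) q) + dist (F (k n) p) (F (k n) q)"
        by (metis add.commute add_left_mono dist_commute dist_triangle dist_triangle_le)
      ultimately show ?thesis using e by linarith
    qed
    then show "\<exists>M. \<forall>m\<ge>M. \<forall>n\<ge>M. dist (F (k m) p) (F (k n) p) < e" by blast
  qed
  with k(1) show ?thesis using that by blast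
qed

definition site :: "nat \<Rightarrow> real \<Rightarrow> nat" where
  "site N r = nat \<lfloor>real N * r\<rfloor>"

lemma site_le: "r \<le> 1 \<Longrightarrow> site N r \<le> N"
  unfolding site_def using floor_mono[of "real N * r" "real N"] mult_left_le[of r "real N"]
  by (simp add: nat_le_iff)

lemma site_0 [simp]: "site N 0 = 0" and site_1 [simp]: "site N 1 = N"
  by (simp_all add: site_def)

lemma site_bounds:
  assumes "0 < N" "0 \<le> r"
  shows "real (site N r) / real N \<le> r" "r - 1 / real N \<le> real (site N r) / real N"
proof -
  have "real (site N r) = of_int \<lfloor>real N * r\<rfloor>" using assms by (simp add: site_def)
  then have "real (site N r) \<le> real N * r" "real N * r - 1 \<le> real (site N r)" by linarith+
  then show "real (site N r) / real N \<le> r" "r - 1 / real N \<le> real (site N r) / real N"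
    using assms divide_right_mono[of "real N * r - 1" "real (site N r)" "real N"]
    by (simp_all add: field_simps)
qed

lemma site_diff:
  assumes "0 < N" "0 \<le> r" "0 \<le> r'"
  shows "\<bar>real (site N r) - real (site N r')\<bar> / real N \<le> \<bar>r - r'\<bar> + 1 / real N"
proof -
  have "\<bar>real (site N r) - real (site N r')\<bar> / real N
      = \<bar>real (site N r) / real N - real (site N r') / real N\<bar>"
    using assms by (simp add: diff_divide_distrib[symmetric])
  then show ?thesis
    using site_bounds[OF assms(1,2)] site_bounds[OF assms(1,3)] by linarith
qed

text \<open>Lattice sums are integrals of step functions; in this form dominated convergence applies to them.\<close>

lemma sum_eq_integral_site:
  assumes N: "0 < N"
  shows "((\<lambda>s. a (site N s)) has_integral (\<Sum>y<m. a y) / real N) {0..real m / real N}"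
proof (induction m)
  case 0
  then show ?case using has_integral_refl(2)[of "\<lambda>s. a (site N s)" "0 :: real"] by simp
next
  case (Suc m)
  let ?I = "{real m / real N..real (Suc m) / real N}"
  have "((\<lambda>s. a m) has_integral (real (Suc m) / real N - real m / real N) *\<^sub>R a m) ?I"
    using has_integral_const_real[of "a m" "real m / real N" "real (Suc m) / real N"] N
    by (simp add: divide_right_mono)
  moreover have "(real (Suc m) / real N - real m / real N) *\<^sub>R a m = a m / real N"
    using N by (simp add: field_simps)
  ultimately have "((\<lambda>s. a m) has_integral a m / real N) ?I" by simp
  then have "((\<lambda>s. a (site N s)) has_integral a m / real N) ?I"
  proof (rule has_integral_spike_finite[of "{real (Suc m) / real N}", rotated 2])
    fix s assume s: "s \<in> ?I - {real (Suc m) / real N}"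
    then have "real m / real N \<le> s" "s < (real m + 1) / real N" by (auto simp: add.commute)
    then have "real m \<le> real N * s" "real N * s < real m + 1"
      using N by (simp_all add: pos_divide_le_eq pos_less_divide_eq mult.commute)
    then have "\<lfloor>real N * s\<rfloor> = int m" by (simp add: floor_eq_iff)
    then show "a (site N s) = a m" by (simp add: site_def)
  qed simp
  from has_integral_combine[OF _ _ Suc this] show ?case
    using N by (simp add: add_divide_distrib divide_right_mono)
qed

lemma abs_integral_le:
  fixes f :: "real \<Rightarrow> real"
  assumes "f integrable_on {a..b}" "a \<le> b" "\<And>x. a \<le> x \<Longrightarrow> x \<le> b \<Longrightarrow> \<bar>f x\<bar> \<le> C"
  shows "\<bar>integral {a..b} f\<bar> \<le> C * (b - a)"
proof -
  have "norm (integral {a..b} f) \<le> integral {a..b} (\<lambda>_. C)"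
    by (rule integral_norm_bound_integral) (use assms in auto)
  then show ?thesis using assms(2) by (simp add: mult.commute)
qed

lemma riemann_sums_converge:
  fixes Ns :: "nat \<Rightarrow> nat"
  assumes Ns: "\<And>n. 0 < Ns n" "filterlim Ns at_top sequentially"
    and r: "0 \<le> r" "r \<le> 1"
    and bdd: "\<And>n y. y \<le> Ns n \<Longrightarrow> \<bar>a n y\<bar> \<le> C"
    and conv: "\<And>s. 0 \<le> s \<Longrightarrow> s \<le> 1 \<Longrightarrow> (\<lambda>n. a n (site (Ns n) s)) \<longlonglongrightarrow> F s"
  shows "F integrable_on {0..r}"
    and "(\<lambda>n. (\<Sum>y<site (Ns n) r. a n y) / real (Ns n)) \<longlonglongrightarrow> integral {0..r} F"
proof -
  define f where "f = (\<lambda>n s. a n (site (Ns n) s))"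
  define r' where "r' = (\<lambda>n. real (site (Ns n) r) / real (Ns n))"
  have int: "f n integrable_on {0..1}" for n
    using sum_eq_integral_site[OF Ns(1)[of n], of "a n" "Ns n"] Ns(1)[of n]
    by (auto simp: f_def integrable_on_def)
  have int': "f n integrable_on {x..y}" if "0 \<le> x" "y \<le> 1" for n x y
    by (rule integrable_on_subinterval[OF int]) (use that in auto)
  have f: "\<bar>f n s\<bar> \<le> C" if "0 \<le> s" "s \<le> 1" for n s
    unfolding f_def by (rule bdd) (use that site_le in auto)
  have C: "0 \<le> C" using f[of 0 undefined] by (simp add: order_trans[OF abs_ge_zero])
  have r'r: "0 \<le> r' n" "r' n \<le> r" "r - 1 / real (Ns n) \<le> r' n" for n
    using site_bounds[OF Ns(1) r(1)] by (auto simp: r'_def)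
  note dc = dominated_convergence[of f "{0..r}" "\<lambda>_. C" F]
  show "F integrable_on {0..r}"
    by (rule dc(1)) (use r f int' conv in \<open>auto simp: f_def\<close>)
  have lim: "(\<lambda>n. integral {0..r} (f n)) \<longlonglongrightarrow> integral {0..r} F"
    by (rule dc(2)) (use r f int' conv in \<open>auto simp: f_def\<close>)
  have Ninv: "(\<lambda>n. 1 / real (Ns n)) \<longlonglongrightarrow> 0"
    using filterlim_compose[OF lim_1_over_n Ns(2)] by (simp add: o_def)
  have "(\<lambda>n. integral {r' n..r} (f n)) \<longlonglongrightarrow> 0"
  proof (rule Lim_null_comparison)
    show "(\<lambda>n. C * (1 / real (Ns n))) \<longlonglongrightarrow> 0"
      using tendsto_mult_left[OF Ninv, of C] by simp
    have "norm (integral {r' n..r} (f n)) \<le> C * (1 / real (Ns n))" for n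
    proof -
      have "norm (integral {r' n..r} (f n)) \<le> C * (r - r' n)"
        unfolding real_norm_def
        by (rule abs_integral_le[OF int']) (use r r'r in \<open>auto intro!: f intro: order_trans\<close>)
      also have "\<dots> \<le> C * (1 / real (Ns n))"
        using r'r[of n] C by (intro mult_left_mono) linarith+
      finally show ?thesis .
    qed
    then show "\<forall>\<^sub>F n in sequentially. norm (integral {r' n..r} (f n)) \<le> C * (1 / real (Ns n))"
      by simp
  qed
  from tendsto_diff[OF lim this]
  have "(\<lambda>n. integral {0..r} (f n) - integral {r' n..r} (f n)) \<longlonglongrightarrow> integral {0..r} F" by simp
  moreover have "integral {0..r} (f n) - integral {r' n..r} (f n)
      = (\<Sum>y<site (Ns n) r. a n y) / real (Ns n)" for n
  proof -
    have "integral {0..r' n} (f n) + integral {r' n..r} (f n) = integral {0..r} (f n)"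
      by (rule Henstock_Kurzweil_Integration.integral_combine) (use r'r int' r in auto)
    moreover have "integral {0..r' n} (f n) = (\<Sum>y<site (Ns n) r. a n y) / real (Ns n)"
      unfolding r'_def f_def by (rule integral_unique[OF sum_eq_integral_site[OF Ns(1)]])
    ultimately show ?thesis by simp
  qed
  ultimately show "(\<lambda>n. (\<Sum>y<site (Ns n) r. a n y) / real (Ns n)) \<longlonglongrightarrow> integral {0..r} F" by simp
qed

section \<open>The free boundary problem: flux condition and uniqueness\<close>

lemma tendsto_at_rightI_sequentially_zero:
  fixes f :: "real \<Rightarrow> real"
  assumes "\<And>X. (\<And>n. 0 < X n) \<Longrightarrow> X \<longlonglongrightarrow> 0 \<Longrightarrow> (\<lambda>n. f (X n)) \<longlonglongrightarrow> l"
  shows "(f \<longlongrightarrow> l) (at_right 0)"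
  unfolding tendsto_at_iff_sequentially
  using assms by (auto simp: o_def)

lemma integral_initial_limit:
  fixes f :: "real \<Rightarrow> real \<Rightarrow> real"
  assumes l: "0 \<le> l" "l \<le> 1"
    and bdd: "eventually (\<lambda>t. \<forall>r\<in>{0..1}. \<bar>f r t\<bar> \<le> C) (at_right 0)"
    and int: "\<And>t. 0 < t \<Longrightarrow> (\<lambda>r. f r t) integrable_on {0..l}"
    and lim: "\<And>r. r \<in> {0<..<1} \<Longrightarrow> ((\<lambda>t. f r t) \<longlongrightarrow> f0 r) (at_right 0)"
  shows "((\<lambda>t. integral {0..l} (\<lambda>r. f r t)) \<longlongrightarrow> integral {0..l} f0) (at_right 0)"
proof (rule tendsto_at_rightI_sequentially_zero)
  fix X :: "nat \<Rightarrow> real" assume X: "\<And>n. 0 < X n" "X \<longlonglongrightarrow> 0"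
  have X': "filterlim X (at_right 0) sequentially"
    using X less_imp_neq[OF X(1)] by (auto simp: filterlim_at intro!: always_eventually)
  have ev: "eventually (\<lambda>n. \<forall>r\<in>{0..1}. \<bar>f r (X n)\<bar> \<le> C) sequentially"
    using filterlim_iff[THEN iffD1, OF X'] bdd by blast
  then obtain m where "\<forall>n\<ge>m. \<forall>r\<in>{0..1}. \<bar>f r (X n)\<bar> \<le> C"
    unfolding eventually_sequentially by blast
  then have m: "\<And>n r. m \<le> n \<Longrightarrow> r \<in> {0..1} \<Longrightarrow> \<bar>f r (X n)\<bar> \<le> C" by blast
  define g where "g = (\<lambda>r. if r \<in> {0<..<1} then f0 r else 0)"
  have "(\<lambda>n. integral {0..l} (\<lambda>r. if r \<in> {0<..<1} then f r (X (n + m)) else 0)) \<longlonglongrightarrow> integral {0..l} g"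
  proof (rule dominated_convergence(2)[where h = "\<lambda>_. C"])
    show "(\<lambda>r. if r \<in> {0<..<1} then f r (X (n + m)) else 0) integrable_on {0..l}" for n
      by (rule integrable_spike_finite[OF _ _ int[OF X(1)], of "{0, 1}"]) (use l in auto)
    show "(\<lambda>n. if r \<in> {0<..<1} then f r (X (n + m)) else 0) \<longlonglongrightarrow> g r" for r
      using filterlim_compose[OF lim X', of r] LIMSEQ_ignore_initial_segment[of "\<lambda>n. f r (X n)" "f0 r" m]
      by (auto simp: g_def)
    show "norm (if r \<in> {0<..<1} then f r (X (n + m)) else 0) \<le> C" if "r \<in> {0..l}" for n r
      using m[of "n + m" r] that l m[of "n + m" 0] by (auto intro: order_trans[OF abs_ge_zero])
  qed (rule integrable_const_ivl)
  moreover have "integral {0..l} (\<lambda>r. if r \<in> {0<..<1} then h r else 0) = integral {0..l} h" for h :: "real \<Rightarrow> real"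
    by (rule integral_spike[of "{0, 1}"]) (use l in auto)
  ultimately have "(\<lambda>n. integral {0..l} (\<lambda>r. f r (X (n + m)))) \<longlonglongrightarrow> integral {0..l} f0"
    by (simp add: g_def)
  then show "(\<lambda>n. integral {0..l} (\<lambda>r. f r (X n))) \<longlonglongrightarrow> integral {0..l} f0"
    by (rule LIMSEQ_offset)
qed

lemma
  fixes f :: "real \<Rightarrow> real \<Rightarrow> real"
  assumes "continuous_on ({0..1} \<times> {0<..}) (\<lambda>(r, t). f r t)"
  shows continuous_space_slice: "0 < t \<Longrightarrow> continuous_on {0..1} (\<lambda>r. f r t)"
    and continuous_time_slice: "r \<in> {0..1} \<Longrightarrow> continuous_on {0<..} (\<lambda>t. f r t)"
proof -
  assume t: "0 < t"
  have "continuous_on {0..1} (\<lambda>r :: real. (r, t))" by (intro continuous_intros)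
  from continuous_on_compose2[OF assms this] show "continuous_on {0..1} (\<lambda>r. f r t)"
    using t by (auto simp: image_subset_iff)
next
  assume r: "r \<in> {0..1}"
  have "continuous_on {0<..} (\<lambda>t :: real. (r, t))" by (intro continuous_intros)
  from continuous_on_compose2[OF assms this] show "continuous_on {0<..} (\<lambda>t. f r t)"
    using r by (auto simp: image_subset_iff)
qed

text \<open>Leibniz' rule, for functions that are smooth only at positive times.\<close>

lemma time_derivative_integral:
  fixes f ft :: "real \<Rightarrow> real \<Rightarrow> real"
  assumes l: "0 \<le> l" "l \<le> 1" and t: "0 < t"
    and der: "\<And>r t. r \<in> {0..1} \<Longrightarrow> 0 < t \<Longrightarrow> ((\<lambda>t. f r t) has_real_derivative ft r t) (at t)"
    and cont: "continuous_on ({0..1} \<times> {0<..}) (\<lambda>(r, t). f r t)"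
      "continuous_on ({0..1} \<times> {0<..}) (\<lambda>(r, t). ft r t)"
  shows "((\<lambda>t. integral {0..l} (\<lambda>r. f r t)) has_real_derivative integral {0..l} (\<lambda>r. ft r t)) (at t)"
proof -
  have "((\<lambda>t. integral (cbox 0 l) (\<lambda>r. f r t)) has_real_derivative
      integral (cbox 0 l) (\<lambda>r. ft r t)) (at t within {0<..})"
  proof (rule leibniz_rule_field_derivative[where f = "\<lambda>t r. f r t" and fx = "\<lambda>t r. ft r t"])
    show "((\<lambda>t. f r t) has_real_derivative ft r t) (at t within {0<..})"
      if "t \<in> {0<..}" "r \<in> cbox 0 l" for t r
      by (rule has_field_derivative_at_within[OF der]) (use that l in auto)
    show "(\<lambda>r. f r t) integrable_on cbox 0 l" if "t \<in> {0<..}" for t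
    proof (rule integrable_continuous)
      have "continuous_on (cbox 0 l) (\<lambda>r. (r, t))" by (intro continuous_intros)
      from continuous_on_compose2[OF cont(1) this] show "continuous_on (cbox 0 l) (\<lambda>r. f r t)"
        using that l by (auto simp: image_subset_iff)
    qed
    have "continuous_on ({0<..} \<times> cbox 0 l) (\<lambda>p. (snd p, fst p))" by (intro continuous_intros)
    from continuous_on_compose2[OF cont(2) this]
    show "continuous_on ({0<..} \<times> cbox 0 l) (\<lambda>(t, r). ft r t)"
      using l by (auto simp: case_prod_unfold image_subset_iff)
  qed (use t in auto)
  moreover have "at t within {0<..} = at t" using t by (intro at_within_open) auto
  ultimately show ?thesis by simp
qed

locale heat_solution =
  fixes u ur urr ut :: "real \<Rightarrow> real \<Rightarrow> real"
  assumes C21: "C21_with u ur urr ut"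
    and heat: "\<And>r t. r \<in> {0..1} \<Longrightarrow> 0 < t \<Longrightarrow> ut r t = 1/2 * urr r t"
begin

lemma
  assumes "r \<in> {0..1}" "0 < t"
  shows der_r: "((\<lambda>r. u r t) has_real_derivative ur r t) (at r within {0..1})"
    and der_rr: "((\<lambda>r. ur r t) has_real_derivative urr r t) (at r within {0..1})"
    and der_t: "((\<lambda>t. u r t) has_real_derivative ut r t) (at t)"
  using C21 assms unfolding C21_with_def by blast+

lemma cont:
  shows "continuous_on ({0..1} \<times> {0<..}) (\<lambda>(r, t). u r t)"
    "continuous_on ({0..1} \<times> {0<..}) (\<lambda>(r, t). ur r t)"
    "continuous_on ({0..1} \<times> {0<..}) (\<lambda>(r, t). urr r t)"
    "continuous_on ({0..1} \<times> {0<..}) (\<lambda>(r, t). ut r t)"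
  using C21 unfolding C21_with_def by auto

lemma flux_integrable:
  assumes "r \<in> {0..1}" "0 < s"
  shows "(\<lambda>\<tau>. 1/2 * ur r \<tau>) integrable_on {s..t}"
  by (intro integrable_continuous_real continuous_intros
      continuous_on_subset[OF continuous_time_slice[OF cont(2) assms(1)]]) (use assms(2) in auto)

lemma mass_derivative:
  assumes l: "l \<in> {0..1}" and t: "0 < t"
  shows "((\<lambda>t. integral {0..l} (\<lambda>r. u r t)) has_real_derivative
    1/2 * ur l t - 1/2 * ur 0 t) (at t)"
proof -
  have "((\<lambda>r. ut r t) has_integral 1/2 * ur l t - 1/2 * ur 0 t) {0..l}"
  proof (rule fundamental_theorem_of_calculus)
    fix r assume r: "r \<in> {0..l}"
    have r01: "r \<in> {0..1}" using r l by auto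
    have "((\<lambda>r. 1/2 * ur r t) has_real_derivative ut r t) (at r within {0..1})"
      unfolding heat[OF r01 t] by (intro DERIV_cmult der_rr r01 t)
    then show "((\<lambda>r. 1/2 * ur r t) has_vector_derivative ut r t) (at r within {0..l})"
      unfolding has_real_derivative_iff_has_vector_derivative[symmetric]
      by (rule has_field_derivative_subset) (use l in auto)
  qed (use l in auto)
  then have "integral {0..l} (\<lambda>r. ut r t) = 1/2 * ur l t - 1/2 * ur 0 t" by (rule integral_unique)
  moreover have "((\<lambda>t. integral {0..l} (\<lambda>r. u r t)) has_real_derivative
      integral {0..l} (\<lambda>r. ut r t)) (at t)"
    by (rule time_derivative_integral[OF _ _ t der_t cont(1,4)]) (use l in auto)
  ultimately show ?thesis by simp
qed

text \<open>The mass in \<open>[0, l]\<close> changes only by the fluxes through \<open>0\<close> and \<open>l\<close>. Hence fluxes at different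
positions determine each other, up to an error that tends to \<open>0\<close> with the distance.\<close>

lemma mass_balance:
  assumes l: "l \<in> {0..1}" and s: "0 < s" "s \<le> t"
  shows "integral {s..t} (\<lambda>\<tau>. 1/2 * ur l \<tau>) = integral {s..t} (\<lambda>\<tau>. 1/2 * ur 0 \<tau>)
    + (integral {0..l} (\<lambda>r. u r t) - integral {0..l} (\<lambda>r. u r s))"
proof -
  have "((\<lambda>\<tau>. 1/2 * ur l \<tau> - 1/2 * ur 0 \<tau>) has_integral
      integral {0..l} (\<lambda>r. u r t) - integral {0..l} (\<lambda>r. u r s)) {s..t}"
  proof (rule fundamental_theorem_of_calculus[OF s(2)])
    fix \<tau> assume "\<tau> \<in> {s..t}"
    then show "((\<lambda>t. integral {0..l} (\<lambda>r. u r t)) has_vector_derivative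
        1/2 * ur l \<tau> - 1/2 * ur 0 \<tau>) (at \<tau> within {s..t})"
      unfolding has_real_derivative_iff_has_vector_derivative[symmetric]
      by (intro has_field_derivative_at_within[OF mass_derivative[OF l]]) (use s in auto)
  qed
  then have "integral {0..l} (\<lambda>r. u r t) - integral {0..l} (\<lambda>r. u r s)
      = integral {s..t} (\<lambda>\<tau>. 1/2 * ur l \<tau> - 1/2 * ur 0 \<tau>)"
    by (rule integral_unique[symmetric])
  also have "\<dots> = integral {s..t} (\<lambda>\<tau>. 1/2 * ur l \<tau>) - integral {s..t} (\<lambda>\<tau>. 1/2 * ur 0 \<tau>)"
    using l s by (intro Henstock_Kurzweil_Integration.integral_diff flux_integrable) auto
  finally show ?thesis by simp
qed

text \<open>By mass balance, the time integrals of the flux at \<open>l\<close> and at the end point \<open>a\<close> differ by masses,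
which converge as the initial time tends to \<open>0\<close> by dominated convergence. So the inner limit exists
for one position if and only if it exists for all, and as a function of \<open>l\<close> it is continuous up to
\<open>a\<close>: the outer limit replaces \<open>l\<close> by \<open>a\<close>.\<close>

lemma iterated_limit_iff:
  assumes a: "a = 0 \<or> a = 1" and t: "0 < t"
    and bdd: "bounded_near_initial_time u"
    and u0: "continuous_on {0..1} u0"
    and init: "\<And>r. r \<in> {0<..<1} \<Longrightarrow> ((\<lambda>t. u r t) \<longlongrightarrow> u0 r) (at_right 0)"
  shows "iterated_limit (\<lambda>l s. integral {s..t} (\<lambda>\<tau>. 1/2 * ur l \<tau>)) c (at a within {0<..<1}) (at_right 0)
    \<longleftrightarrow> ((\<lambda>s. integral {s..t} (\<lambda>\<tau>. 1/2 * ur a \<tau>)) \<longlongrightarrow> c) (at_right 0)"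
proof -
  define F where "F = (\<lambda>l s. integral {s..t} (\<lambda>\<tau>. 1/2 * ur l \<tau>))"
  define M where "M = (\<lambda>l s. integral {0..l} (\<lambda>r. u r s))"
  define M0 where "M0 = (\<lambda>l. integral {0..l} u0)"
  define H where "H = (\<lambda>l. (M l t - M0 l) - (M a t - M0 a))"
  have a01: "a \<in> {0..1}" using a by auto
  have M_lim: "((\<lambda>s. M l s) \<longlongrightarrow> M0 l) (at_right 0)" if "l \<in> {0..1}" for l
  proof -
    from bdd obtain C where "eventually (\<lambda>t. \<forall>r\<in>{0..1}. \<bar>u r t\<bar> \<le> C) (at_right 0)"
      by (auto simp: bounded_near_initial_time_def)
    then show ?thesis unfolding M_def M0_def
      by (rule integral_initial_limit[rotated 2])
        (use that init in \<open>auto intro!: integrable_continuous_real continuous_on_subset[OF continuous_space_slice[OF cont(1)]]\<close>)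
  qed
  have before: "eventually (\<lambda>s. 0 < s \<and> s \<le> t) (at_right 0)"
    using t by (auto simp: eventually_at_right_field intro!: exI[of _ t])
  have shift: "eventually (\<lambda>s. F l s = F l' s + ((M l t - M l s) - (M l' t - M l' s))) (at_right 0)"
    if "l \<in> {0..1}" "l' \<in> {0..1}" for l l'
    using before
  proof eventually_elim
    case (elim s)
    then show ?case
      using mass_balance[OF that(1), of s t] mass_balance[OF that(2), of s t] unfolding F_def M_def by linarith
  qed
  have transfer: "(F l \<longlongrightarrow> c + ((M l t - M0 l) - (M l' t - M0 l'))) (at_right 0)"
    if "l \<in> {0..1}" "l' \<in> {0..1}" "(F l' \<longlongrightarrow> c) (at_right 0)" for l l' c
  proof (rule Lim_transform_eventually[rotated])
    show "eventually (\<lambda>s. F l' s + ((M l t - M l s) - (M l' t - M l' s)) = F l s) (at_right 0)"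
      using shift[OF that(1,2)] by eventually_elim simp
    show "((\<lambda>s. F l' s + ((M l t - M l s) - (M l' t - M l' s))) \<longlongrightarrow>
        c + ((M l t - M0 l) - (M l' t - M0 l'))) (at_right 0)"
      by (intro tendsto_intros M_lim that)
  qed
  have near: "eventually (\<lambda>l. l \<in> {0..1}) (at a within {0<..<1})"
    by (auto simp: eventually_at_filter)
  have H_lim: "(H \<longlongrightarrow> 0) (at a within {0<..<1})"
  proof -
    have "continuous_on {0..1} (\<lambda>l. M l t)" unfolding M_def
      by (intro indefinite_integral_continuous_1 integrable_continuous_real continuous_space_slice[OF cont(1) t])
    moreover have "continuous_on {0..1} M0" unfolding M0_def
      by (intro indefinite_integral_continuous_1 integrable_continuous_real u0)
    ultimately have "continuous_on {0..1} H" unfolding H_def by (intro continuous_intros)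
    then have "(H \<longlongrightarrow> H a) (at a within {0..1})" using a01 by (auto simp: continuous_on_def)
    then have "(H \<longlongrightarrow> H a) (at a within {0<..<1})" by (rule tendsto_within_subset) auto
    then show ?thesis by (simp add: H_def)
  qed
  have nontriv: "at a within {0<..<1} \<noteq> (bot :: real filter)"
    using a by (auto simp: at_within_eq_bot_iff)
  show ?thesis
  proof
    assume "((\<lambda>s. integral {s..t} (\<lambda>\<tau>. 1/2 * ur a \<tau>)) \<longlongrightarrow> c) (at_right 0)"
    then have c: "(F a \<longlongrightarrow> c) (at_right 0)" by (simp add: F_def)
    show "iterated_limit (\<lambda>l s. integral {s..t} (\<lambda>\<tau>. 1/2 * ur l \<tau>)) c (at a within {0<..<1}) (at_right 0)"
      unfolding iterated_limit_def F_def[symmetric]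
    proof (intro exI conjI)
      show "eventually (\<lambda>l. (F l \<longlongrightarrow> c + H l) (at_right 0)) (at a within {0<..<1})"
        using near by eventually_elim (unfold H_def, intro transfer a01 c)
      show "((\<lambda>l. c + H l) \<longlongrightarrow> c) (at a within {0<..<1})"
        using tendsto_add[OF tendsto_const H_lim, of c] by simp
    qed
  next
    assume "iterated_limit (\<lambda>l s. integral {s..t} (\<lambda>\<tau>. 1/2 * ur l \<tau>)) c (at a within {0<..<1}) (at_right 0)"
    then obtain g where g: "eventually (\<lambda>l. (F l \<longlongrightarrow> g l) (at_right 0)) (at a within {0<..<1})"
      "(g \<longlongrightarrow> c) (at a within {0<..<1})"
      unfolding iterated_limit_def F_def[symmetric] by blast
    have "\<exists>l. l \<in> {0..1} \<and> (F l \<longlongrightarrow> g l) (at_right 0)"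
      using eventually_happens[OF eventually_conj[OF near g(1)]] nontriv by auto
    then obtain l where "l \<in> {0..1}" "(F l \<longlongrightarrow> g l) (at_right 0)" by blast
    from transfer[OF a01 this] obtain c' where c': "(F a \<longlongrightarrow> c') (at_right 0)" by blast
    have "eventually (\<lambda>l. c' + H l = g l) (at a within {0<..<1})"
      using near g(1)
    proof eventually_elim
      case (elim l)
      have "(F l \<longlongrightarrow> c' + H l) (at_right 0)"
        unfolding H_def by (rule transfer[OF elim(1) a01 c'])
      then show ?case using tendsto_unique[OF _ _ elim(2)] by simp
    qed
    moreover have "((\<lambda>l. c' + H l) \<longlongrightarrow> c') (at a within {0<..<1})"
      using tendsto_add[OF tendsto_const H_lim, of c'] by simp
    ultimately have "(g \<longlongrightarrow> c') (at a within {0<..<1})"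
      by (rule Lim_transform_eventually[rotated])
    then have "c' = c" using tendsto_unique[OF nontriv _ g(2)] by blast
    then show "((\<lambda>s. integral {s..t} (\<lambda>\<tau>. 1/2 * ur a \<tau>)) \<longlongrightarrow> c) (at_right 0)"
      using c' by (simp add: F_def)
  qed
qed

text \<open>The integrated boundary law, differentiated. The sign \<open>\<sigma>\<close> is \<open>1\<close> at \<open>0\<close> and \<open>- 1\<close> at \<open>1\<close>.\<close>

lemma boundary_speed:
  assumes a: "a \<in> {0..1}" and t: "0 < t"
    and balance: "\<And>s t. 0 < s \<Longrightarrow> s \<le> t \<Longrightarrow> integral {s..t} (\<lambda>\<tau>. 1/2 * ur a \<tau>) = \<sigma> * (u a t - u a s)"
  shows "1/2 * ur a t = \<sigma> * ut a t"
proof -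
  have "continuous_on {t / 2..t + 1} (\<lambda>\<tau>. 1/2 * ur a \<tau>)"
    by (intro continuous_intros continuous_on_subset[OF continuous_time_slice[OF cont(2) a]]) (use t in auto)
  then have "((\<lambda>t'. integral {t / 2..t'} (\<lambda>\<tau>. 1/2 * ur a \<tau>)) has_real_derivative 1/2 * ur a t)
      (at t within {t / 2..t + 1})"
    by (rule integral_has_real_derivative) (use t in auto)
  then have "((\<lambda>t'. \<sigma> * (u a t' - u a (t / 2))) has_real_derivative 1/2 * ur a t)
      (at t within {t / 2..t + 1})"
    by (rule has_field_derivative_transform_within[OF _ zero_less_one]) (use t balance in auto)
  moreover have "at t within {t / 2..t + 1} = at t"
    using t by (intro at_within_interior) (simp add: interior_atLeastAtMost_real)
  moreover have "((\<lambda>t'. \<sigma> * (u a t' - u a (t / 2))) has_real_derivative \<sigma> * (ut a t - 0)) (at t)"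
    by (intro DERIV_cmult DERIV_diff der_t a t DERIV_const)
  ultimately show ?thesis using DERIV_unique by fastforce
qed

text \<open>The energy \<open>u(0)\<^sup>2 + u(1)\<^sup>2 + \<integral> u\<^sup>2\<close> has the derivative \<open>- \<integral> u\<^sub>r\<^sup>2\<close>: the boundary laws say that the
boundary terms of the integration by parts are absorbed by the reservoirs. Boundedness makes the
energy tend to \<open>0\<close> with time, although \<open>u\<close> tends to \<open>0\<close> only pointwise.\<close>

lemma zero_of_zero_initial_data:
  assumes bc: "\<And>t. 0 < t \<Longrightarrow> ut 0 t = 1/2 * ur 0 t" "\<And>t. 0 < t \<Longrightarrow> ut 1 t = - (1/2 * ur 1 t)"
    and bdd: "bounded_near_initial_time u"
    and init: "\<And>r. r \<in> {0..1} \<Longrightarrow> ((\<lambda>t. u r t) \<longlongrightarrow> 0) (at_right 0)"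
    and r: "r \<in> {0..1}" and t: "0 < t"
  shows "u r t = 0"
proof -
  define E where "E = (\<lambda>t. (u 0 t)\<^sup>2 + (u 1 t)\<^sup>2 + integral {0..1} (\<lambda>r. (u r t)\<^sup>2))"
  have cont_sq: "continuous_on ({0..1} \<times> {0<..}) (\<lambda>(r, t). (u r t)\<^sup>2)"
    "continuous_on ({0..1} \<times> {0<..}) (\<lambda>(r, t). 2 * u r t * ut r t)"
    using cont(1,4) unfolding case_prod_unfold by (auto intro!: continuous_intros)
  have E_der: "(E has_real_derivative - integral {0..1} (\<lambda>r. (ur r t)\<^sup>2)) (at t)" if t: "0 < t" for t
  proof -
    have "((\<lambda>t. (u r t)\<^sup>2) has_real_derivative 2 * u r t * ut r t) (at t)"
      if "r \<in> {0..1}" "0 < t" for r t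
      by (auto intro!: derivative_eq_intros der_t that)
    note d = this
    have "((\<lambda>r. (ur r t)\<^sup>2 + 2 * u r t * ut r t) has_integral u 1 t * ur 1 t - u 0 t * ur 0 t) {0..1}"
    proof (rule fundamental_theorem_of_calculus)
      fix r :: real assume r: "r \<in> {0..1}"
      have "((\<lambda>r. u r t * ur r t) has_real_derivative ur r t * ur r t + urr r t * u r t) (at r within {0..1})"
        by (rule DERIV_mult[OF der_r[OF r t] der_rr[OF r t]])
      then show "((\<lambda>r. u r t * ur r t) has_vector_derivative (ur r t)\<^sup>2 + 2 * u r t * ut r t) (at r within {0..1})"
        unfolding has_real_derivative_iff_has_vector_derivative[symmetric] heat[OF r t]
        by (simp add: power2_eq_square mult.commute)
    qed simp
    then have "integral {0..1} (\<lambda>r. (ur r t)\<^sup>2 + 2 * u r t * ut r t) = u 1 t * ur 1 t - u 0 t * ur 0 t"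
      by (rule integral_unique)
    moreover have "integral {0..1} (\<lambda>r. (ur r t)\<^sup>2 + 2 * u r t * ut r t)
        = integral {0..1} (\<lambda>r. (ur r t)\<^sup>2) + integral {0..1} (\<lambda>r. 2 * u r t * ut r t)"
      by (intro Henstock_Kurzweil_Integration.integral_add integrable_continuous_real
          continuous_space_slice[OF cont_sq(2) t] continuous_intros continuous_space_slice[OF cont(2) t])
    moreover have "(E has_real_derivative 2 * u 0 t * ut 0 t + 2 * u 1 t * ut 1 t
        + integral {0..1} (\<lambda>r. 2 * u r t * ut r t)) (at t)"
      unfolding E_def
      by (intro DERIV_add d time_derivative_integral[OF _ _ t d cont_sq] t) auto
    moreover have "2 * u 0 t * ut 0 t = u 0 t * ur 0 t" "2 * u 1 t * ut 1 t = - (u 1 t * ur 1 t)"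
      by (simp_all add: bc[OF t])
    then have "2 * u 0 t * ut 0 t + 2 * u 1 t * ut 1 t + integral {0..1} (\<lambda>r. 2 * u r t * ut r t)
        = - integral {0..1} (\<lambda>r. (ur r t)\<^sup>2)"
      using calculation(1,2) by linarith
    ultimately show ?thesis by (simp only:)
  qed
  have dec: "E t \<le> E s" if "0 < s" "s \<le> t" for s t
  proof (rule DERIV_nonpos_imp_nonincreasing[OF that(2)])
    fix x assume "s \<le> x" "x \<le> t"
    then have x: "0 < x" using that by simp
    have "0 \<le> integral {0..1} (\<lambda>r. (ur r x)\<^sup>2)"
      by (intro integral_nonneg integrable_continuous_real continuous_intros continuous_space_slice[OF cont(2) x]) auto
    then show "\<exists>y. (E has_real_derivative y) (at x) \<and> y \<le> 0" using E_der[OF x] by force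
  qed
  from bdd obtain C where C: "eventually (\<lambda>t. \<forall>r\<in>{0..1}. \<bar>u r t\<bar> \<le> C) (at_right 0)"
    by (auto simp: bounded_near_initial_time_def)
  have "((\<lambda>t. integral {0..1} (\<lambda>r. (u r t)\<^sup>2)) \<longlongrightarrow> integral {0..1} (\<lambda>r :: real. 0)) (at_right 0)"
  proof (rule integral_initial_limit[where f = "\<lambda>r t. (u r t)\<^sup>2" and C = "C\<^sup>2"])
    show "eventually (\<lambda>t. \<forall>r\<in>{0..1}. \<bar>(u r t)\<^sup>2\<bar> \<le> C\<^sup>2) (at_right 0)"
      using C by eventually_elim (auto simp: abs_le_square_iff[symmetric] intro: order_trans[OF _ abs_ge_self])
    show "(\<lambda>r. (u r t)\<^sup>2) integrable_on {0..1}" if "0 < t" for t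
      by (intro integrable_continuous_real continuous_space_slice[OF cont_sq(1) that])
    show "((\<lambda>t. (u r t)\<^sup>2) \<longlongrightarrow> 0) (at_right 0)" if "r \<in> {0<..<1}" for r
      using tendsto_power[OF init[of r], of 2] that by simp
  qed auto
  from tendsto_add[OF tendsto_add[OF tendsto_power[OF init[of 0], of 2] tendsto_power[OF init[of 1], of 2]] this]
  have E_lim: "(E \<longlongrightarrow> 0) (at_right 0)" by (simp add: E_def)
  have "E t \<le> 0"
  proof (rule tendsto_lowerbound[OF E_lim])
    show "eventually (\<lambda>s. E t \<le> E s) (at_right 0)"
      using t dec[of _ t] by (auto simp: eventually_at_right_field intro!: exI[of _ t])
  qed simp
  moreover have int: "0 \<le> integral {0..1} (\<lambda>r. (u r t)\<^sup>2)"
    by (intro integral_nonneg integrable_continuous_real continuous_space_slice[OF cont_sq(1) t]) auto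
  moreover have "0 \<le> (u 0 t)\<^sup>2" "0 \<le> (u 1 t)\<^sup>2" by auto
  ultimately have "integral {0..1} (\<lambda>r. (u r t)\<^sup>2) = 0" unfolding E_def by linarith
  then show ?thesis
    using integral_eq_0_iff[OF continuous_space_slice[OF cont_sq(1) t]] r by auto
qed

end

lemma C21_with_diff:
  assumes "C21_with u ur urr ut" "C21_with v vr vrr vt"
  shows "C21_with (\<lambda>r t. u r t - v r t) (\<lambda>r t. ur r t - vr r t) (\<lambda>r t. urr r t - vrr r t) (\<lambda>r t. ut r t - vt r t)"
proof -
  have "continuous_on ({0..1} \<times> {0<..}) (\<lambda>(r, t). f r t - g r t)"
    if "continuous_on ({0..1} \<times> {0<..}) (\<lambda>(r, t). f r t)" "continuous_on ({0..1} \<times> {0<..}) (\<lambda>(r, t). g r t)"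
    for f g :: "real \<Rightarrow> real \<Rightarrow> real"
    using that unfolding case_prod_unfold by (rule continuous_on_diff)
  then show ?thesis
    using assms unfolding C21_with_def by (auto intro!: DERIV_diff)
qed

lemma at_right_eq_at_within_unit: "at_right 0 = at 0 within {0<..<1 :: real}"
  by (rule at_within_nhd[of _ "{..<1}"]) auto

lemma at_left_eq_at_within_unit: "at_left 1 = at 1 within {0<..<1 :: real}"
  by (rule at_within_nhd[of _ "{0<..}"]) auto

text \<open>The flux conditions of the free boundary problem in local form. Subtracting them at two times removes
the initial time from the integrals, which can then be differentiated.\<close>

lemma free_boundary_solutionE:
  assumes sol: "free_boundary_solution u0 v0m v0p u vm vp"
    and bdd: "bounded_near_initial_time u" and u0: "continuous_on {0..1} u0"
  obtains ur urr ut where "heat_solution u ur urr ut"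
    "\<And>t. 0 < t \<Longrightarrow> vm t = u 0 t" "\<And>t. 0 < t \<Longrightarrow> vp t = u 1 t"
    "\<And>t. 0 < t \<Longrightarrow> ut 0 t = 1/2 * ur 0 t" "\<And>t. 0 < t \<Longrightarrow> ut 1 t = - (1/2 * ur 1 t)"
    "((\<lambda>t. u 0 t) \<longlongrightarrow> v0m) (at_right 0)" "((\<lambda>t. u 1 t) \<longlongrightarrow> v0p) (at_right 0)"
    "\<And>r. r \<in> {0<..<1} \<Longrightarrow> ((\<lambda>t. u r t) \<longlongrightarrow> u0 r) (at_right 0)"
proof -
  from sol obtain ur urr ut where C21: "C21_with u ur urr ut"
    and v0: "(vm \<longlongrightarrow> v0m) (at_right 0)" "(vp \<longlongrightarrow> v0p) (at_right 0)"
    and heat: "\<And>r t. r \<in> {0..1} \<Longrightarrow> 0 < t \<Longrightarrow> ut r t = 1/2 * urr r t"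
    and bd: "\<And>t. 0 < t \<Longrightarrow> u 1 t = vp t" "\<And>t. 0 < t \<Longrightarrow> u 0 t = vm t"
    and init: "\<And>r. r \<in> {0<..<1} \<Longrightarrow> ((\<lambda>t. u r t) \<longlongrightarrow> u0 r) (at_right 0)"
    and left: "\<And>t. 0 < t \<Longrightarrow> \<exists>c. iterated_limit (\<lambda>l t0. integral {t0..t} (\<lambda>s. 1/2 * ur l s)) c
        (at_right 0) (at_right 0) \<and> vm t = v0m + c"
    and right: "\<And>t. 0 < t \<Longrightarrow> \<exists>c. iterated_limit (\<lambda>l t0. integral {t0..t} (\<lambda>s. 1/2 * ur l s)) c
        (at_left 1) (at_right 0) \<and> vp t = v0p - c"
    unfolding free_boundary_solution_def by blast
  interpret heat_solution u ur urr ut by unfold_locales (fact C21, fact heat)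
  note ends = at_right_eq_at_within_unit at_left_eq_at_within_unit
  \<comment> \<open>The limits at two final times \<open>s\<close> and \<open>t\<close> differ by the integral over \<open>{s..t}\<close>.\<close>
  have split: "integral {s..t} (\<lambda>\<tau>. 1/2 * ur a \<tau>) = c t - c s"
    if lim: "\<And>t. 0 < t \<Longrightarrow> ((\<lambda>s. integral {s..t} (\<lambda>\<tau>. 1/2 * ur a \<tau>)) \<longlongrightarrow> c t) (at_right 0)"
      and s: "0 < s" "s \<le> t" and a: "a \<in> {0..1}" for a c s t
  proof -
    have "((\<lambda>s'. integral {s'..t} (\<lambda>\<tau>. 1/2 * ur a \<tau>) - integral {s'..s} (\<lambda>\<tau>. 1/2 * ur a \<tau>))
        \<longlongrightarrow> c t - c s) (at_right 0)"
      by (intro tendsto_diff lim) (use s in auto)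
    moreover have "eventually (\<lambda>s'. integral {s'..t} (\<lambda>\<tau>. 1/2 * ur a \<tau>) - integral {s'..s} (\<lambda>\<tau>. 1/2 * ur a \<tau>)
        = integral {s..t} (\<lambda>\<tau>. 1/2 * ur a \<tau>)) (at_right 0)"
    proof -
      have "eventually (\<lambda>s'. 0 < s' \<and> s' < s) (at_right 0)"
        using s by (auto simp: eventually_at_right_field)
      then show ?thesis
      proof eventually_elim
        case (elim s')
        then show ?case
          using Henstock_Kurzweil_Integration.integral_combine[OF _ s(2) flux_integrable[OF a, of s' t]] by simp
      qed
    qed
    ultimately have "((\<lambda>s' :: real. integral {s..t} (\<lambda>\<tau>. 1/2 * ur a \<tau>)) \<longlongrightarrow> c t - c s) (at_right 0)"
      by (rule Lim_transform_eventually)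
    then show ?thesis by (simp add: tendsto_const_iff)
  qed
  have lim0: "((\<lambda>s. integral {s..t} (\<lambda>\<tau>. 1/2 * ur 0 \<tau>)) \<longlongrightarrow> u 0 t - v0m) (at_right 0)" if t: "0 < t" for t
  proof -
    from left[OF t] obtain c where "iterated_limit (\<lambda>l t0. integral {t0..t} (\<lambda>s. 1/2 * ur l s)) c
        (at_right 0) (at_right 0)" "vm t = v0m + c" by blast
    then show ?thesis
      unfolding ends(1) using iterated_limit_iff[OF _ t bdd u0 init, of 0 c] bd[OF t] by (simp add: ends(1))
  qed
  have lim1: "((\<lambda>s. integral {s..t} (\<lambda>\<tau>. 1/2 * ur 1 \<tau>)) \<longlongrightarrow> v0p - u 1 t) (at_right 0)" if t: "0 < t" for t
  proof -
    from right[OF t] obtain c where "iterated_limit (\<lambda>l t0. integral {t0..t} (\<lambda>s. 1/2 * ur l s)) c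
        (at_left 1) (at_right 0)" "vp t = v0p - c" by blast
    then show ?thesis
      using iterated_limit_iff[OF _ t bdd u0 init, of 1 c] bd[OF t] by (simp add: ends(2))
  qed
  have positive: "eventually (\<lambda>t. 0 < t) (at_right (0 :: real))" by (rule eventually_at_right_less)
  show ?thesis
  proof (rule that)
    show "heat_solution u ur urr ut" by unfold_locales
    show "ut 0 t = 1/2 * ur 0 t" if "0 < t" for t
      using boundary_speed[OF _ that, of 0 1] split[OF lim0, of _ _] by auto
    show "ut 1 t = - (1/2 * ur 1 t)" if "0 < t" for t
      using boundary_speed[OF _ that, of 1 "- 1"] split[OF lim1, of _ _] by auto
    show "((\<lambda>t. u 0 t) \<longlongrightarrow> v0m) (at_right 0)"
      by (rule Lim_transform_eventually[OF v0(1)]) (use positive bd in \<open>auto elim!: eventually_mono\<close>)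
    show "((\<lambda>t. u 1 t) \<longlongrightarrow> v0p) (at_right 0)"
      by (rule Lim_transform_eventually[OF v0(2)]) (use positive bd in \<open>auto elim!: eventually_mono\<close>)
  qed (use bd init in auto)
qed

lemma free_boundary_solution_unique:
  assumes u0: "continuous_on {0..1} u0"
    and u: "free_boundary_solution u0 v0m v0p u vm vp" "bounded_near_initial_time u"
    and v: "free_boundary_solution u0 v0m v0p v wm wp" "bounded_near_initial_time v"
    and t: "0 < t"
  shows "r \<in> {0..1} \<Longrightarrow> u r t = v r t" "vm t = wm t" "vp t = wp t"
proof -
  obtain ur urr ut where U: "heat_solution u ur urr ut"
    "\<And>t. 0 < t \<Longrightarrow> vm t = u 0 t" "\<And>t. 0 < t \<Longrightarrow> vp t = u 1 t"
    "\<And>t. 0 < t \<Longrightarrow> ut 0 t = 1/2 * ur 0 t" "\<And>t. 0 < t \<Longrightarrow> ut 1 t = - (1/2 * ur 1 t)"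
    "((\<lambda>t. u 0 t) \<longlongrightarrow> v0m) (at_right 0)" "((\<lambda>t. u 1 t) \<longlongrightarrow> v0p) (at_right 0)"
    "\<And>r. r \<in> {0<..<1} \<Longrightarrow> ((\<lambda>t. u r t) \<longlongrightarrow> u0 r) (at_right 0)"
    by (rule free_boundary_solutionE[OF u u0]) blast
  obtain vr vrr vt where V: "heat_solution v vr vrr vt"
    "\<And>t. 0 < t \<Longrightarrow> wm t = v 0 t" "\<And>t. 0 < t \<Longrightarrow> wp t = v 1 t"
    "\<And>t. 0 < t \<Longrightarrow> vt 0 t = 1/2 * vr 0 t" "\<And>t. 0 < t \<Longrightarrow> vt 1 t = - (1/2 * vr 1 t)"
    "((\<lambda>t. v 0 t) \<longlongrightarrow> v0m) (at_right 0)" "((\<lambda>t. v 1 t) \<longlongrightarrow> v0p) (at_right 0)"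
    "\<And>r. r \<in> {0<..<1} \<Longrightarrow> ((\<lambda>t. v r t) \<longlongrightarrow> u0 r) (at_right 0)"
    by (rule free_boundary_solutionE[OF v u0]) blast
  define w where "w = (\<lambda>r t. u r t - v r t)"
  interpret w: heat_solution w "\<lambda>r t. ur r t - vr r t" "\<lambda>r t. urr r t - vrr r t" "\<lambda>r t. ut r t - vt r t"
    unfolding w_def using U(1) V(1) by (auto simp: heat_solution_def intro!: C21_with_diff)
  have "bounded_near_initial_time w"
  proof -
    from u(2) v(2) obtain C D where "eventually (\<lambda>t. \<forall>r\<in>{0..1}. \<bar>u r t\<bar> \<le> C) (at_right 0)"
      "eventually (\<lambda>t. \<forall>r\<in>{0..1}. \<bar>v r t\<bar> \<le> D) (at_right 0)"
      by (auto simp: bounded_near_initial_time_def)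
    then have "eventually (\<lambda>t. \<forall>r\<in>{0..1}. \<bar>w r t\<bar> \<le> C + D) (at_right 0)"
      by eventually_elim (auto simp: w_def intro!: order_trans[OF abs_triangle_ineq4] add_mono)
    then show ?thesis by (auto simp: bounded_near_initial_time_def)
  qed
  moreover have "((\<lambda>t. w r t) \<longlongrightarrow> 0) (at_right 0)" if r: "r \<in> {0..1}" for r
  proof -
    consider "r = 0" | "r = 1" | "r \<in> {0<..<1}"
      using r by (cases "r = 0"; cases "r = 1") auto
    then show ?thesis
    proof cases
      case 1
      then show ?thesis using tendsto_diff[OF U(6) V(6)] by (simp add: w_def)
    next
      case 2
      then show ?thesis using tendsto_diff[OF U(7) V(7)] by (simp add: w_def)
    next
      case 3
      then show ?thesis using tendsto_diff[OF U(8) V(8), of r r] by (simp add: w_def)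
    qed
  qed
  ultimately have "w r t = 0" if "r \<in> {0..1}" for r
    using w.zero_of_zero_initial_data[OF _ _ _ _ that t] U(4,5) V(4,5) by (simp add: right_diff_distrib)
  then have eq: "u r t = v r t" if "r \<in> {0..1}" for r using that by (simp add: w_def)
  then show "r \<in> {0..1} \<Longrightarrow> u r t = v r t" .
  show "vm t = wm t" "vp t = wp t" using eq[of 0] eq[of 1] U(2,3) V(2,3) t by auto
qed

section \<open>Limits of the rescaled chains\<close>

text \<open>Rescaled chains with common initial data. The number of sites is an arbitrary sequence tending to
infinity, so that the setting is stable under passing to subsequences.\<close>

locale flow_sequence =
  fixes Ns :: "nat \<Rightarrow> nat" and W :: "nat \<Rightarrow> nat \<Rightarrow> real \<Rightarrow> real"
    and u0 :: "real \<Rightarrow> real" and v0m v0p :: real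
  assumes flow: "\<And>n. bounded_flow (Ns n) (W n)"
    and Ns_lim: "filterlim Ns at_top sequentially"
    and u0_cont: "continuous_on {0..1} u0"
    and u0_bound: "\<And>r. r \<in> {0..1} \<Longrightarrow> \<bar>u0 r\<bar> \<le> 1"
    and init_left: "\<And>n. W n 0 0 = v0m"
    and init_right: "\<And>n. W n (Ns n + 1) 0 = v0p"
    and init_bulk: "\<And>n x. x \<in> {1..Ns n} \<Longrightarrow> W n x 0 = u0 (real x / real (Ns n))"
begin

definition speed :: "nat \<Rightarrow> nat \<Rightarrow> real \<Rightarrow> real" where
  "speed n x t = chain_op (Ns n) (\<lambda>z. W n z t) x"

lemma Ns_pos: "0 < Ns n"
  using flow by (simp add: bounded_flow_def)

lemma inverse_Ns_lim: "(\<lambda>n. 1 / real (Ns n)) \<longlonglongrightarrow> 0"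
  using filterlim_compose[OF lim_1_over_n Ns_lim] by (simp add: o_def)

lemma W_bound: "x \<le> Ns n + 1 \<Longrightarrow> 0 \<le> t \<Longrightarrow> \<bar>W n x t\<bar> \<le> 1"
  using flow[of n] by (simp add: bounded_flow_def)

lemma W_derivative:
  "x \<le> Ns n + 1 \<Longrightarrow> 0 \<le> t \<Longrightarrow> (W n x has_real_derivative speed n x t) (at t within {0..})"
  using flow[of n] heat_flowD[of "Ns n" "W n" x t] by (simp add: bounded_flow_def speed_def)

lemma equicontinuity_site:
  assumes "0 < \<tau>"
  obtains C where "0 \<le> C" "\<And>n x t. x \<le> Ns n + 1 \<Longrightarrow> \<tau> \<le> t \<Longrightarrow> \<bar>speed n x t\<bar> \<le> C"
    "\<And>n x y t. x \<le> Ns n + 1 \<Longrightarrow> y \<le> Ns n + 1 \<Longrightarrow> \<tau> \<le> t \<Longrightarrow>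
      \<bar>speed n x t - speed n y t\<bar> \<le> C * sqrt (\<bar>real x - real y\<bar> / real (Ns n))"
    "\<And>n r r' t t'. r \<in> {0..1} \<Longrightarrow> r' \<in> {0..1} \<Longrightarrow> \<tau> \<le> t \<Longrightarrow> \<tau> \<le> t' \<Longrightarrow>
      \<bar>W n (site (Ns n) r) t - W n (site (Ns n) r') t'\<bar>
        \<le> C * (sqrt (\<bar>r - r'\<bar> + 1 / real (Ns n)) + \<bar>t - t'\<bar>)"
    "\<And>n r r' t t'. r \<in> {0..1} \<Longrightarrow> r' \<in> {0..1} \<Longrightarrow> \<tau> \<le> t \<Longrightarrow> \<tau> \<le> t' \<Longrightarrow>
      \<bar>speed n (site (Ns n) r) t - speed n (site (Ns n) r') t'\<bar>
        \<le> C * (sqrt (\<bar>r - r'\<bar> + 1 / real (Ns n)) + \<bar>t - t'\<bar>)"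
proof -
  from equicontinuity[OF assms] obtain C where C: "0 \<le> C"
    "\<And>N w x t. bounded_flow N w \<Longrightarrow> x \<le> N + 1 \<Longrightarrow> \<tau> \<le> t \<Longrightarrow> \<bar>chain_op N (\<lambda>z. w z t) x\<bar> \<le> C"
    "\<And>N w x y t t'. bounded_flow N w \<Longrightarrow> x \<le> N + 1 \<Longrightarrow> y \<le> N + 1 \<Longrightarrow> \<tau> \<le> t \<Longrightarrow> \<tau> \<le> t' \<Longrightarrow>
      \<bar>w x t - w y t'\<bar> \<le> C * (sqrt (\<bar>real x - real y\<bar> / real N) + \<bar>t - t'\<bar>)"
    "\<And>N w x y t t'. bounded_flow N w \<Longrightarrow> x \<le> N + 1 \<Longrightarrow> y \<le> N + 1 \<Longrightarrow> \<tau> \<le> t \<Longrightarrow> \<tau> \<le> t' \<Longrightarrow>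
      \<bar>chain_op N (\<lambda>z. w z t) x - chain_op N (\<lambda>z. w z t') y\<bar>
        \<le> C * (sqrt (\<bar>real x - real y\<bar> / real N) + \<bar>t - t'\<bar>)"
    by blast
  have mono: "C * (sqrt (\<bar>real (site (Ns n) r) - real (site (Ns n) r')\<bar> / real (Ns n)) + \<bar>t - t'\<bar>)
      \<le> C * (sqrt (\<bar>r - r'\<bar> + 1 / real (Ns n)) + \<bar>t - t'\<bar>)"
    if "r \<in> {0..1}" "r' \<in> {0..1}" for n r r' and t t' :: real
    by (intro mult_left_mono add_right_mono real_sqrt_le_mono site_diff Ns_pos C(1)) (use that in auto)
  have le: "site (Ns n) r \<le> Ns n + 1" if "r \<in> {0..1}" for n r
    using site_le[of r "Ns n"] that by simp
  show ?thesis
  proof (rule that[OF C(1)], goal_cases)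
    case (1 n x t)
    then show ?case unfolding speed_def by (intro C(2) flow)
  next
    case (2 n x y t)
    then show ?case using C(4)[OF flow 2(1,2,3,3)] by (simp add: speed_def)
  next
    case (3 n r r' t t')
    show ?case
      by (rule order_trans[OF C(3)[OF flow le le] mono]) (use 3 in auto)
  next
    case (4 n r r' t t')
    show ?case unfolding speed_def
      by (rule order_trans[OF C(4)[OF flow le le] mono]) (use 4 in auto)
  qed
qed

lemma convergent_subsequence:
  obtains k u G where "strict_mono (k :: nat \<Rightarrow> nat)"
    "\<And>r t. r \<in> {0..1} \<Longrightarrow> 0 < t \<Longrightarrow> (\<lambda>n. W (k n) (site (Ns (k n)) r) t) \<longlonglongrightarrow> u r t"
    "\<And>r t. r \<in> {0..1} \<Longrightarrow> 0 < t \<Longrightarrow> (\<lambda>n. speed (k n) (site (Ns (k n)) r) t) \<longlonglongrightarrow> G r t"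
proof -
  define F where "F = (\<lambda>n p. (W n (site (Ns n) (fst p)) (snd p), speed n (site (Ns n) (fst p)) (snd p)))"
  define D :: "(real \<times> real) set" where "D = (\<rat> \<inter> {0..1}) \<times> (\<rat> \<inter> {0<..})"
  define S :: "(real \<times> real) set" where "S = {0..1} \<times> {0<..}"
  have le: "site (Ns n) r \<le> Ns n + 1" if "r \<in> {0..1}" for n r
    using site_le[of r "Ns n"] that by simp
  have "countable D" by (simp add: D_def countable_rat countable_Int1)
  then obtain k where k: "strict_mono (k :: nat \<Rightarrow> nat)" "\<And>p. p \<in> S \<Longrightarrow> convergent (\<lambda>n. F (k n) p)"
  proof (rule pointwise_convergent_subsequence[where F = F and S = S])
    fix p assume "p \<in> D"
    then obtain r t where p: "p = (r, t)" "r \<in> {0..1}" "0 < t" by (auto simp: D_def)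
    obtain C where "\<And>n x s. x \<le> Ns n + 1 \<Longrightarrow> t \<le> s \<Longrightarrow> \<bar>speed n x s\<bar> \<le> C"
      using equicontinuity_site[OF p(3)] by metis
    then have "norm (F n p) \<le> 1 + C" for n
      unfolding F_def p fst_conv snd_conv
      using W_bound[OF le[OF p(2)], of t n] p(3) le[OF p(2), of n]
      by (intro order_trans[OF norm_Pair_le] add_mono) auto
    then show "\<exists>B. \<forall>n. norm (F n p) \<le> B" by blast
  next
    fix p e assume "p \<in> S" and e: "0 < (e :: real)"
    then obtain r t where p: "p = (r, t)" and r: "r \<in> {0..1}" and t: "0 < t" by (auto simp: S_def)
    from t have t2: "0 < t / 2" by simp
    obtain C where C: "0 \<le> C"
      "\<And>n r r' s s'. r \<in> {0..1} \<Longrightarrow> r' \<in> {0..1} \<Longrightarrow> t / 2 \<le> s \<Longrightarrow> t / 2 \<le> s' \<Longrightarrow>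
        \<bar>W n (site (Ns n) r) s - W n (site (Ns n) r') s'\<bar>
          \<le> C * (sqrt (\<bar>r - r'\<bar> + 1 / real (Ns n)) + \<bar>s - s'\<bar>)"
      "\<And>n r r' s s'. r \<in> {0..1} \<Longrightarrow> r' \<in> {0..1} \<Longrightarrow> t / 2 \<le> s \<Longrightarrow> t / 2 \<le> s' \<Longrightarrow>
        \<bar>speed n (site (Ns n) r) s - speed n (site (Ns n) r') s'\<bar>
          \<le> C * (sqrt (\<bar>r - r'\<bar> + 1 / real (Ns n)) + \<bar>s - s'\<bar>)"
      using equicontinuity_site[OF t2] by metis
    \<comment> \<open>The rational point is chosen so close that space and time contribute at most \<open>\<eta> / 2\<close> each; the spacing
      \<open>1 / Ns n\<close> is eventually below \<open>\<delta>\<close> too, whence the \<open>2 * \<delta>\<close> below.\<close>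
    define \<eta> where "\<eta> = e / (2 * (C + 1))"
    have \<eta>: "0 < \<eta>" using e C by (simp add: \<eta>_def)
    define \<delta> where "\<delta> = min (\<eta>\<^sup>2 / 8) (min (\<eta> / 2) (t / 2))"
    have \<delta>: "0 < \<delta>" "2 * \<delta> \<le> (\<eta> / 2)\<^sup>2" "\<delta> \<le> \<eta> / 2" "\<delta> \<le> t / 2"
      using \<eta> t by (auto simp: \<delta>_def power_divide min_def)
    have "max 0 (r - \<delta>) < min 1 (r + \<delta>)" using r \<delta> by auto
    then obtain r' where r': "r' \<in> \<rat>" "max 0 (r - \<delta>) < r'" "r' < min 1 (r + \<delta>)"
      using Rats_dense_in_real by blast
    obtain t' where t': "t' \<in> \<rat>" "t - \<delta> < t'" "t' < t"
      using Rats_dense_in_real[of "t - \<delta>" t] \<delta> by auto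
    have "(r', t') \<in> D" using r' t' \<delta> t by (auto simp: D_def)
    moreover have "eventually (\<lambda>n. 1 / real (Ns n) < \<delta>) sequentially"
      using order_tendstoD(2)[OF inverse_Ns_lim \<delta>(1)] .
    then have "eventually (\<lambda>n. dist (F n p) (F n (r', t')) \<le> e) sequentially"
    proof eventually_elim
      case (elim n)
      have "sqrt (\<bar>r - r'\<bar> + 1 / real (Ns n)) \<le> sqrt ((\<eta> / 2)\<^sup>2)"
        using elim r' \<delta> by (intro real_sqrt_le_mono) auto
      then have "sqrt (\<bar>r - r'\<bar> + 1 / real (Ns n)) + \<bar>t - t'\<bar> \<le> \<eta>"
        using \<eta> \<delta> t' by (simp add: real_sqrt_unique) 
      then have "C * (sqrt (\<bar>r - r'\<bar> + 1 / real (Ns n)) + \<bar>t - t'\<bar>) \<le> C * \<eta>"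
        using C(1) by (rule mult_left_mono)
      also have "\<dots> \<le> e / 2"
        using C(1) e by (simp add: \<eta>_def field_simps)
      finally have *: "C * (sqrt (\<bar>r - r'\<bar> + 1 / real (Ns n)) + \<bar>t - t'\<bar>) \<le> e / 2" .
      have "r' \<in> {0..1}" "t / 2 \<le> t" "t / 2 \<le> t'" using r' t' \<delta> t by auto
      note ** = order_trans[OF C(2)[OF r this] *] order_trans[OF C(3)[OF r this] *]
      have "dist (F n p) (F n (r', t')) \<le> e / 2 + e / 2"
        unfolding p F_def dist_Pair_Pair fst_conv snd_conv
        by (rule order_trans[OF sqrt_sum_squares_le_sum]) (use ** in \<open>auto simp: dist_real_def intro!: add_mono\<close>)
      then show ?case by simp
    qed
    ultimately show "\<exists>q\<in>D. eventually (\<lambda>n. dist (F n p) (F n q) \<le> e) sequentially" by blast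
  qed blast
  have lim: "(\<lambda>n. F (k n) p) \<longlonglongrightarrow> lim (\<lambda>n. F (k n) p)" if "p \<in> S" for p
    using k(2)[OF that] by (simp add: convergent_LIMSEQ_iff)
  show ?thesis
  proof (rule that[OF k(1)])
    fix r t :: real assume "r \<in> {0..1}" "0 < t"
    then have "(r, t) \<in> S" by (simp add: S_def)
    from tendsto_fst[OF lim[OF this]] tendsto_snd[OF lim[OF this]]
    show "(\<lambda>n. W (k n) (site (Ns (k n)) r) t) \<longlonglongrightarrow> fst (lim (\<lambda>n. F (k n) (r, t)))"
      "(\<lambda>n. speed (k n) (site (Ns (k n)) r) t) \<longlonglongrightarrow> snd (lim (\<lambda>n. F (k n) (r, t)))"
      by (simp_all add: F_def)
  qed
qed

lemma flow_sequence_subsequence: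
  assumes "strict_mono (k :: nat \<Rightarrow> nat)"
  shows "flow_sequence (\<lambda>n. Ns (k n)) (\<lambda>n. W (k n)) u0 v0m v0p"
  using flow init_left init_right init_bulk u0_cont u0_bound
    filterlim_compose[OF Ns_lim filterlim_subseq[OF assms]]
  by unfold_locales auto

end

text \<open>The speeds \<open>L w\<close> are assumed to converge along with the profiles: the limit equation is obtained from
the limits of both.\<close>

locale convergent_flow = flow_sequence +
  fixes u G :: "real \<Rightarrow> real \<Rightarrow> real"
  assumes u_lim: "\<And>r t. r \<in> {0..1} \<Longrightarrow> 0 < t \<Longrightarrow> (\<lambda>n. W n (site (Ns n) r) t) \<longlonglongrightarrow> u r t"
    and G_lim: "\<And>r t. r \<in> {0..1} \<Longrightarrow> 0 < t \<Longrightarrow> (\<lambda>n. speed n (site (Ns n) r) t) \<longlonglongrightarrow> G r t"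
begin

text \<open>This will be \<open>u\<^sub>r\<close>. The formula is the limit of the equation summed from the left reservoir, where
\<open>u\<^sub>r(0) = 2 G(0)\<close>.\<close>

definition flux :: "real \<Rightarrow> real \<Rightarrow> real" where
  "flux r t = 2 * G 0 t + 2 * integral {0..r} (\<lambda>s. G s t)"

lemma u_bound:
  assumes "r \<in> {0..1}" "0 < t"
  shows "\<bar>u r t\<bar> \<le> 1"
proof (rule LIMSEQ_le_const2[OF tendsto_rabs[OF u_lim[OF assms]]])
  show "\<exists>m. \<forall>n\<ge>m. \<bar>W n (site (Ns n) r) t\<bar> \<le> 1"
  proof -
    have "\<bar>W n (site (Ns n) r) t\<bar> \<le> 1" for n
      by (rule W_bound) (use site_le[of r "Ns n"] assms in auto)
    then show ?thesis by blast
  qed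
qed

lemma modulus:
  assumes "0 < \<tau>"
  obtains C where "0 \<le> C" "\<And>r t. r \<in> {0..1} \<Longrightarrow> \<tau> \<le> t \<Longrightarrow> \<bar>G r t\<bar> \<le> C"
    "\<And>r r' t t'. r \<in> {0..1} \<Longrightarrow> r' \<in> {0..1} \<Longrightarrow> \<tau> \<le> t \<Longrightarrow> \<tau> \<le> t' \<Longrightarrow>
      \<bar>u r t - u r' t'\<bar> \<le> C * (sqrt \<bar>r - r'\<bar> + \<bar>t - t'\<bar>)"
    "\<And>r r' t t'. r \<in> {0..1} \<Longrightarrow> r' \<in> {0..1} \<Longrightarrow> \<tau> \<le> t \<Longrightarrow> \<tau> \<le> t' \<Longrightarrow>
      \<bar>G r t - G r' t'\<bar> \<le> C * (sqrt \<bar>r - r'\<bar> + \<bar>t - t'\<bar>)"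
proof -
  obtain C where C: "0 \<le> C" "\<And>n x t. x \<le> Ns n + 1 \<Longrightarrow> \<tau> \<le> t \<Longrightarrow> \<bar>speed n x t\<bar> \<le> C"
    "\<And>n r r' t t'. r \<in> {0..1} \<Longrightarrow> r' \<in> {0..1} \<Longrightarrow> \<tau> \<le> t \<Longrightarrow> \<tau> \<le> t' \<Longrightarrow>
      \<bar>W n (site (Ns n) r) t - W n (site (Ns n) r') t'\<bar>
        \<le> C * (sqrt (\<bar>r - r'\<bar> + 1 / real (Ns n)) + \<bar>t - t'\<bar>)"
    "\<And>n r r' t t'. r \<in> {0..1} \<Longrightarrow> r' \<in> {0..1} \<Longrightarrow> \<tau> \<le> t \<Longrightarrow> \<tau> \<le> t' \<Longrightarrow>
      \<bar>speed n (site (Ns n) r) t - speed n (site (Ns n) r') t'\<bar>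
        \<le> C * (sqrt (\<bar>r - r'\<bar> + 1 / real (Ns n)) + \<bar>t - t'\<bar>)"
    by (rule equicontinuity_site[OF assms]) blast
  have lim: "(\<lambda>n. C * (sqrt (\<bar>r - r'\<bar> + 1 / real (Ns n)) + \<bar>t - t'\<bar>))
      \<longlonglongrightarrow> C * (sqrt (\<bar>r - r'\<bar> + 0) + \<bar>t - t'\<bar>)" for r r' t t' :: real
    by (intro tendsto_intros inverse_Ns_lim)
  show ?thesis
  proof (rule that[OF C(1)], goal_cases)
    case (1 r t)
    then have "\<bar>speed n (site (Ns n) r) t\<bar> \<le> C" for n
      by (intro C(2)) (auto intro!: le_SucI site_le)
    then show ?case
      using 1 assms by (intro LIMSEQ_le_const2[OF tendsto_rabs[OF G_lim]]) auto
  next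
    case (2 r r' t t')
    then show ?case
      using LIMSEQ_le[OF tendsto_rabs[OF tendsto_diff[OF u_lim u_lim]] lim, of r t r' t' r r' t t'] C(3) assms
      by auto
  next
    case (3 r r' t t')
    then show ?case
      using LIMSEQ_le[OF tendsto_rabs[OF tendsto_diff[OF G_lim G_lim]] lim, of r t r' t' r r' t t'] C(4) assms
      by auto
  qed
qed

lemma G_has_integral:
  assumes r: "r \<in> {0..1}" and s: "0 < s" "s \<le> t"
  shows "(G r has_integral (u r t - u r s)) {s..t}"
proof -
  obtain C where C: "0 \<le> C" "\<And>n x t. x \<le> Ns n + 1 \<Longrightarrow> s \<le> t \<Longrightarrow> \<bar>speed n x t\<bar> \<le> C"
    using equicontinuity_site[OF s(1)] by metis
  have le: "site (Ns n) r \<le> Ns n + 1" for n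
    using site_le[of r "Ns n"] r by simp
  show ?thesis
  proof (rule has_integral_dominated_convergence)
    show "((\<lambda>\<tau>. speed n (site (Ns n) r) \<tau>) has_integral
        W n (site (Ns n) r) t - W n (site (Ns n) r) s) {s..t}" for n
    proof (rule fundamental_theorem_of_calculus[OF s(2)])
      fix \<tau> assume "\<tau> \<in> {s..t}"
      then show "(W n (site (Ns n) r) has_vector_derivative speed n (site (Ns n) r) \<tau>) (at \<tau> within {s..t})"
        unfolding has_real_derivative_iff_has_vector_derivative[symmetric]
        by (intro has_field_derivative_subset[OF W_derivative[OF le]]) (use s in auto)
    qed
    show "(\<lambda>_. C) integrable_on {s..t}" by (rule integrable_const_ivl)
    show "\<forall>\<tau>\<in>{s..t}. norm (speed n (site (Ns n) r) \<tau>) \<le> C" for n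
      using C(2)[OF le] by auto
    show "\<forall>\<tau>\<in>{s..t}. (\<lambda>n. speed n (site (Ns n) r) \<tau>) \<longlonglongrightarrow> G r \<tau>"
      using G_lim[OF r] s by auto
    show "(\<lambda>n. W n (site (Ns n) r) t - W n (site (Ns n) r) s) \<longlonglongrightarrow> u r t - u r s"
      by (intro tendsto_diff u_lim r) (use s in auto)
  qed
qed

definition discrete_flux :: "nat \<Rightarrow> nat \<Rightarrow> real \<Rightarrow> real" where
  "discrete_flux n y t = real (Ns n) * (W n (y + 1) t - W n y t)"

text \<open>The equation summed over the first \<open>y\<close> sites. The last term corrects the range of summation, from
\<open>1, \<dots>, y\<close> to the Riemann sum over \<open>0, \<dots>, y - 1\<close>, and vanishes in the limit.\<close>

lemma discrete_flux_eq:
  assumes "y \<le> Ns n"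
  shows "discrete_flux n y t = 2 * speed n 0 t
    + 2 * ((\<Sum>z<y. speed n z t) / real (Ns n)) + 2 * ((speed n y t - speed n 0 t) / real (Ns n))"
  using assms
proof (induction y)
  case 0
  then show ?case using Ns_pos[of n] by (simp add: discrete_flux_def speed_def chain_op_def)
next
  case (Suc y)
  have "discrete_flux n (Suc y) t - discrete_flux n y t = 2 * (speed n (Suc y) t / real (Ns n))"
    using Suc.prems Ns_pos[of n]
    by (simp add: discrete_flux_def speed_def chain_op_def power2_eq_square field_simps)
  then show ?case using Suc by (simp add: add_divide_distrib diff_divide_distrib)
qed

lemma discrete_flux_bound:
  assumes C: "\<And>x. x \<le> Ns n + 1 \<Longrightarrow> \<bar>speed n x t\<bar> \<le> C" and y: "y \<le> Ns n"
  shows "\<bar>discrete_flux n y t\<bar> \<le> 8 * C"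
proof -
  have C0: "0 \<le> C" using C[of 0] by linarith
  have N: "1 \<le> real (Ns n)" using Ns_pos[of n] by simp
  have "\<bar>\<Sum>z<y. speed n z t\<bar> \<le> (\<Sum>z<y. \<bar>speed n z t\<bar>)" by (rule sum_abs)
  also have "\<dots> \<le> (\<Sum>z<y. C)" using y by (intro sum_mono C) auto
  also have "\<dots> \<le> C * real (Ns n)" using y C0 by (simp add: mult.commute mult_left_mono)
  finally have A: "\<bar>(\<Sum>z<y. speed n z t) / real (Ns n)\<bar> \<le> C"
    using N by (simp add: pos_divide_le_eq)
  have "\<bar>speed n y t - speed n 0 t\<bar> \<le> 2 * C" using C[of y] C[of 0] y by linarith
  also have "\<dots> \<le> 2 * C * real (Ns n)" using mult_left_mono[OF N, of "2 * C"] C0 by simp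
  finally have B: "\<bar>(speed n y t - speed n 0 t) / real (Ns n)\<bar> \<le> 2 * C"
    using N by (simp add: pos_divide_le_eq)
  show ?thesis
    unfolding discrete_flux_eq[OF y] using A B C[of 0] by linarith
qed

lemma
  assumes r: "r \<in> {0..1}" and t: "0 < t"
  shows G_integrable: "(\<lambda>s. G s t) integrable_on {0..r}"
    and discrete_flux_lim: "(\<lambda>n. discrete_flux n (site (Ns n) r) t) \<longlonglongrightarrow> flux r t"
proof -
  obtain C where C: "\<And>n x. x \<le> Ns n + 1 \<Longrightarrow> \<bar>speed n x t\<bar> \<le> C"
    using equicontinuity_site[OF t] by (metis order_refl)
  have r': "0 \<le> r" "r \<le> 1" using r by auto
  have conv: "(\<lambda>n. speed n (site (Ns n) s) t) \<longlonglongrightarrow> G s t" if "0 \<le> s" "s \<le> 1" for s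
    using G_lim[OF _ t] that by auto
  have bdd: "\<bar>speed n y t\<bar> \<le> C" if "y \<le> Ns n" for n y using C that by auto
  note riemann = riemann_sums_converge[where a = "\<lambda>n y. speed n y t", OF Ns_pos Ns_lim r' bdd conv]
  show "(\<lambda>s. G s t) integrable_on {0..r}" by (rule riemann(1))
  have "(\<lambda>n. 2 * speed n (site (Ns n) 0) t + 2 * ((\<Sum>z<site (Ns n) r. speed n z t) / real (Ns n))
      + 2 * ((speed n (site (Ns n) r) t - speed n (site (Ns n) 0) t) * (1 / real (Ns n))))
      \<longlonglongrightarrow> 2 * G 0 t + 2 * integral {0..r} (\<lambda>s. G s t) + 2 * ((G r t - G 0 t) * 0)"
    by (intro tendsto_intros riemann(2) conv inverse_Ns_lim) (use r in auto)
  then show "(\<lambda>n. discrete_flux n (site (Ns n) r) t) \<longlonglongrightarrow> flux r t"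
    using site_le[OF r'(2)] by (simp add: discrete_flux_eq flux_def)
qed

lemma u_eq_integral_flux:
  assumes r: "r \<in> {0..1}" and t: "0 < t"
  shows "u r t = u 0 t + integral {0..r} (\<lambda>s. flux s t)"
proof -
  obtain C where C: "\<And>n x. x \<le> Ns n + 1 \<Longrightarrow> \<bar>speed n x t\<bar> \<le> C"
    using equicontinuity_site[OF t] by (metis order_refl)
  have r': "0 \<le> r" "r \<le> 1" using r by auto
  have conv: "(\<lambda>n. discrete_flux n (site (Ns n) s) t) \<longlonglongrightarrow> flux s t" if "0 \<le> s" "s \<le> 1" for s
    using discrete_flux_lim[OF _ t] that by auto
  have bdd: "\<bar>discrete_flux n y t\<bar> \<le> 8 * C" if "y \<le> Ns n" for n y
    by (rule discrete_flux_bound[OF C that])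
  note riemann = riemann_sums_converge[where a = "\<lambda>n y. discrete_flux n y t", OF Ns_pos Ns_lim r' bdd conv]
  have "(\<Sum>y<m. discrete_flux n y t) / real (Ns n) = W n m t - W n 0 t" for n m
    using Ns_pos[of n] sum_lessThan_telescope[of "\<lambda>y. W n y t" m]
    by (simp add: discrete_flux_def sum_distrib_left[symmetric])
  then have "(\<lambda>n. W n (site (Ns n) r) t - W n (site (Ns n) 0) t) \<longlonglongrightarrow> integral {0..r} (\<lambda>s. flux s t)"
    using riemann(2) by simp
  moreover have "(\<lambda>n. W n (site (Ns n) r) t - W n (site (Ns n) 0) t) \<longlonglongrightarrow> u r t - u 0 t"
    by (intro tendsto_diff u_lim t r) auto
  ultimately have "u r t - u 0 t = integral {0..r} (\<lambda>s. flux s t)" by (rule LIMSEQ_unique[rotated])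
  then show "u r t = u 0 t + integral {0..r} (\<lambda>s. flux s t)" by simp
qed

lemma right_reservoir_lim:
  assumes t: "0 < t"
  shows "(\<lambda>n. W n (Ns n + 1) t) \<longlonglongrightarrow> u 1 t"
proof -
  have "(\<lambda>n. W n (site (Ns n) 1) t + discrete_flux n (site (Ns n) 1) t * (1 / real (Ns n)))
      \<longlonglongrightarrow> u 1 t + flux 1 t * 0"
    by (intro tendsto_intros u_lim discrete_flux_lim inverse_Ns_lim t) auto
  moreover have "W n (site (Ns n) 1) t + discrete_flux n (site (Ns n) 1) t * (1 / real (Ns n))
      = W n (Ns n + 1) t" for n
    using Ns_pos[of n] by (simp add: discrete_flux_def)
  ultimately show ?thesis by simp
qed

text \<open>At the right reservoir the chain has the speed \<open>- 1/2\<close> times the last discrete flux. Between sites \<open>N\<close>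
and \<open>N + 1\<close> the speed varies by \<open>O(N\<^sup>-\<^sup>1\<^sup>/\<^sup>2)\<close> only.\<close>

lemma G_right:
  assumes t: "0 < t"
  shows "G 1 t = - flux 1 t / 2"
proof -
  obtain C where C: "\<And>n x y. x \<le> Ns n + 1 \<Longrightarrow> y \<le> Ns n + 1 \<Longrightarrow>
      \<bar>speed n x t - speed n y t\<bar> \<le> C * sqrt (\<bar>real x - real y\<bar> / real (Ns n))"
    using equicontinuity_site[OF t] by (metis order_refl)
  have "(\<lambda>n. C * sqrt (1 / real (Ns n))) \<longlonglongrightarrow> C * sqrt 0"
    by (intro tendsto_intros inverse_Ns_lim)
  then have lim0: "(\<lambda>n. C * sqrt (1 / real (Ns n))) \<longlonglongrightarrow> 0" by simp
  have "norm (speed n (Ns n + 1) t - speed n (Ns n) t) \<le> C * sqrt (1 / real (Ns n))" for n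
    using C[of "Ns n + 1" n "Ns n"] by simp
  then have "(\<lambda>n. speed n (Ns n + 1) t - speed n (Ns n) t) \<longlonglongrightarrow> 0"
    by (intro Lim_null_comparison[OF _ lim0]) simp
  moreover have "speed n (Ns n + 1) t = - discrete_flux n (site (Ns n) 1) t / 2" for n
    by (simp add: speed_def chain_op_def discrete_flux_def algebra_simps)
  moreover have "(\<lambda>n. - discrete_flux n (site (Ns n) 1) t / 2 - speed n (site (Ns n) 1) t)
      \<longlonglongrightarrow> - flux 1 t / 2 - G 1 t"
    by (intro tendsto_intros discrete_flux_lim G_lim t) auto
  ultimately have "- flux 1 t / 2 - G 1 t = 0"
    using LIMSEQ_unique by fastforce
  then show ?thesis by simp
qed

end

lemma continuous_of_modulus:
  fixes f :: "real \<Rightarrow> real \<Rightarrow> real"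
  assumes modulus: "\<And>\<tau>. 0 < \<tau> \<Longrightarrow> \<exists>C. \<forall>r\<in>{0..1}. \<forall>r'\<in>{0..1}. \<forall>t\<ge>\<tau>. \<forall>t'\<ge>\<tau>.
    \<bar>f r t - f r' t'\<bar> \<le> C * (sqrt \<bar>r - r'\<bar> + \<bar>t - t'\<bar>)"
  shows "continuous_on ({0..1} \<times> {0<..}) (\<lambda>(r, t). f r t)"
  unfolding continuous_on_def
proof
  fix p :: "real \<times> real" assume "p \<in> {0..1} \<times> {0<..}"
  then obtain r t where p: "p = (r, t)" "r \<in> {0..1}" "0 < t" by auto
  have half: "0 < t / 2" using p(3) by simp
  from modulus[OF half] obtain C where
    "\<forall>r\<in>{0..1}. \<forall>r'\<in>{0..1}. \<forall>s\<ge>t / 2. \<forall>s'\<ge>t / 2.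
      \<bar>f r s - f r' s'\<bar> \<le> C * (sqrt \<bar>r - r'\<bar> + \<bar>s - s'\<bar>)"
    by blast
  then have C: "\<And>r r' s s'. r \<in> {0..1} \<Longrightarrow> r' \<in> {0..1} \<Longrightarrow> t / 2 \<le> s \<Longrightarrow> t / 2 \<le> s' \<Longrightarrow>
      \<bar>f r s - f r' s'\<bar> \<le> C * (sqrt \<bar>r - r'\<bar> + \<bar>s - s'\<bar>)"
    by blast
  let ?F = "at p within {0..1} \<times> {0<..}"
  have "((\<lambda>q. C * (sqrt \<bar>fst q - r\<bar> + \<bar>snd q - t\<bar>)) \<longlongrightarrow> C * (sqrt \<bar>fst p - r\<bar> + \<bar>snd p - t\<bar>)) ?F"
    by (intro tendsto_intros)
  then have lim: "((\<lambda>q. C * (sqrt \<bar>fst q - r\<bar> + \<bar>snd q - t\<bar>)) \<longlongrightarrow> 0) ?F" by (simp add: p)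
  have "((\<lambda>q. snd q) \<longlongrightarrow> snd p) ?F" by (intro tendsto_intros)
  then have "eventually (\<lambda>q. t / 2 < snd q) ?F"
    by (rule order_tendstoD) (use p in auto)
  moreover have "eventually (\<lambda>q. q \<in> {0..1} \<times> {0<..}) ?F" by (simp add: eventually_at_filter)
  ultimately have "eventually (\<lambda>q. norm ((case q of (r, t) \<Rightarrow> f r t) - f r t)
      \<le> C * (sqrt \<bar>fst q - r\<bar> + \<bar>snd q - t\<bar>)) ?F"
  proof eventually_elim
    case (elim q)
    then show ?case using C[of "fst q" r "snd q" t] p by (auto simp: case_prod_unfold mem_Times_iff)
  qed
  then have "((\<lambda>q. (case q of (r, t) \<Rightarrow> f r t) - f r t) \<longlongrightarrow> 0) ?F"
    by (rule Lim_null_comparison[OF _ lim])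
  then show "((\<lambda>q. case q of (r, t) \<Rightarrow> f r t) \<longlongrightarrow> (case p of (r, t) \<Rightarrow> f r t)) ?F"
    unfolding p(1) prod.case by (rule LIM_zero_cancel)
qed

context convergent_flow
begin

lemma flux_modulus:
  assumes "0 < \<tau>"
  shows "\<exists>C. \<forall>r\<in>{0..1}. \<forall>r'\<in>{0..1}. \<forall>t\<ge>\<tau>. \<forall>t'\<ge>\<tau>.
    \<bar>flux r t - flux r' t'\<bar> \<le> C * (sqrt \<bar>r - r'\<bar> + \<bar>t - t'\<bar>)"
proof -
  obtain C where C: "0 \<le> C" "\<And>r t. r \<in> {0..1} \<Longrightarrow> \<tau> \<le> t \<Longrightarrow> \<bar>G r t\<bar> \<le> C"
    "\<And>r r' t t'. r \<in> {0..1} \<Longrightarrow> r' \<in> {0..1} \<Longrightarrow> \<tau> \<le> t \<Longrightarrow> \<tau> \<le> t' \<Longrightarrow>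
      \<bar>u r t - u r' t'\<bar> \<le> C * (sqrt \<bar>r - r'\<bar> + \<bar>t - t'\<bar>)"
    "\<And>r r' t t'. r \<in> {0..1} \<Longrightarrow> r' \<in> {0..1} \<Longrightarrow> \<tau> \<le> t \<Longrightarrow> \<tau> \<le> t' \<Longrightarrow>
      \<bar>G r t - G r' t'\<bar> \<le> C * (sqrt \<bar>r - r'\<bar> + \<bar>t - t'\<bar>)"
    by (rule modulus[OF assms]) blast
  have time: "\<bar>flux r t - flux r t'\<bar> \<le> 4 * C * \<bar>t - t'\<bar>"
    if r: "r \<in> {0..1}" and t: "\<tau> \<le> t" "\<tau> \<le> t'" for r t t'
  proof -
    have G: "\<bar>G s t - G s t'\<bar> \<le> C * \<bar>t - t'\<bar>" if "s \<in> {0..1}" for s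
      using C(4)[OF that that t] by simp
    have int: "(\<lambda>s. G s t) integrable_on {0..r}" "(\<lambda>s. G s t') integrable_on {0..r}"
      using G_integrable[OF r] t assms by auto
    have "\<bar>integral {0..r} (\<lambda>s. G s t - G s t')\<bar> \<le> C * \<bar>t - t'\<bar> * (r - 0)"
      by (rule abs_integral_le[OF integrable_diff[OF int]]) (use r G in auto)
    also have "\<dots> \<le> C * \<bar>t - t'\<bar>" using r C(1) by (simp add: mult_left_le)
    finally have "\<bar>integral {0..r} (\<lambda>s. G s t) - integral {0..r} (\<lambda>s. G s t')\<bar> \<le> C * \<bar>t - t'\<bar>"
      by (simp add: Henstock_Kurzweil_Integration.integral_diff[OF int])
    then show ?thesis using G[of 0] unfolding flux_def by (simp add: abs_if split: if_splits)
  qed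
  have space: "\<bar>flux r t - flux r' t\<bar> \<le> 2 * C * sqrt \<bar>r - r'\<bar>"
    if r: "r \<in> {0..1}" "r' \<in> {0..1}" "r' \<le> r" and t: "\<tau> \<le> t" for r r' t
  proof -
    have t0: "0 < t" using t assms by simp
    have int: "(\<lambda>s. G s t) integrable_on {0..r}" by (rule G_integrable[OF r(1) t0])
    have "integral {0..r'} (\<lambda>s. G s t) + integral {r'..r} (\<lambda>s. G s t) = integral {0..r} (\<lambda>s. G s t)"
      by (rule Henstock_Kurzweil_Integration.integral_combine[OF _ _ int]) (use r in auto)
    then have "\<bar>flux r t - flux r' t\<bar> = 2 * \<bar>integral {r'..r} (\<lambda>s. G s t)\<bar>"
      by (simp add: flux_def abs_if)
    also have "\<bar>integral {r'..r} (\<lambda>s. G s t)\<bar> \<le> C * (r - r')"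
      by (rule abs_integral_le[OF integrable_on_subinterval[OF int]]) (use r t C(2) in auto)
    also have "C * (r - r') \<le> C * sqrt \<bar>r - r'\<bar>"
    proof (rule mult_left_mono[OF _ C(1)])
      have "(r - r')\<^sup>2 \<le> r - r'" using r by (auto simp: power2_eq_square intro!: mult_left_le)
      then show "r - r' \<le> sqrt \<bar>r - r'\<bar>" using r by (simp add: real_le_rsqrt)
    qed
    finally show ?thesis by simp
  qed
  have "\<bar>flux r t - flux r' t'\<bar> \<le> 4 * C * (sqrt \<bar>r - r'\<bar> + \<bar>t - t'\<bar>)"
    if r: "r \<in> {0..1}" "r' \<in> {0..1}" and t: "\<tau> \<le> t" "\<tau> \<le> t'" for r r' t t'
  proof -
    have "\<bar>flux r t - flux r' t\<bar> \<le> 2 * C * sqrt \<bar>r - r'\<bar>"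
      using space[OF r _ t(1)] space[OF r(2,1) _ t(1)]
      by (cases "r' \<le> r") (simp_all add: abs_minus_commute)
    moreover have "0 \<le> C * sqrt \<bar>r - r'\<bar>" using C(1) by simp
    ultimately show ?thesis using time[OF r(2) t] unfolding distrib_left by linarith
  qed
  then show ?thesis by blast
qed

lemma
  shows continuous_u: "continuous_on ({0..1} \<times> {0<..}) (\<lambda>(r, t). u r t)"
    and continuous_G: "continuous_on ({0..1} \<times> {0<..}) (\<lambda>(r, t). G r t)"
    and continuous_flux: "continuous_on ({0..1} \<times> {0<..}) (\<lambda>(r, t). flux r t)"
proof -
  show "continuous_on ({0..1} \<times> {0<..}) (\<lambda>(r, t). u r t)"
  proof (rule continuous_of_modulus)
    fix \<tau> :: real assume "0 < \<tau>"
    from modulus[OF this] show "\<exists>C. \<forall>r\<in>{0..1}. \<forall>r'\<in>{0..1}. \<forall>t\<ge>\<tau>. \<forall>t'\<ge>\<tau>.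
        \<bar>u r t - u r' t'\<bar> \<le> C * (sqrt \<bar>r - r'\<bar> + \<bar>t - t'\<bar>)" by metis
  qed
  show "continuous_on ({0..1} \<times> {0<..}) (\<lambda>(r, t). G r t)"
  proof (rule continuous_of_modulus)
    fix \<tau> :: real assume "0 < \<tau>"
    from modulus[OF this] show "\<exists>C. \<forall>r\<in>{0..1}. \<forall>r'\<in>{0..1}. \<forall>t\<ge>\<tau>. \<forall>t'\<ge>\<tau>.
        \<bar>G r t - G r' t'\<bar> \<le> C * (sqrt \<bar>r - r'\<bar> + \<bar>t - t'\<bar>)" by metis
  qed
  show "continuous_on ({0..1} \<times> {0<..}) (\<lambda>(r, t). flux r t)"
    by (rule continuous_of_modulus[OF flux_modulus])
qed

lemma u_time_derivative:
  assumes r: "r \<in> {0..1}" and t: "0 < t"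
  shows "((\<lambda>t. u r t) has_real_derivative G r t) (at t)"
proof -
  have "continuous_on {t / 2..t + 1} (\<lambda>t. G r t)"
    by (rule continuous_on_subset[OF continuous_time_slice[OF continuous_G r]]) (use t in auto)
  then have "((\<lambda>t'. integral {t / 2..t'} (\<lambda>t. G r t)) has_real_derivative G r t) (at t within {t / 2..t + 1})"
    by (rule integral_has_real_derivative) (use t in auto)
  moreover have "integral {t / 2..t'} (\<lambda>t. G r t) = u r t' - u r (t / 2)" if "t / 2 \<le> t'" for t'
    by (rule integral_unique[OF G_has_integral[OF r]]) (use t that in auto)
  ultimately have "((\<lambda>t'. u r t' - u r (t / 2)) has_real_derivative G r t) (at t within {t / 2..t + 1})"
    by (elim has_field_derivative_transform_within[OF _ zero_less_one]) (use t in auto)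
  moreover have "at t within {t / 2..t + 1} = at t"
    using t by (intro at_within_interior) (simp add: interior_atLeastAtMost_real)
  ultimately have "((\<lambda>t'. u r t' - u r (t / 2)) has_real_derivative G r t) (at t)" by simp
  from DERIV_add[OF this DERIV_const[of "u r (t / 2)"]] show ?thesis by simp
qed

lemma C21: "C21_with u flux (\<lambda>r t. 2 * G r t) G"
proof -
  have "((\<lambda>r. u r t) has_real_derivative flux r t) (at r within {0..1})"
    if r: "r \<in> {0..1}" and t: "0 < t" for r t
  proof -
    have "((\<lambda>r. integral {0..r} (\<lambda>s. flux s t)) has_real_derivative flux r t) (at r within {0..1})"
      by (rule integral_has_real_derivative[OF continuous_space_slice[OF continuous_flux t] r])
    from DERIV_add[OF DERIV_const[of "u 0 t"] this]
    have "((\<lambda>r. u 0 t + integral {0..r} (\<lambda>s. flux s t)) has_real_derivative flux r t) (at r within {0..1})"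
      by simp
    then show ?thesis
      by (rule has_field_derivative_transform_within[OF _ zero_less_one r])
        (simp add: u_eq_integral_flux[OF _ t, symmetric])
  qed
  moreover have "((\<lambda>r. flux r t) has_real_derivative 2 * G r t) (at r within {0..1})"
    if r: "r \<in> {0..1}" and t: "0 < t" for r t
  proof -
    have "((\<lambda>r. integral {0..r} (\<lambda>s. G s t)) has_real_derivative G r t) (at r within {0..1})"
      by (rule integral_has_real_derivative[OF continuous_space_slice[OF continuous_G t] r])
    from DERIV_add[OF DERIV_const[of "2 * G 0 t"] DERIV_cmult[OF this, of 2]]
    show ?thesis by (simp add: flux_def)
  qed
  moreover have "continuous_on ({0..1} \<times> {0<..}) (\<lambda>(r, t). 2 * G r t)"
    using continuous_G unfolding case_prod_unfold by (intro continuous_intros)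
  ultimately show ?thesis
    unfolding C21_with_def using u_time_derivative continuous_u continuous_G continuous_flux by auto
qed

lemma u_initial:
  assumes r: "r \<in> {0<..<1}"
  shows "((\<lambda>t. u r t) \<longlongrightarrow> u0 r) (at_right 0)"
proof (rule tendstoI)
  fix e :: real assume e: "0 < e"
  from e have e2: "0 < e / 2" by simp
  from u0_cont r have "(u0 \<longlongrightarrow> u0 r) (at r within {0..1})" by (auto simp: continuous_on_def)
  from tendstoD[OF this e2] obtain d where "0 < d"
    "\<forall>x\<in>{0..1}. x \<noteq> r \<and> dist x r < d \<longrightarrow> dist (u0 x) (u0 r) < e / 2"
    unfolding eventually_at by blast
  then have d: "0 < d" "\<And>x. x \<in> {0..1} \<Longrightarrow> x \<noteq> r \<Longrightarrow> dist x r < d \<Longrightarrow> dist (u0 x) (u0 r) < e / 2"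
    by blast+
  define \<delta> where "\<delta> = min d (min r (1 - r))"
  have \<delta>: "0 < \<delta>" "\<delta> \<le> r" "\<delta> \<le> 1 - r" "\<delta> \<le> d" using d r by (auto simp: \<delta>_def)
  have near: "\<bar>u0 x - u0 r\<bar> \<le> e / 2" if "x \<in> {0..1}" "\<bar>x - r\<bar> < \<delta>" for x
    using d(2)[of x] that \<delta> e by (cases "x = r") (auto simp: dist_real_def)
  have r01: "r \<in> {0..1}" using r by auto
  have bound: "\<bar>u r t - u0 r\<bar> \<le> e / 2 + 2 / \<delta>\<^sup>2 * t" if t: "0 < t" for t
  proof (rule LIMSEQ_le[OF tendsto_rabs[OF tendsto_diff[OF u_lim[OF r01 t] tendsto_const]]])
    have "(\<lambda>n. e / 2 + 2 / \<delta>\<^sup>2 * ((1 / real (Ns n))\<^sup>2 + t)) \<longlonglongrightarrow> e / 2 + 2 / \<delta>\<^sup>2 * (0\<^sup>2 + t)"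
      by (intro tendsto_intros inverse_Ns_lim)
    then show "(\<lambda>n. e / 2 + 2 / \<delta>\<^sup>2 * ((1 / real (Ns n))\<^sup>2 + t)) \<longlonglongrightarrow> e / 2 + 2 / \<delta>\<^sup>2 * t" by simp
    have "\<bar>W n (site (Ns n) r) t - u0 r\<bar> \<le> e / 2 + 2 / \<delta>\<^sup>2 * ((1 / real (Ns n))\<^sup>2 + t)" for n
    proof -
      have "\<bar>W n (site (Ns n) r) t - u0 r\<bar>
          \<le> e / 2 + 2 / \<delta>\<^sup>2 * ((real (site (Ns n) r) / real (Ns n) - r)\<^sup>2 + t)"
      proof (rule initial_layer_bulk[OF flow \<delta>(1-3)])
        show "\<bar>W n x 0 - u0 r\<bar> \<le> e / 2"
          if "x \<in> {1..Ns n}" "\<bar>real x / real (Ns n) - r\<bar> < \<delta>" for x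
          unfolding init_bulk[OF that(1)] by (rule near[OF _ that(2)]) (use that Ns_pos[of n] in auto)
        show "site (Ns n) r \<le> Ns n + 1" using site_le[of r "Ns n"] r by simp
      qed (use u0_bound[OF r01] e t in auto)
      also have "\<dots> \<le> e / 2 + 2 / \<delta>\<^sup>2 * ((1 / real (Ns n))\<^sup>2 + t)"
      proof (intro add_left_mono mult_left_mono add_right_mono)
        have "\<bar>real (site (Ns n) r) / real (Ns n) - r\<bar> \<le> \<bar>1 / real (Ns n)\<bar>"
          using site_bounds[OF Ns_pos, of r n] r by auto
        then show "(real (site (Ns n) r) / real (Ns n) - r)\<^sup>2 \<le> (1 / real (Ns n))\<^sup>2"
          by (rule abs_le_square_iff[THEN iffD1])
      qed simp
      finally show ?thesis .
    qed
    then show "\<exists>m. \<forall>n\<ge>m. \<bar>W n (site (Ns n) r) t - u0 r\<bar> \<le> e / 2 + 2 / \<delta>\<^sup>2 * ((1 / real (Ns n))\<^sup>2 + t)"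
      by blast
  qed
  have "((\<lambda>t. e / 2 + 2 / \<delta>\<^sup>2 * t) \<longlongrightarrow> e / 2 + 2 / \<delta>\<^sup>2 * 0) (at_right 0)"
    by (intro tendsto_intros)
  then have "eventually (\<lambda>t. e / 2 + 2 / \<delta>\<^sup>2 * t < e) (at_right 0)"
    by (rule order_tendstoD) (use e in auto)
  moreover have "eventually (\<lambda>t. 0 < t) (at_right (0 :: real))" by (rule eventually_at_right_less)
  ultimately show "eventually (\<lambda>t. dist (u r t) (u0 r) < e) (at_right 0)"
  proof eventually_elim
    case (elim t)
    then show ?case using bound[of t] by (simp add: dist_real_def)
  qed
qed

text \<open>Stated for a general sequence of flows, so that it applies to the right reservoir after reflecting the
chain. The hat function has the width \<open>\<surd>t\<close>, which balances the two error terms \<open>2 m / N\<close> and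
\<open>N t / m\<close>.\<close>

lemma reservoir_initial:
  assumes flow': "\<And>n. bounded_flow (Ns n) (V n)" and init: "\<And>n. V n 0 0 = c"
    and lim: "\<And>t. 0 < t \<Longrightarrow> (\<lambda>n. V n 0 t) \<longlonglongrightarrow> v t"
  shows "(v \<longlongrightarrow> c) (at_right 0)"
proof -
  have bound: "\<bar>v t - c\<bar> \<le> 3 * sqrt t" if t: "0 < t" "t \<le> 1" for t
  proof (rule LIMSEQ_le[OF tendsto_rabs[OF tendsto_diff[OF lim[OF t(1)] tendsto_const]]])
    have "(\<lambda>n. 3 * sqrt t + 2 * (1 / real (Ns n))) \<longlonglongrightarrow> 3 * sqrt t + 2 * 0"
      by (intro tendsto_intros inverse_Ns_lim)
    then show "(\<lambda>n. 3 * sqrt t + 2 * (1 / real (Ns n))) \<longlonglongrightarrow> 3 * sqrt t" by simp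
    have "\<bar>V n 0 t - c\<bar> \<le> 3 * sqrt t + 2 * (1 / real (Ns n))" for n
    proof -
      define N where "N = real (Ns n)"
      have N: "1 \<le> N" using Ns_pos[of n] by (simp add: N_def)
      define m where "m = nat \<lceil>N * sqrt t\<rceil>"
      have pos: "0 < N * sqrt t" using N t by simp
      have m: "N * sqrt t \<le> real m" "real m \<le> N * sqrt t + 1"
        using pos unfolding m_def by linarith+
      have "0 < real m" using m pos by linarith
      then have m1: "1 \<le> m" by simp
      have "N * sqrt t \<le> N" using N t by (intro mult_left_le) auto
      then have "N * sqrt t \<le> real (Ns n)" unfolding N_def .
      then have m2: "m \<le> Ns n" by (simp add: m_def)
      have "\<bar>V n 0 t - V n 0 0\<bar> \<le> 2 * real m / N + N * t / real m"
        unfolding N_def by (rule initial_layer_reservoir[OF flow' m1 m2]) (use t in simp)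
      also have "2 * real m / N \<le> 2 * (N * sqrt t + 1) / N"
        using m N by (intro divide_right_mono) auto
      also have "2 * (N * sqrt t + 1) / N = 2 * sqrt t + 2 * (1 / N)"
        using N by (simp add: field_simps)
      also have "N * t / real m \<le> N * t / (N * sqrt t)"
        using m pos N t mult_pos_pos[OF \<open>0 < real m\<close> pos] by (intro divide_left_mono) auto
      also have "N * t / (N * sqrt t) = sqrt t"
        using N t by (simp add: real_div_sqrt)
      finally show ?thesis by (simp add: init N_def)
    qed
    then show "\<exists>m. \<forall>n\<ge>m. \<bar>V n 0 t - c\<bar> \<le> 3 * sqrt t + 2 * (1 / real (Ns n))" by blast
  qed
  have "((\<lambda>t. 3 * sqrt t) \<longlongrightarrow> 3 * sqrt 0) (at_right 0)" by (intro tendsto_intros)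
  then have lim0: "((\<lambda>t. 3 * sqrt t) \<longlongrightarrow> 0) (at_right 0)" by simp
  have "eventually (\<lambda>t. 0 < t \<and> t < 1) (at_right (0 :: real))"
    by (auto simp: eventually_at_right_field intro!: exI[of _ 1])
  then have "eventually (\<lambda>t. norm (v t - c) \<le> 3 * sqrt t) (at_right 0)"
    by eventually_elim (use bound in auto)
  then have "((\<lambda>t. v t - c) \<longlongrightarrow> 0) (at_right 0)" by (rule Lim_null_comparison[OF _ lim0])
  then show ?thesis by (rule LIM_zero_cancel)
qed

lemma left_initial: "((\<lambda>t. u 0 t) \<longlongrightarrow> v0m) (at_right 0)"
  by (rule reservoir_initial[OF flow init_left]) (use u_lim[of 0] in simp)

lemma right_initial: "((\<lambda>t. u 1 t) \<longlongrightarrow> v0p) (at_right 0)"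
proof (rule reservoir_initial[where V = "\<lambda>n x. W n (Ns n + 1 - x)"])
  show "bounded_flow (Ns n) (\<lambda>x. W n (Ns n + 1 - x))" for n
    using flow[of n] heat_flow_reflect[of "Ns n" "W n"] by (auto simp: bounded_flow_def)
qed (use init_right right_reservoir_lim in auto)

lemma bounded_u: "bounded_near_initial_time u"
  unfolding bounded_near_initial_time_def
  by (rule exI[of _ 1], rule eventually_mono[OF eventually_at_right_less[of 0]]) (use u_bound in auto)

lemma flux_left: "0 < t \<Longrightarrow> 1/2 * flux 0 t = G 0 t"
  by (simp add: flux_def)

lemma C1_boundary:
  assumes "r \<in> {0..1}"
  shows "u r C1_differentiable_on {0<..}"
  unfolding C1_differentiable_on_def
  using u_time_derivative[OF assms] continuous_time_slice[OF continuous_G assms]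
  by (auto simp: has_real_derivative_iff_has_vector_derivative intro!: exI[of _ "G r"])

lemma limit_solves: "free_boundary_solution u0 v0m v0p u (u 0) (u 1)"
proof -
  interpret sol: heat_solution u flux "\<lambda>r t. 2 * G r t" G
    by unfold_locales (use C21 in auto)
  have lim: "((\<lambda>s. integral {s..t} (\<lambda>\<tau>. 1/2 * flux a \<tau>)) \<longlongrightarrow> \<sigma> * (u a t - c)) (at_right 0)"
    if a: "a \<in> {0..1}" and t: "0 < t" and init: "((\<lambda>t. u a t) \<longlongrightarrow> c) (at_right 0)"
      and eq: "\<And>\<tau>. 0 < \<tau> \<Longrightarrow> 1/2 * flux a \<tau> = \<sigma> * G a \<tau>" for a t c \<sigma>
  proof (rule Lim_transform_eventually)
    show "((\<lambda>s. \<sigma> * (u a t - u a s)) \<longlongrightarrow> \<sigma> * (u a t - c)) (at_right 0)"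
      by (intro tendsto_intros init)
    have "eventually (\<lambda>s. 0 < s \<and> s < t) (at_right 0)"
      using t by (auto simp: eventually_at_right_field)
    then show "eventually (\<lambda>s. \<sigma> * (u a t - u a s) = integral {s..t} (\<lambda>\<tau>. 1/2 * flux a \<tau>)) (at_right 0)"
    proof eventually_elim
      case (elim s)
      have "((\<lambda>\<tau>. \<sigma> * G a \<tau>) has_integral \<sigma> * (u a t - u a s)) {s..t}"
        by (intro has_integral_mult_right G_has_integral a) (use elim in auto)
      then have "((\<lambda>\<tau>. 1/2 * flux a \<tau>) has_integral \<sigma> * (u a t - u a s)) {s..t}"
        by (rule has_integral_eq[rotated]) (use elim eq in auto)
      then show ?case by (rule integral_unique[symmetric])
    qed
  qed
  note iff = sol.iterated_limit_iff[OF _ _ bounded_u u0_cont u_initial]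
  have left: "\<exists>c. iterated_limit (\<lambda>l t0. integral {t0..t} (\<lambda>s. 1/2 * flux l s)) c
      (at_right 0) (at_right 0) \<and> u 0 t = v0m + c" if t: "0 < t" for t
    using lim[OF _ t left_initial, of 1] iff[of 0 t "u 0 t - v0m"] t flux_left
    unfolding at_right_eq_at_within_unit[symmetric] by (intro exI[of _ "u 0 t - v0m"]) simp
  have right: "\<exists>c. iterated_limit (\<lambda>l t0. integral {t0..t} (\<lambda>s. 1/2 * flux l s)) c
      (at_left 1) (at_right 0) \<and> u 1 t = v0p - c" if t: "0 < t" for t
    using lim[OF _ t right_initial, of "- 1"] iff[of 1 t "v0p - u 1 t"] t G_right
    unfolding at_left_eq_at_within_unit[symmetric] by (intro exI[of _ "v0p - u 1 t"]) simp
  show ?thesis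
    unfolding free_boundary_solution_def
    by (intro exI[of _ flux] exI[of _ "\<lambda>r t. 2 * G r t"] exI[of _ G] conjI C21 C1_boundary
        left_initial right_initial)
      (use u_initial left right in auto)
qed

end

section \<open>Convergence\<close>

lemma LIMSEQ_of_subsequences:
  fixes a :: "nat \<Rightarrow> 'a :: metric_space"
  assumes sub: "\<And>s. strict_mono (s :: nat \<Rightarrow> nat) \<Longrightarrow> \<exists>k. strict_mono (k :: nat \<Rightarrow> nat) \<and> (\<lambda>n. a (s (k n))) \<longlonglongrightarrow> L"
  shows "a \<longlonglongrightarrow> L"
proof (rule ccontr)
  assume "\<not> a \<longlonglongrightarrow> L"
  then obtain e where e: "0 < e" "\<And>m. \<exists>n\<ge>m. e \<le> dist (a n) L"
    unfolding lim_sequentially by (meson not_less)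
  then have "infinite {n. e \<le> dist (a n) L}"
    by (auto simp: infinite_nat_iff_unbounded_le)
  then obtain s :: "nat \<Rightarrow> nat" where s: "strict_mono s" "\<And>n. e \<le> dist (a (s n)) L"
    using infinite_enumerate by blast
  from sub[OF s(1)] obtain k where "strict_mono (k :: nat \<Rightarrow> nat)" "(\<lambda>n. a (s (k n))) \<longlonglongrightarrow> L" by blast
  then obtain m where "dist (a (s (k m))) L < e"
    using e(1) unfolding lim_sequentially by blast
  then show False using s(2)[of "k m"] by simp
qed

lemma (in flow_sequence) subsequential_solution:
  obtains k u where "strict_mono (k :: nat \<Rightarrow> nat)"
    "\<And>r t. r \<in> {0..1} \<Longrightarrow> 0 < t \<Longrightarrow> (\<lambda>n. W (k n) (site (Ns (k n)) r) t) \<longlonglongrightarrow> u r t"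
    "\<And>t. 0 < t \<Longrightarrow> (\<lambda>n. W (k n) (Ns (k n) + 1) t) \<longlonglongrightarrow> u 1 t"
    "free_boundary_solution u0 v0m v0p u (u 0) (u 1)" "bounded_near_initial_time u"
proof -
  obtain k u G where k: "strict_mono (k :: nat \<Rightarrow> nat)"
    and u: "\<And>r t. r \<in> {0..1} \<Longrightarrow> 0 < t \<Longrightarrow> (\<lambda>n. W (k n) (site (Ns (k n)) r) t) \<longlonglongrightarrow> u r t"
    and G: "\<And>r t. r \<in> {0..1} \<Longrightarrow> 0 < t \<Longrightarrow> (\<lambda>n. speed (k n) (site (Ns (k n)) r) t) \<longlonglongrightarrow> G r t"
    by (rule convergent_subsequence) blast
  interpret sub: flow_sequence "\<lambda>n. Ns (k n)" "\<lambda>n. W (k n)" u0 v0m v0p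
    by (rule flow_sequence_subsequence[OF k])
  interpret lim: convergent_flow "\<lambda>n. Ns (k n)" "\<lambda>n. W (k n)" u0 v0m v0p u G
    by unfold_locales (use u G in \<open>simp_all add: sub.speed_def speed_def\<close>)
  show ?thesis
    by (rule that[OF k u lim.right_reservoir_lim lim.limit_solves lim.bounded_u])
qed

text \<open>Every subsequence has a further subsequence that converges to a bounded solution of the free boundary
problem, and there is only one.\<close>

lemma (in flow_sequence) convergence:
  obtains u where
    "\<And>r t. r \<in> {0..1} \<Longrightarrow> 0 < t \<Longrightarrow> (\<lambda>n. W n (site (Ns n) r) t) \<longlonglongrightarrow> u r t"
    "\<And>t. 0 < t \<Longrightarrow> (\<lambda>n. W n (Ns n + 1) t) \<longlonglongrightarrow> u 1 t"
    "free_boundary_solution u0 v0m v0p u (u 0) (u 1)" "bounded_near_initial_time u"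
proof -
  obtain u where u: "free_boundary_solution u0 v0m v0p u (u 0) (u 1)" "bounded_near_initial_time u"
    by (rule subsequential_solution) blast
  have sub: "\<exists>k. strict_mono (k :: nat \<Rightarrow> nat) \<and>
      (\<forall>r\<in>{0..1}. \<forall>t>0. (\<lambda>n. W (s (k n)) (site (Ns (s (k n))) r) t) \<longlonglongrightarrow> u r t) \<and>
      (\<forall>t>0. (\<lambda>n. W (s (k n)) (Ns (s (k n)) + 1) t) \<longlonglongrightarrow> u 1 t)"
    if s: "strict_mono (s :: nat \<Rightarrow> nat)" for s
  proof -
    interpret sub: flow_sequence "\<lambda>n. Ns (s n)" "\<lambda>n. W (s n)" u0 v0m v0p
      by (rule flow_sequence_subsequence[OF s])
    obtain k v where k: "strict_mono (k :: nat \<Rightarrow> nat)"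
      and v: "\<And>r t. r \<in> {0..1} \<Longrightarrow> 0 < t \<Longrightarrow> (\<lambda>n. W (s (k n)) (site (Ns (s (k n))) r) t) \<longlonglongrightarrow> v r t"
        "\<And>t. 0 < t \<Longrightarrow> (\<lambda>n. W (s (k n)) (Ns (s (k n)) + 1) t) \<longlonglongrightarrow> v 1 t"
      and sol: "free_boundary_solution u0 v0m v0p v (v 0) (v 1)" "bounded_near_initial_time v"
      by (rule sub.subsequential_solution) blast
    have "v r t = u r t" if "r \<in> {0..1}" "0 < t" for r t
      by (rule free_boundary_solution_unique(1)[OF u0_cont sol u that(2,1)])
    then show ?thesis using k v by (intro exI[of _ k]) auto
  qed
  show ?thesis
  proof (rule that[OF _ _ u])
    show "(\<lambda>n. W n (site (Ns n) r) t) \<longlonglongrightarrow> u r t" if "r \<in> {0..1}" "0 < t" for r t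
      by (rule LIMSEQ_of_subsequences) (use sub that in blast)
    show "(\<lambda>n. W n (Ns n + 1) t) \<longlonglongrightarrow> u 1 t" if "0 < t" for t
      by (rule LIMSEQ_of_subsequences) (use sub that in blast)
  qed
qed

theorem theorem2p1:
  fixes u0 :: "real \<Rightarrow> real" and v0m v0p :: real
    and P :: "nat \<Rightarrow> 'a measure" and X :: "nat \<Rightarrow> real \<Rightarrow> 'a \<Rightarrow> state"
  assumes u0_cont: "continuous_on {0..1} u0"
    and u0_range: "u0 ` {0..1} \<subseteq> {0..1}"
    and v0_range: "v0m \<in> {0..1}" "v0p \<in> {0..1}"
    and process: "\<And>N. 0 < N \<Longrightarrow> markov_jump_process (P N) (states N N) (generator N N) (X N)"
    and init_left: "\<And>N. 0 < N \<Longrightarrow> mean_occupation N N (P N) (X N) 0 0 = v0m"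
    and init_right: "\<And>N. 0 < N \<Longrightarrow> mean_occupation N N (P N) (X N) (N + 1) 0 = v0p"
    and init_bulk: "\<And>N x. 0 < N \<Longrightarrow> x \<in> {1..N} \<Longrightarrow>
                      mean_occupation N N (P N) (X N) x 0 = u0 (1 / real N * real x)"
  shows "\<exists>u vm vp.
      (\<forall>r\<in>{0..1}. \<forall>t>0.
         (\<lambda>N. mean_occupation N N (P N) (X N) (nat \<lfloor>real N * r\<rfloor>) (real N ^ 2 * t)) \<longlonglongrightarrow> u r t) \<and>
      (\<forall>t>0. (\<lambda>N. mean_occupation N N (P N) (X N) 0 (real N ^ 2 * t)) \<longlonglongrightarrow> vm t) \<and>
      (\<forall>t>0. (\<lambda>N. mean_occupation N N (P N) (X N) (N + 1) (real N ^ 2 * t)) \<longlonglongrightarrow> vp t) \<and>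
      free_boundary_solution u0 v0m v0p u vm vp \<and> bounded_near_initial_time u \<and>
      (\<forall>u' vm' vp'.
         free_boundary_solution u0 v0m v0p u' vm' vp' \<and> bounded_near_initial_time u' \<longrightarrow>
         (\<forall>t>0. (\<forall>r\<in>{0..1}. u' r t = u r t) \<and> vm' t = vm t \<and> vp' t = vp t))"
proof -
  define W where "W = (\<lambda>N x t. mean_occupation N N (P N) (X N) x ((real N)\<^sup>2 * t))"
  \<comment> \<open>Indexed by \<open>Suc\<close>, since there is no chain with \<open>N = 0\<close>.\<close>
  interpret flow_sequence Suc "\<lambda>n. W (Suc n)" u0 v0m v0p
  proof
    fix n
    note proc = process[of "Suc n", simplified]
    show "bounded_flow (Suc n) (W (Suc n))"
      unfolding bounded_flow_def W_def
      using mean_occupation_heat_flow[OF _ proc] mean_occupation_range[OF _ proc] by simp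
    show "filterlim Suc at_top sequentially" by (rule filterlim_Suc)
    show "\<bar>u0 r\<bar> \<le> 1" if "r \<in> {0..1}" for r using u0_range that by (auto simp: image_subset_iff)
    show "W (Suc n) 0 0 = v0m" using init_left[of "Suc n"] by (simp add: W_def)
    show "W (Suc n) (Suc n + 1) 0 = v0p" using init_right[of "Suc n"] by (simp add: W_def)
    show "W (Suc n) x 0 = u0 (real x / real (Suc n))" if "x \<in> {1..Suc n}" for x
      using init_bulk[of "Suc n" x] that by (simp add: W_def)
  qed (fact u0_cont)
  obtain u where u: "\<And>r t. r \<in> {0..1} \<Longrightarrow> 0 < t \<Longrightarrow> (\<lambda>n. W (Suc n) (site (Suc n) r) t) \<longlonglongrightarrow> u r t"
    "\<And>t. 0 < t \<Longrightarrow> (\<lambda>n. W (Suc n) (Suc n + 1) t) \<longlonglongrightarrow> u 1 t"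
    and sol: "free_boundary_solution u0 v0m v0p u (u 0) (u 1)" "bounded_near_initial_time u"
    by (rule convergence) blast
  have bulk: "(\<lambda>N. W N (site N r) t) \<longlonglongrightarrow> u r t" if "r \<in> {0..1}" "0 < t" for r t
    by (rule LIMSEQ_imp_Suc) (rule u(1)[OF that])
  have right: "(\<lambda>N. W N (N + 1) t) \<longlonglongrightarrow> u 1 t" if "0 < t" for t
    by (rule LIMSEQ_imp_Suc) (rule u(2)[OF that])
  show ?thesis
  proof (intro exI conjI allI ballI impI)
    fix r t :: real assume r: "r \<in> {0..1}" and t: "0 < t"
    show "(\<lambda>N. mean_occupation N N (P N) (X N) (nat \<lfloor>real N * r\<rfloor>) (real N ^ 2 * t)) \<longlonglongrightarrow> u r t"
      using bulk[OF r t] unfolding W_def site_def .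
  next
    fix t :: real assume t: "0 < t"
    show "(\<lambda>N. mean_occupation N N (P N) (X N) 0 (real N ^ 2 * t)) \<longlonglongrightarrow> u 0 t"
      using bulk[OF _ t, of 0] unfolding W_def by simp
    show "(\<lambda>N. mean_occupation N N (P N) (X N) (N + 1) (real N ^ 2 * t)) \<longlonglongrightarrow> u 1 t"
      using right[OF t] unfolding W_def .
  next
    fix u' vm' vp' t r
    assume sol': "free_boundary_solution u0 v0m v0p u' vm' vp' \<and> bounded_near_initial_time u'"
      and t: "0 < (t :: real)"
    note unique = free_boundary_solution_unique[OF u0_cont conjunct1[OF sol'] conjunct2[OF sol'] sol t]
    show "u' r t = u r t" if "r \<in> {0..1}" by (rule unique(1)[OF that])
    show "vm' t = u 0 t" "vp' t = u 1 t" by (rule unique(2), rule unique(3))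
  qed (fact sol)+
qed

end
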